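(* Let $\mu$ be a neutral measure on $2^{\mathbb N}$, where $2^{\mathbb N}$ carries the standard metric, and let $D_\mu$ be its dimension probability. Then $D_\mu$ (projectively) dominates a neutral measure on $[0,1]$: there exist a neutral measure $\nu$ on $[0,1]$ and a constant $c>0$ such that $D_\mu(E)\ge c\,\nu(E)$ for every Borel set $E\subseteq[0,1]$.
   Context: Standard metric on $2^{\mathbb N}$: $d(x,y)=2^{-m}$ where $m$ is the least index at which $x,y$ differ ($d(x,x)=0$); $B_r(x)$ is the ball of radius $r$. The pointwise dimension of $x$ with respect to a Borel probability measure $\mu$ is $d_\mu(x)=\liminf_{r\to0}\frac{\log\mu(B_r(x))}{\log r}$. The dimension distribution of $\mu$ is $Ddist(\mu,D)=\mu(\{x:d_\mu(x)\in[0,D]\})$, and the dimension probability $D_\mu$ of $\mu$ is the associated Lebesgue–Stieltjes measure on $[0,\infty)$, i.e. the distribution of $d_\mu(x)$ when $x$ is drawn from $\mu$. Neutral measures on $2^{\mathbb N}$. $2^{<\mathbb N}$ is the set of finite binary strings; for a Borel probability measure $\mu$ on $2^{\mathbb N}$ write $\mu(\sigma)=\mu([\sigma])$. A semimeasure is a function $f:2^{<\mathbb N}\to[0,1]$ with $f(\sigma)\ge f(\sigma\,\hat{}\,0)+f(\sigma\,\hat{}\,1)$; its undergraph is $\{(\sigma,q)\in2^{<\mathbb N}\times\mathbb Q: f(\sigma)>q\}$. A c.e. test is a computably enumerable set $T$ of elements $\big((\sigma_i,q_i)_{i<k},(\sigma,q)\big)\in(2^{<\mathbb N}\times\mathbb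 Q)^{<\mathbb N}\times(2^{<\mathbb N}\times\mathbb Q)$ such that for every Borel probability measure $\mu$ the set of $(\sigma,q)$ for which some $\big((\sigma_i,q_i)_{i<k},(\sigma,q)\big)\in T$ has $\mu(\sigma_i)>q_i$ for all $i<k$ is the undergraph of a semimeasure, denoted $T(\mu)$. A c.e. test $U$ is universal if for every c.e. test $T$ there is a rational $c>0$ with $U(\mu)(\sigma)\ge c\,T(\mu)(\sigma)$ for all $\mu,\sigma$. $\mu$ passes $T$ if $T(\mu)(\sigma)\le\mu(\sigma)$ for all $\sigma$; $\mu$ is neutral if it passes a universal c.e. test. Neutral measures on $[0,1]$. A uniform c.e. test on $[0,1]$ is a function $t:P([0,1])\times[0,1]\to[0,\infty]$ ($P([0,1])$ the Borel probability measures) for which there is a c.e. set $E$ of tuples $\big((I_i,q_i)_{i<k},J,q\big)$, with $I_i,J$ relatively open subintervals of $[0,1]$ with rational endpoints, $q_i\in\mathbb Q$, $q\in\mathbb Q_{\ge0}$, such that $t(\nu,x)=\sup\{q: \exists((I_i,q_i)_{i<k},J,q)\in E,\ \nu(I_i)>q_i\ \forall i<k,\ x\in J\}$ ($\sup\emptyset=0$), and $\int t(\nu,x)\,d\nu(x)\le1$ for every $\nu\in P([0,1])$. A measure $\nu\in P([0,1])$ is neutral on $[0,1]$ if $\sup_{x\in[0,1]}t(\nu,x)<\infty$ for every uniform c.e. test $t$. *)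

theory Defs
  imports "HOL-Probability.Probability" "HOL-Library.Nat_Bijection"
begin

section \<open>Computably enumerable sets\<close>

text \<open>
  Partial recursive functions, as mu-recursive terms with a relational semantics on argument lists.
  Terms carry no arity: a term applied to an argument list of the wrong shape has no value.
  \<open>PrimRec\<close> recurses on the first argument, and its step function receives the recursion
  index, then the previous value, then the parameters.
\<close>

datatype recf =
    Zero
  | Succ
  | Proj nat
  | Comp recf "recf list"
  | PrimRec recf recf
  | Mu recf

inductive computes :: "recf \<Rightarrow> nat list \<Rightarrow> nat \<Rightarrow> bool" where
  Zero: "computes Zero xs 0"
| Succ: "computes Succ [x] (Suc x)"
| Proj: "i < length xs \<Longrightarrow> computes (Proj i) xs (xs ! i)"
| Comp: "list_all2 (\<lambda>g y. computes g xs y) gs ys \<Longrightarrow> computes f ys z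
    \<Longrightarrow> computes (Comp f gs) xs z"
| PrimRec_0: "computes f xs y \<Longrightarrow> computes (PrimRec f g) (0 # xs) y"
| PrimRec_Suc: "computes (PrimRec f g) (n # xs) y \<Longrightarrow> computes g (n # y # xs) z
    \<Longrightarrow> computes (PrimRec f g) (Suc n # xs) z"
| Mu: "computes f (n # xs) 0 \<Longrightarrow> (\<And>m. m < n \<Longrightarrow> \<exists>y. y \<noteq> 0 \<and> computes f (m # xs) y)
    \<Longrightarrow> computes (Mu f) xs n"

definition ce_nat :: "nat set \<Rightarrow> bool" where
  "ce_nat A \<longleftrightarrow> (\<exists>f. A = {n. \<exists>y. computes f [n] y})"

text \<open>Computable enumerability of a set of finite objects, relative to an injective coding
  \<open>enc\<close> with decidable range.\<close>

definition ce :: "('a \<Rightarrow> nat) \<Rightarrow> 'a set \<Rightarrow> bool" where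
  "ce enc A \<longleftrightarrow> ce_nat (enc ` A)"

definition enc_string :: "bool list \<Rightarrow> nat" where
  "enc_string \<sigma> = list_encode (map of_bool \<sigma>)"

definition enc_rat :: "rat \<Rightarrow> nat" where
  "enc_rat q = (case quotient_of q of (a, b) \<Rightarrow> prod_encode (int_encode a, nat b))"

definition enc_pair :: "('a \<Rightarrow> nat) \<Rightarrow> ('b \<Rightarrow> nat) \<Rightarrow> 'a \<times> 'b \<Rightarrow> nat" where
  "enc_pair f g p = prod_encode (f (fst p), g (snd p))"

definition enc_list :: "('a \<Rightarrow> nat) \<Rightarrow> 'a list \<Rightarrow> nat" where
  "enc_list f xs = list_encode (map f xs)"


section \<open>Cantor space and the dimension probability\<close>

text \<open>The type \<open>nat \<Rightarrow> bool\<close> carries the product topology, which is the topology of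
  \<open>cantor_dist\<close>, so \<open>borel\<close> is the intended sigma-algebra.\<close>

definition cantor_measures :: "(nat \<Rightarrow> bool) measure set" where
  "cantor_measures = {\<mu>. prob_space \<mu> \<and> sets \<mu> = sets borel}"

definition cylinder :: "bool list \<Rightarrow> (nat \<Rightarrow> bool) set" where
  "cylinder \<sigma> = {x. \<forall>i < length \<sigma>. x i = \<sigma> ! i}"

definition cantor_dist :: "(nat \<Rightarrow> bool) \<Rightarrow> (nat \<Rightarrow> bool) \<Rightarrow> real" where
  "cantor_dist x y = (if x = y then 0 else 1 / 2 ^ (LEAST m. x m \<noteq> y m))"

definition cantor_ball :: "real \<Rightarrow> (nat \<Rightarrow> bool) \<Rightarrow> (nat \<Rightarrow> bool) set" where
  "cantor_ball r x = {y. cantor_dist x y < r}"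

text \<open>The logarithm of a probability, with \<open>log 0 = -\<infinity>\<close> (whereas \<open>ln 0 = 0\<close> for the
  real logarithm); a point outside the support therefore has pointwise dimension \<open>\<infinity>\<close>.\<close>

definition log_prob :: "real \<Rightarrow> ereal" where
  "log_prob p = (if p = 0 then - \<infinity> else ereal (ln p))"

definition pointwise_dim :: "(nat \<Rightarrow> bool) measure \<Rightarrow> (nat \<Rightarrow> bool) \<Rightarrow> ereal" where
  "pointwise_dim \<mu> x =
    Liminf (at_right 0) (\<lambda>r. log_prob (measure \<mu> (cantor_ball r x)) / ereal (ln r))"

definition Ddist :: "(nat \<Rightarrow> bool) measure \<Rightarrow> real \<Rightarrow> real" where
  "Ddist \<mu> D = measure \<mu> {x. pointwise_dim \<mu> x \<in> {0..ereal D}}"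

text \<open>\<open>Ddist \<mu>\<close> vanishes on the negative reals, so the measure below gives \<open>{0}\<close> the mass
  \<open>Ddist \<mu> 0\<close>.\<close>

definition dim_prob :: "(nat \<Rightarrow> bool) measure \<Rightarrow> real measure" where
  "dim_prob \<mu> = restrict_space (interval_measure (Ddist \<mu>)) {0..}"


section \<open>Neutral measures on Cantor space\<close>

definition semimeasure :: "(bool list \<Rightarrow> real) \<Rightarrow> bool" where
  "semimeasure f \<longleftrightarrow>
    (\<forall>\<sigma>. f \<sigma> \<in> {0..1}) \<and> (\<forall>\<sigma>. f \<sigma> \<ge> f (\<sigma> @ [False]) + f (\<sigma> @ [True]))"

definition undergraph :: "(bool list \<Rightarrow> real) \<Rightarrow> (bool list \<times> rat) set" where
  "undergraph f = {(\<sigma>, q). f \<sigma> > of_rat q}"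

type_synonym test = "((bool list \<times> rat) list \<times> (bool list \<times> rat)) set"

definition test_output :: "test \<Rightarrow> (nat \<Rightarrow> bool) measure \<Rightarrow> (bool list \<times> rat) set" where
  "test_output T \<mu> =
    {p. \<exists>cs. (cs, p) \<in> T \<and> (\<forall>(\<sigma>, q) \<in> set cs. measure \<mu> (cylinder \<sigma>) > of_rat q)}"

definition ce_test :: "test \<Rightarrow> bool" where
  "ce_test T \<longleftrightarrow>
    ce (enc_pair (enc_list (enc_pair enc_string enc_rat)) (enc_pair enc_string enc_rat)) T \<and>
    (\<forall>\<mu> \<in> cantor_measures. \<exists>f. semimeasure f \<and> test_output T \<mu> = undergraph f)"

definition test_semimeasure :: "test \<Rightarrow> (nat \<Rightarrow> bool) measure \<Rightarrow> bool list \<Rightarrow> real" where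
  "test_semimeasure T \<mu> = (THE f. semimeasure f \<and> test_output T \<mu> = undergraph f)"

definition universal_ce_test :: "test \<Rightarrow> bool" where
  "universal_ce_test U \<longleftrightarrow> ce_test U \<and>
    (\<forall>T. ce_test T \<longrightarrow> (\<exists>c::rat. c > 0 \<and>
      (\<forall>\<mu> \<in> cantor_measures. \<forall>\<sigma>.
        test_semimeasure U \<mu> \<sigma> \<ge> of_rat c * test_semimeasure T \<mu> \<sigma>)))"

definition passes :: "(nat \<Rightarrow> bool) measure \<Rightarrow> test \<Rightarrow> bool" where
  "passes \<mu> T \<longleftrightarrow> (\<forall>\<sigma>. test_semimeasure T \<mu> \<sigma> \<le> measure \<mu> (cylinder \<sigma>))"

definition neutral :: "(nat \<Rightarrow> bool) measure \<Rightarrow> bool" where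
  "neutral \<mu> \<longleftrightarrow> \<mu> \<in> cantor_measures \<and> (\<exists>U. universal_ce_test U \<and> passes \<mu> U)"


section \<open>Neutral measures on the unit interval\<close>

definition unit_measures :: "real measure set" where
  "unit_measures = {\<nu>. prob_space \<nu> \<and> sets \<nu> = sets (restrict_space borel {0..1})}"

text \<open>The pair \<open>(a, b)\<close> names the relatively open interval \<open>(a, b) \<inter> [0, 1]\<close>. Since
  \<open>a < 0\<close> and \<open>b > 1\<close> are allowed, the forms \<open>[0, b)\<close>, \<open>(a, 1]\<close> and \<open>[0, 1]\<close>
  are included.\<close>

definition rat_interval :: "rat \<times> rat \<Rightarrow> real set" where
  "rat_interval I = {of_rat (fst I)<..<of_rat (snd I)} \<inter> {0..1}"

type_synonym unit_test = "(((rat \<times> rat) \<times> rat) list \<times> ((rat \<times> rat) \<times> rat)) set"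

definition uniform_ce_test :: "(real measure \<Rightarrow> real \<Rightarrow> ennreal) \<Rightarrow> bool" where
  "uniform_ce_test t \<longleftrightarrow>
    (\<exists>E :: unit_test.
      ce (enc_pair (enc_list (enc_pair (enc_pair enc_rat enc_rat) enc_rat))
                   (enc_pair (enc_pair enc_rat enc_rat) enc_rat)) E \<and>
      (\<forall>(cs, J, q) \<in> E. q \<ge> 0) \<and>
      (\<forall>\<nu> \<in> unit_measures. \<forall>x \<in> {0..1}.
        t \<nu> x = Sup {ennreal (of_rat q) | q. \<exists>cs J. (cs, J, q) \<in> E \<and>
          (\<forall>(I, p) \<in> set cs. measure \<nu> (rat_interval I) > of_rat p) \<and>
          x \<in> rat_interval J})) \<and>
    (\<forall>\<nu> \<in> unit_measures. (\<integral>\<^sup>+ x. t \<nu> x \<partial>\<nu>) \<le> 1)"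

definition neutral_unit :: "real measure \<Rightarrow> bool" where
  "neutral_unit \<nu> \<longleftrightarrow> \<nu> \<in> unit_measures \<and>
    (\<forall>t. uniform_ce_test t \<longrightarrow> (SUP x \<in> {0..1}. t \<nu> x) < \<infinity>)"

end

theory Submission
  imports Defs "HOL-Real_Asymp.Real_Asymp"
begin

text \<open>
  A neutral measure \<open>\<mu>\<close> dominates, up to a constant factor, every semimeasure that is lower
  semicomputable from \<open>\<mu>\<close>. In particular it dominates the uniform measure, so it has full support.
  Let \<open>\<nu>\<close> be the image of \<open>\<mu>\<close> under the binary expansion map. A uniform test \<open>t\<close> on the unit interval
  pulls back to the semimeasure \<open>\<sigma> \<mapsto> \<integral>\<^bsub>[\<sigma>]\<^esub> t(\<nu>, 0.y) d\<mu>(y)\<close> (approximated here from below by finite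
  sums); as \<open>\<mu>\<close> dominates it, \<open>t(\<nu>, 0.y)\<close> is bounded \<open>\<mu>\<close>-almost everywhere, and by lower
  semicontinuity and full support it is bounded everywhere. So \<open>\<nu>\<close> is neutral.

  Now draw \<open>y\<close> from \<open>\<mu>\<close> and independent fair bits \<open>z\<close>, and let \<open>x\<close> be \<open>z\<close> with the bit at every
  position \<open>k\<close> erased for which the \<open>i\<close>-th bit of \<open>y\<close> is 0, where \<open>2\<^sup>i\<close> is the exact power of two
  in \<open>k + 1\<close>. Positions with valuation \<open>i\<close> have density \<open>2\<^sup>-\<^sup>i\<^sup>-\<^sup>1\<close>, so the surviving positions have
  density \<open>0.y\<close>, and among the first \<open>n\<close> they are determined by \<open>log n\<close> bits of \<open>y\<close>. The
  distribution of \<open>x\<close> is computable from \<open>\<mu>\<close>, hence dominated by \<open>\<mu>\<close>; this bounds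
  \<open>d\<^sub>\<mu>(x)\<close> by \<open>0.y\<close> from above. In the other direction, if \<open>s\<^sub>n\<close> of the first \<open>n\<close> positions survive, then
  the expectation of \<open>2\<^bsup>s\<^sub>n\<^esup> \<mu>(x|n)\<close> over \<open>z\<close> is at most 1, so that almost surely
  \<open>\<mu>(x|n) = O(n\<^sup>2 2\<^bsup>-s\<^sub>n\<^esup>)\<close>. Hence almost surely \<open>x\<close> has dimension \<open>0.y\<close>, and the dimension probability of \<open>\<mu>\<close> dominates \<open>\<nu>\<close>.
\<close>

section \<open>Computable functions\<close>

text \<open>Two requirements shape the argument. A test must produce a semimeasure from every Borel
  probability measure, not only from a neutral one. Both tests are therefore built from finitely
  many strict lower bounds on cylinder measures, and such bounds may only be added over disjoint
  cylinders; hence the lists of pairwise distinct or incompatible strings, and hence the integral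
  condition on \<open>t\<close> is used at the image of an arbitrary measure. Secondly, the survival
  pattern must be cheap to describe. The lower bound for \<mu> at \<open>pre x n\<close> contains
  the mass of the cylinder of the \<open>m\<close> bits of \<open>y\<close> that fix the pattern.
  Since \<open>2 ^ m\<close> is of order \<open>n\<close> and \<mu> dominates the uniform measure,
  this costs only a factor of order \<open>1 / n\<close>. So both bounds differ from
  \<open>(1 / 2) ^ active y n\<close> by polynomial factors, which vanish after taking logarithms
  and dividing by \<open>n\<close>; a pattern that depends on linearly many bits would in general
  leave an exponential factor. Once \<open>ce\<close> is known to coincide with
  \<open>semidecidable\<close>, no recursive term has to be exhibited again: closure rules handle
  the tests.\<close>

definition recursive :: "nat \<Rightarrow> (nat list \<Rightarrow> nat) \<Rightarrow> bool" where
  "recursive k F \<longleftrightarrow> (\<exists>r. \<forall>xs. length xs = k \<longrightarrow> computes r xs (F xs))"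

lemma recursive_cong:
  assumes "recursive k F" "\<And>xs. length xs = k \<Longrightarrow> F xs = G xs"
  shows "recursive k G"
  using assms unfolding recursive_def by metis

lemma recursive_nth: "i < k \<Longrightarrow> recursive k (\<lambda>xs. xs ! i)"
  unfolding recursive_def using computes.Proj by metis

lemma recursive_zero: "recursive k (\<lambda>xs. 0)"
  unfolding recursive_def using computes.Zero by metis

lemma recursive_comp1:
  assumes "recursive 1 (\<lambda>xs. g (xs ! 0))" "recursive k F"
  shows "recursive k (\<lambda>xs. g (F xs))"
proof -
  obtain r s where r: "\<And>xs. length xs = 1 \<Longrightarrow> computes r xs (g (xs ! 0))"
    and s: "\<And>xs. length xs = k \<Longrightarrow> computes s xs (F xs)"
    using assms unfolding recursive_def by auto
  have "computes (Comp r [s]) xs (g (F xs))" if "length xs = k" for xs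
    by (rule computes.Comp[where ys = "[F xs]"]) (use s[OF that] r[of "[F xs]"] in auto)
  then show ?thesis unfolding recursive_def by blast
qed

lemma recursive_comp2:
  assumes "recursive 2 (\<lambda>xs. g (xs ! 0) (xs ! 1))" "recursive k F1" "recursive k F2"
  shows "recursive k (\<lambda>xs. g (F1 xs) (F2 xs))"
proof -
  obtain r s t where r: "\<And>xs. length xs = 2 \<Longrightarrow> computes r xs (g (xs ! 0) (xs ! 1))"
    and s: "\<And>xs. length xs = k \<Longrightarrow> computes s xs (F1 xs)"
    and t: "\<And>xs. length xs = k \<Longrightarrow> computes t xs (F2 xs)"
    using assms unfolding recursive_def by auto
  have "computes (Comp r [s, t]) xs (g (F1 xs) (F2 xs))" if "length xs = k" for xs
    by (rule computes.Comp[where ys = "[F1 xs, F2 xs]"])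
      (use s[OF that] t[OF that] r[of "[F1 xs, F2 xs]"] in auto)
  then show ?thesis unfolding recursive_def by blast
qed

lemma recursive_Suc: "recursive k F \<Longrightarrow> recursive k (\<lambda>xs. Suc (F xs))"
proof (rule recursive_comp1[where g = Suc])
  have "computes Succ xs (Suc (xs ! 0))" if "length xs = 1" for xs
    using that computes.Succ by (metis One_nat_def Suc_length_conv length_0_conv nth_Cons_0)
  then show "recursive 1 (\<lambda>xs. Suc (xs ! 0))"
    unfolding recursive_def by blast
qed

lemma recursive_const: "recursive k (\<lambda>xs. c)"
  by (induction c) (auto intro: recursive_zero recursive_Suc)

lemma recursive_rec_nat:
  assumes F: "recursive k F" and G: "recursive (Suc (Suc k)) (\<lambda>ys. G (ys ! 0) (ys ! 1) (drop 2 ys))"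
  shows "recursive (Suc k) (\<lambda>xs. rec_nat (F (tl xs)) (\<lambda>n y. G n y (tl xs)) (hd xs))"
proof -
  obtain r s where r: "\<And>xs. length xs = k \<Longrightarrow> computes r xs (F xs)"
    and s: "\<And>ys. length ys = Suc (Suc k) \<Longrightarrow> computes s ys (G (ys ! 0) (ys ! 1) (drop 2 ys))"
    using assms unfolding recursive_def by auto
  have *: "computes (PrimRec r s) (n # xs) (rec_nat (F xs) (\<lambda>n y. G n y xs) n)"
    if "length xs = k" for n xs
  proof (induction n)
    case 0
    show ?case using computes.PrimRec_0[OF r[OF that]] by simp
  next
    case (Suc n)
    show ?case
      using computes.PrimRec_Suc[OF Suc] s[of "n # rec_nat (F xs) (\<lambda>n y. G n y xs) n # xs"] that
      by simp
  qed
  have "computes (PrimRec r s) xs (rec_nat (F (tl xs)) (\<lambda>n y. G n y (tl xs)) (hd xs))"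
    if "length xs = Suc k" for xs
    using *[of "tl xs" "hd xs"] that by (cases xs) auto
  then show ?thesis unfolding recursive_def by blast
qed

lemma recursive_Least:
  assumes F: "recursive (Suc k) (\<lambda>ys. F (ys ! 0) (tl ys))"
    and ex: "\<And>xs. length xs = k \<Longrightarrow> \<exists>n. F n xs = 0"
  shows "recursive k (\<lambda>xs. LEAST n. F n xs = 0)"
proof -
  obtain r where r: "\<And>ys. length ys = Suc k \<Longrightarrow> computes r ys (F (ys ! 0) (tl ys))"
    using assms unfolding recursive_def by auto
  have "computes (Mu r) xs (LEAST n. F n xs = 0)" if "length xs = k" for xs
  proof (rule computes.Mu)
    have r': "computes r (n # xs) (F n xs)" for n using r[of "n # xs"] that by simp
    have "F (LEAST n. F n xs = 0) xs = 0" using ex[OF that] by (rule LeastI_ex)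
    then show "computes r ((LEAST n. F n xs = 0) # xs) 0" using r'[of "LEAST n. F n xs = 0"] by simp
    show "\<exists>y. y \<noteq> 0 \<and> computes r (m # xs) y" if "m < (LEAST n. F n xs = 0)" for m
      using r'[of m] not_less_Least[OF that] by blast
  qed
  then show ?thesis unfolding recursive_def by blast
qed

lemma recursive_add: "recursive 2 (\<lambda>xs. xs ! 0 + xs ! 1)"
proof (rule recursive_cong)
  show "recursive 2 (\<lambda>xs. rec_nat (tl xs ! 0) (\<lambda>n y. Suc y) (hd xs))"
    unfolding numeral_2_eq_2
    by (rule recursive_rec_nat) (auto intro!: recursive_nth recursive_Suc)
  show "rec_nat (tl xs ! 0) (\<lambda>n y. Suc y) (hd xs) = xs ! 0 + xs ! 1" if "length xs = 2" for xs
  proof -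
    have "rec_nat b (\<lambda>n y. Suc y) a = a + b" for a b by (induction a) auto
    then show ?thesis using that by (auto simp: length_Suc_conv numeral_2_eq_2)
  qed
qed

lemma recursive_mult: "recursive 2 (\<lambda>xs. xs ! 0 * xs ! 1)"
proof (rule recursive_cong)
  show "recursive 2 (\<lambda>xs. rec_nat 0 (\<lambda>n y. y + tl xs ! 0) (hd xs))"
    unfolding numeral_2_eq_2
    apply (rule recursive_rec_nat[where G = "\<lambda>n y xs. y + xs ! 0"])
     apply (rule recursive_zero)
    apply (rule recursive_comp2[OF recursive_add])
     apply (auto intro!: recursive_nth)
    apply (rule recursive_cong[OF recursive_nth[of 2]])
    apply auto
    done
  show "rec_nat 0 (\<lambda>n y. y + tl xs ! 0) (hd xs) = xs ! 0 * xs ! 1" if "length xs = 2" for xs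
  proof -
    have "rec_nat 0 (\<lambda>n y. y + b) a = a * b" for a b :: nat by (induction a) auto
    then show ?thesis using that by (auto simp: length_Suc_conv numeral_2_eq_2)
  qed
qed

lemma recursive_pred: "recursive 1 (\<lambda>xs. xs ! 0 - 1)"
proof (rule recursive_cong)
  show "recursive 1 (\<lambda>xs. rec_nat 0 (\<lambda>n y. n) (hd xs))"
    unfolding One_nat_def
    by (rule recursive_rec_nat) (auto intro!: recursive_nth recursive_zero)
  show "rec_nat 0 (\<lambda>n y. n) (hd xs) = xs ! 0 - 1" if "length xs = 1" for xs
    using that by (cases "hd xs") (auto simp: length_Suc_conv)
qed

lemma recursive_diff: "recursive 2 (\<lambda>xs. xs ! 0 - xs ! 1)"
proof -
  \<comment> \<open>Recursion is on the first argument, whereas subtraction recurses on the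
    subtrahend; hence the arguments are swapped first.\<close>
  have rev: "recursive 2 (\<lambda>xs. xs ! 1 - xs ! 0)"
  proof (rule recursive_cong)
    show "recursive 2 (\<lambda>xs. rec_nat (tl xs ! 0) (\<lambda>n y. y - 1) (hd xs))"
      unfolding numeral_2_eq_2
      by (rule recursive_rec_nat)
        (rule recursive_nth recursive_comp1[OF recursive_pred] | simp)+
    show "rec_nat (tl xs ! 0) (\<lambda>n y. y - 1) (hd xs) = xs ! 1 - xs ! 0" if "length xs = 2" for xs
    proof -
      have "rec_nat b (\<lambda>n y. y - 1) a = b - a" for a b :: nat by (induction a) auto
      then show ?thesis using that by (auto simp: length_Suc_conv numeral_2_eq_2)
    qed
  qed
  show ?thesis
    by (rule recursive_comp2[where g = "\<lambda>a b. b - a", OF rev])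
      (auto intro!: recursive_nth)
qed

lemma recursive_triangle: "recursive 1 (\<lambda>xs. triangle (xs ! 0))"
proof (rule recursive_cong)
  show "recursive 1 (\<lambda>xs. rec_nat 0 (\<lambda>n y. y + Suc n) (hd xs))"
    unfolding One_nat_def
    by (rule recursive_rec_nat)
      (auto intro!: recursive_nth recursive_zero recursive_comp2[OF recursive_add] recursive_Suc)
  show "rec_nat 0 (\<lambda>n y. y + Suc n) (hd xs) = triangle (xs ! 0)" if "length xs = 1" for xs
  proof -
    have "rec_nat 0 (\<lambda>n y. y + Suc n) a = triangle a" for a by (induction a) auto
    then show ?thesis using that by (auto simp: length_Suc_conv)
  qed
qed

lemma recursive_prod_encode: "recursive 2 (\<lambda>xs. prod_encode (xs ! 0, xs ! 1))"
  unfolding prod_encode_def prod.case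
  by (intro recursive_comp2[OF recursive_add] recursive_comp1[OF recursive_triangle])
    (auto intro!: recursive_nth)

lemma le_triangle: "n \<le> triangle n"
  by (induction n) auto

lemma triangle_mono: "m \<le> n \<Longrightarrow> triangle m \<le> triangle n"
  by (induction rule: dec_induct) auto

text \<open>\<open>prod_encode (a, b)\<close> is \<open>triangle (a + b) + a\<close>, so a search
  for the first larger triangular number finds the diagonal \<open>a + b\<close>. The comparison is
  a vanishing truncated difference, as \<open>Mu\<close> demands.\<close>

lemma Least_triangle:
  "(LEAST s. Suc (prod_encode (a, b)) - triangle (Suc s) = 0) = a + b"
proof (rule Least_equality)
  show "Suc (prod_encode (a, b)) - triangle (Suc (a + b)) = 0"
    by (simp add: prod_encode_def)
  fix s assume *: "Suc (prod_encode (a, b)) - triangle (Suc s) = 0"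
  show "a + b \<le> s"
  proof (rule ccontr)
    assume "\<not> a + b \<le> s"
    then have "triangle (Suc s) \<le> triangle (a + b)" by (intro triangle_mono) auto
    then show False using * by (simp add: prod_encode_def)
  qed
qed

lemma recursive_prod_decode:
  "recursive 1 (\<lambda>xs. fst (prod_decode (xs ! 0)))"
  "recursive 1 (\<lambda>xs. snd (prod_decode (xs ! 0)))"
proof -
  define s where "s n = (LEAST s. Suc n - triangle (Suc s) = 0)" for n
  have s: "recursive 1 (\<lambda>xs. s (xs ! 0))"
    unfolding s_def
  proof (rule recursive_Least)
    show "recursive (Suc 1) (\<lambda>ys. Suc (tl ys ! 0) - triangle (Suc (ys ! 0)))"
    proof (intro recursive_comp2[OF recursive_diff] recursive_comp1[OF recursive_triangle]
        recursive_Suc)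
      show "recursive (Suc 1) (\<lambda>xs. tl xs ! 0)"
        by (rule recursive_cong[OF recursive_nth[of 1]]) (auto simp: length_Suc_conv)
    qed (auto intro!: recursive_nth)
    show "\<exists>n. Suc (xs ! 0) - triangle (Suc n) = 0" if "length xs = 1" for xs :: "nat list"
      using le_triangle[of "Suc (xs ! 0)"] by (intro exI[of _ "xs ! 0"]) auto
  qed
  have eq: "fst (prod_decode n) = n - triangle (s n)"
    "snd (prod_decode n) = s n - (n - triangle (s n))" for n
  proof -
    obtain a b where ab: "n = prod_encode (a, b)" by (metis prod_decode_inverse surj_pair)
    have "s n = a + b" unfolding s_def ab by (rule Least_triangle)
    then show "fst (prod_decode n) = n - triangle (s n)"
      "snd (prod_decode n) = s n - (n - triangle (s n))"
      unfolding ab prod_encode_inverse by (simp_all add: prod_encode_def)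
  qed
  show "recursive 1 (\<lambda>xs. fst (prod_decode (xs ! 0)))"
    "recursive 1 (\<lambda>xs. snd (prod_decode (xs ! 0)))"
    unfolding eq
    by (intro recursive_comp2[OF recursive_diff] recursive_comp1[OF recursive_triangle] s
      recursive_nth; simp)+
qed

definition computable_nat :: "(nat \<Rightarrow> nat) \<Rightarrow> bool" where
  "computable_nat f \<longleftrightarrow> recursive 1 (\<lambda>xs. f (xs ! 0))"

lemma computable_nat_comp2:
  assumes "recursive 2 (\<lambda>xs. g (xs ! 0) (xs ! 1))" "computable_nat f1" "computable_nat f2"
  shows "computable_nat (\<lambda>n. g (f1 n) (f2 n))"
  using assms unfolding computable_nat_def by (rule recursive_comp2)

lemma computable_nat_compose:
  assumes "computable_nat g" "computable_nat f"
  shows "computable_nat (\<lambda>n. g (f n))"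
  using assms unfolding computable_nat_def by (rule recursive_comp1)

lemma computable_nat_id: "computable_nat (\<lambda>n. n)"
  unfolding computable_nat_def by (rule recursive_nth) simp

lemma computable_nat_const: "computable_nat (\<lambda>n. c)"
  unfolding computable_nat_def by (rule recursive_const)

lemma computable_nat_Suc: "computable_nat f \<Longrightarrow> computable_nat (\<lambda>n. Suc (f n))"
  unfolding computable_nat_def by (rule recursive_Suc)

lemmas computable_nat_arith =
  computable_nat_comp2[OF recursive_add] computable_nat_comp2[OF recursive_mult]
  computable_nat_comp2[OF recursive_diff] computable_nat_comp2[OF recursive_prod_encode]

lemma computable_nat_prod_decode:
  "computable_nat (\<lambda>n. fst (prod_decode n))" "computable_nat (\<lambda>n. snd (prod_decode n))"
  unfolding computable_nat_def by (rule recursive_prod_decode)+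

text \<open>Parameter, index and previous value are packed into one number, so that from here on
  only unary functions have to be considered.\<close>

lemma computable_nat_rec_nat:
  assumes i: "computable_nat i"
    and s: "computable_nat (\<lambda>z. s (fst (prod_decode z)) (fst (prod_decode (snd (prod_decode z))))
      (snd (prod_decode (snd (prod_decode z)))))"
    and m: "computable_nat m"
  shows "computable_nat (\<lambda>e. rec_nat (i e) (\<lambda>n y. s e n y) (m e))"
proof -
  have s': "recursive 3 (\<lambda>ys. s (ys ! 2) (ys ! 0) (ys ! 1))"
  proof -
    have "recursive 3 (\<lambda>ys. (\<lambda>z. s (fst (prod_decode z)) (fst (prod_decode (snd (prod_decode z))))
      (snd (prod_decode (snd (prod_decode z))))) (prod_encode (ys ! 2, prod_encode (ys ! 0, ys ! 1))))"
      by (rule recursive_comp1[OF s[unfolded computable_nat_def]])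
        (intro recursive_comp2[OF recursive_prod_encode] recursive_nth; simp)
    then show ?thesis by simp
  qed
  have "recursive (Suc 1) (\<lambda>xs. rec_nat (i (tl xs ! 0)) (\<lambda>n y. s (tl xs ! 0) n y) (hd xs))"
  proof (rule recursive_rec_nat[where F = "\<lambda>xs. i (xs ! 0)" and G = "\<lambda>n y xs. s (xs ! 0) n y"])
    show "recursive 1 (\<lambda>xs. i (xs ! 0))" using i by (simp add: computable_nat_def)
    show "recursive (Suc (Suc 1)) (\<lambda>ys. s (drop 2 ys ! 0) (ys ! 0) (ys ! 1))"
      using s' unfolding numeral_2_eq_2 numeral_3_eq_3 One_nat_def by (rule recursive_cong) simp
  qed
  then have "recursive 2 (\<lambda>xs. (\<lambda>a b. rec_nat (i b) (\<lambda>n y. s b n y) a) (xs ! 0) (xs ! 1))"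
    unfolding numeral_2_eq_2 One_nat_def
    by (rule recursive_cong) (auto simp: length_Suc_conv)
  from computable_nat_comp2[OF this m computable_nat_id] show ?thesis .
qed

lemma computable_nat_Least:
  assumes f: "computable_nat (\<lambda>z. f (fst (prod_decode z)) (snd (prod_decode z)))"
    and ex: "\<And>e. \<exists>n. f e n = 0"
  shows "computable_nat (\<lambda>e. LEAST n. f e n = 0)"
  unfolding computable_nat_def
proof (rule recursive_Least)
  have "recursive (Suc 1) (\<lambda>ys. (\<lambda>z. f (fst (prod_decode z)) (snd (prod_decode z)))
      (prod_encode (ys ! 1, ys ! 0)))"
    by (rule recursive_comp1[OF f[unfolded computable_nat_def]])
      (intro recursive_comp2[OF recursive_prod_encode] recursive_nth; simp)
  then show "recursive (Suc 1) (\<lambda>ys. f (tl ys ! 0) (ys ! 0))"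
    by (rule recursive_cong) (auto simp: length_Suc_conv)
qed (use ex in auto)

text \<open>Decoding is total and may send several numbers to one object. Computability of the
  normalisation makes the range of \<open>encode\<close> decidable: \<open>n\<close> lies in it iff
  \<open>encode (decode n) = n\<close>.\<close>

class effective =
  fixes encode :: "'a \<Rightarrow> nat" and decode :: "nat \<Rightarrow> 'a"
  assumes decode_encode [simp]: "decode (encode x) = x"
    and computable_nat_encode_decode: "computable_nat (\<lambda>n. encode (decode n))"

lemma encode_eq_iff [simp]: "encode x = encode y \<longleftrightarrow> x = y"
  by (metis decode_encode)

instantiation nat :: effective
begin
definition encode_nat :: "nat \<Rightarrow> nat" where [simp]: "encode_nat n = n"
definition decode_nat :: "nat \<Rightarrow> nat" where [simp]: "decode_nat n = n"
instance by standard (auto intro: computable_nat_id)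
end

instantiation bool :: effective
begin
definition encode_bool :: "bool \<Rightarrow> nat" where [simp]: "encode_bool b = of_bool b"
definition decode_bool :: "nat \<Rightarrow> bool" where [simp]: "decode_bool n \<longleftrightarrow> n \<noteq> 0"
instance
proof
  have "computable_nat (\<lambda>n. 1 - (1 - n))"
    by (intro computable_nat_arith computable_nat_const computable_nat_id)
  moreover have "(\<lambda>n. 1 - (1 - n)) = (\<lambda>n. encode (decode n :: bool))" by (auto simp: fun_eq_iff)
  ultimately show "computable_nat (\<lambda>n. encode (decode n :: bool))" by simp
qed auto
end

instantiation prod :: (effective, effective) effective
begin
definition encode_prod :: "'a \<times> 'b \<Rightarrow> nat" where
  "encode_prod p = prod_encode (encode (fst p), encode (snd p))"
definition decode_prod :: "nat \<Rightarrow> 'a \<times> 'b" where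
  "decode_prod n = (decode (fst (prod_decode n)), decode (snd (prod_decode n)))"
instance
proof
  show "computable_nat (\<lambda>n. encode (decode n :: 'a \<times> 'b))"
    unfolding encode_prod_def decode_prod_def fst_conv snd_conv
    by (intro computable_nat_arith computable_nat_compose[OF computable_nat_encode_decode]
        computable_nat_prod_decode)
qed (auto simp: encode_prod_def decode_prod_def)
end

section \<open>Closure properties of computable functions between effective types\<close>

definition computable :: "('a::effective \<Rightarrow> 'b::effective) \<Rightarrow> bool" where
  "computable F \<longleftrightarrow> computable_nat (\<lambda>n. encode (F (decode n)))"

named_theorems computable_intros

lemma computable_id [computable_intros]: "computable (\<lambda>x. x)"
  unfolding computable_def by (rule computable_nat_encode_decode)

lemma computable_compose:
  assumes "computable G" "computable F"
  shows "computable (\<lambda>x. G (F x))"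
  using computable_nat_compose[OF assms[unfolded computable_def]] unfolding computable_def by simp

lemma computable_const [computable_intros]: "computable (\<lambda>x. c)"
  unfolding computable_def by (rule computable_nat_const)

lemma computable_fst [computable_intros]:
  assumes "computable F" shows "computable (\<lambda>x. fst (F x))"
proof (rule computable_compose[OF _ assms])
  show "computable (fst :: 'b \<times> 'c \<Rightarrow> 'b)"
    unfolding computable_def decode_prod_def fst_conv
    by (intro computable_nat_compose[OF computable_nat_encode_decode] computable_nat_prod_decode)
qed

lemma computable_snd [computable_intros]:
  assumes "computable F" shows "computable (\<lambda>x. snd (F x))"
proof (rule computable_compose[OF _ assms])
  show "computable (snd :: 'b \<times> 'c \<Rightarrow> 'c)"
    unfolding computable_def decode_prod_def snd_conv
    by (intro computable_nat_compose[OF computable_nat_encode_decode] computable_nat_prod_decode)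
qed

lemma computable_Pair [computable_intros]:
  "computable F \<Longrightarrow> computable G \<Longrightarrow> computable (\<lambda>x. (F x, G x))"
  unfolding computable_def encode_prod_def fst_conv snd_conv by (intro computable_nat_arith)

text \<open>Computability of a binary operation is expressed on pairs through \<open>fst\<close> and
  \<open>snd\<close>; this rule converts such a fact into one about curried application.\<close>

lemma computable_comp2:
  assumes "computable (\<lambda>z. G (fst z) (snd z))" "computable F1" "computable F2"
  shows "computable (\<lambda>x. G (F1 x) (F2 x))"
  using computable_compose[OF assms(1) computable_Pair[OF assms(2,3)]] by simp

lemma computable_comp4:
  assumes "computable (\<lambda>z. S (fst z) (fst (snd z)) (fst (snd (snd z))) (snd (snd (snd z))))"
    "computable F1" "computable F2" "computable F3" "computable F4"
  shows "computable (\<lambda>x. S (F1 x) (F2 x) (F3 x) (F4 x))"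
  using computable_compose[OF assms(1) computable_Pair[OF assms(2) computable_Pair[OF assms(3)
        computable_Pair[OF assms(4,5)]]]] by simp

lemma computable_Suc [computable_intros]: "computable F \<Longrightarrow> computable (\<lambda>x. Suc (F x))"
  unfolding computable_def encode_nat_def by (rule computable_nat_Suc)

lemma computable_arith [computable_intros]:
  fixes F G :: "'a::effective \<Rightarrow> nat"
  shows "computable F \<Longrightarrow> computable G \<Longrightarrow> computable (\<lambda>x. F x + G x)"
    "computable F \<Longrightarrow> computable G \<Longrightarrow> computable (\<lambda>x. F x * G x)"
    "computable F \<Longrightarrow> computable G \<Longrightarrow> computable (\<lambda>x. F x - G x)"
  unfolding computable_def encode_nat_def by (intro computable_nat_arith; simp)+

lemma computable_encode [computable_intros]:
  "computable F \<Longrightarrow> computable (\<lambda>x. encode (F x))"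
  unfolding computable_def encode_nat_def .

lemma computable_decode [computable_intros]:
  assumes "computable F" shows "computable (\<lambda>x. decode (F x))"
  by (rule computable_compose[OF _ assms])
    (simp add: computable_def computable_nat_encode_decode)

lemma computable_boolI:
  assumes "computable (\<lambda>x. of_bool (P x) :: nat)"
  shows "computable P"
  using assms unfolding computable_def by simp

lemma computable_of_bool [computable_intros]:
  "computable P \<Longrightarrow> computable (\<lambda>x. of_bool (P x) :: nat)"
  unfolding computable_def by simp

lemma computable_Not [computable_intros]:
  assumes "computable P" shows "computable (\<lambda>x. \<not> P x)"
proof (rule computable_boolI)
  have "computable (\<lambda>x. 1 - of_bool (P x) :: nat)" by (intro computable_intros assms)
  then show "computable (\<lambda>x. of_bool (\<not> P x) :: nat)"
    by (rule back_subst[where P = computable]) (auto simp: fun_eq_iff)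
qed

lemma computable_conj [computable_intros]:
  assumes "computable P" "computable Q" shows "computable (\<lambda>x. P x \<and> Q x)"
proof (rule computable_boolI)
  have "computable (\<lambda>x. of_bool (P x) * of_bool (Q x) :: nat)" by (intro computable_intros assms)
  then show "computable (\<lambda>x. of_bool (P x \<and> Q x) :: nat)" by (simp add: of_bool_conj)
qed

lemma computable_disj [computable_intros]:
  assumes "computable P" "computable Q" shows "computable (\<lambda>x. P x \<or> Q x)"
proof -
  have "computable (\<lambda>x. \<not> (\<not> P x \<and> \<not> Q x))" by (intro computable_intros assms)
  then show ?thesis by simp
qed

lemma computable_imp [computable_intros]:
  assumes "computable P" "computable Q" shows "computable (\<lambda>x. P x \<longrightarrow> Q x)"
proof -
  have "computable (\<lambda>x. \<not> P x \<or> Q x)" by (intro computable_intros assms)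
  then show ?thesis by simp
qed

text \<open>Case distinction becomes arithmetic: the two codes are weighted by the characteristic
  values of the condition and added.\<close>

lemma computable_if [computable_intros]:
  assumes "computable P" "computable F" "computable G"
  shows "computable (\<lambda>x. if P x then F x else G x)"
proof -
  have "computable (\<lambda>x. of_bool (P x) * encode (F x) + of_bool (\<not> P x) * encode (G x))"
    by (intro computable_intros assms)
  then have "computable (\<lambda>x. encode (if P x then F x else G x))"
    by (rule back_subst[where P = computable]) (auto simp: fun_eq_iff)
  then show ?thesis by (simp add: computable_def)
qed

lemma computable_le_nat [computable_intros]:
  fixes F G :: "'a::effective \<Rightarrow> nat"
  assumes "computable F" "computable G" shows "computable (\<lambda>x. F x \<le> G x)"
proof (rule computable_boolI)
  have "computable (\<lambda>x. 1 - (F x - G x))" by (intro computable_intros assms)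
  then show "computable (\<lambda>x. of_bool (F x \<le> G x) :: nat)"
    by (rule back_subst[where P = computable]) (auto simp: fun_eq_iff)
qed

lemma computable_less_nat [computable_intros]:
  fixes F G :: "'a::effective \<Rightarrow> nat"
  assumes "computable F" "computable G" shows "computable (\<lambda>x. F x < G x)"
  unfolding less_eq_Suc_le by (intro computable_intros assms)

lemma computable_eq [computable_intros]:
  assumes "computable F" "computable G" shows "computable (\<lambda>x. F x = G x)"
proof -
  have "computable (\<lambda>x. encode (F x) \<le> encode (G x) \<and> encode (G x) \<le> encode (F x))"
    by (intro computable_intros assms)
  then show ?thesis by (simp flip: order_eq_iff)
qed

lemma computable_rec_nat [computable_intros]:
  assumes M: "computable M" and I: "computable I"
    and S: "computable (\<lambda>z. S (fst z) (fst (snd z)) (snd (snd z)))"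
  shows "computable (\<lambda>e. rec_nat (I e) (\<lambda>n y. S e n y) (M e))"
proof -
  have eq: "encode (rec_nat (I e) (\<lambda>n y. S e n y) k)
      = rec_nat (encode (I e)) (\<lambda>n y. encode (S e n (decode y))) k" for e k
    by (induction k) (simp_all, metis decode_encode)
  show ?thesis
    unfolding computable_def eq
  proof (rule computable_nat_rec_nat)
    show "computable_nat (\<lambda>n. encode (I (decode n)))" using I by (simp add: computable_def)
    show "computable_nat (\<lambda>n. M (decode n))" using M by (simp add: computable_def)
    show "computable_nat (\<lambda>z. encode (S (decode (fst (prod_decode z)))
        (fst (prod_decode (snd (prod_decode z)))) (decode (snd (prod_decode (snd (prod_decode z)))))))"
      using S by (simp add: computable_def decode_prod_def)
  qed
qed

text \<open>\<open>computable\<close> speaks of total functions, so the search must succeed for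
  every argument. Truth is turned into a zero by \<open>1 - of_bool\<close>.\<close>

lemma computable_Least [computable_intros]:
  assumes P: "computable (\<lambda>z. P (fst z) (snd z))" and ex: "\<And>e. \<exists>n. P e n"
  shows "computable (\<lambda>e. LEAST n::nat. P e n)"
proof -
  have "computable (\<lambda>z. 1 - of_bool (P (fst z) (snd z)) :: nat)" by (intro computable_intros P)
  then have "computable_nat (\<lambda>e. LEAST n. 1 - of_bool (P (decode e) n) = (0::nat))"
    by (intro computable_nat_Least) (use ex in \<open>auto simp: computable_def decode_prod_def\<close>)
  moreover have "1 - of_bool p = (0::nat) \<longleftrightarrow> p" for p by auto
  ultimately show ?thesis by (simp add: computable_def)
qed

lemma computable_all_less [computable_intros]:
  fixes N :: "'a::effective \<Rightarrow> nat"
  assumes "computable (\<lambda>z. P (fst z) (snd z))" "computable N"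
  shows "computable (\<lambda>e. \<forall>i<N e. P e i)"
proof -
  have "computable (\<lambda>e. rec_nat True (\<lambda>i b. b \<and> P e i) (N e))"
    by (intro computable_intros assms(2)
        computable_comp2[where G = P, OF assms(1)])
  moreover have "rec_nat True (\<lambda>i b. b \<and> Q i) n = (\<forall>i<n. Q i)" for Q n
    by (induction n) (auto simp: less_Suc_eq)
  ultimately show ?thesis by simp
qed

lemma computable_ex_less [computable_intros]:
  fixes N :: "'a::effective \<Rightarrow> nat"
  assumes "computable (\<lambda>z. P (fst z) (snd z))" "computable N"
  shows "computable (\<lambda>e. \<exists>i<N e. P e i)"
proof -
  have "computable (\<lambda>e. \<not> (\<forall>i<N e. \<not> P e i))"
    by (rule computable_Not computable_all_less assms)+
  moreover have "(\<lambda>e. \<not> (\<forall>i<N e. \<not> P e i)) = (\<lambda>e. \<exists>i<N e. P e i)" by blast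
  ultimately show ?thesis by (rule subst[of _ _ computable, rotated])
qed

section \<open>Recursion over coded lists; a code bounds the length of its list, hence the number of
  stages\<close>

lemma length_list_decode_le: "length (list_decode n) \<le> n"
proof (induction n rule: list_decode.induct)
  case (2 n)
  obtain x y where xy: "prod_decode n = (x, y)" by fastforce
  then have "y \<le> n" by (metis le_prod_encode_2 prod_decode_inverse)
  then show ?case using 2[OF xy[symmetric]] xy by simp
qed simp

text \<open>A nonempty list has code \<open>Suc (prod_encode (x, c))\<close>. At \<open>0\<close>,
  the code of the empty list, \<open>code_tl\<close> returns \<open>0\<close>, so iterating past the
  end is harmless.\<close>

definition code_tl :: "nat \<Rightarrow> nat" where "code_tl c = snd (prod_decode (c - 1))"
definition code_hd :: "nat \<Rightarrow> nat" where "code_hd c = fst (prod_decode (c - 1))"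

lemma prod_decode_0 [simp]: "prod_decode 0 = (0, 0)"
  by (simp add: prod_decode_def prod_decode_aux.simps)

lemma list_decode_code_tl: "list_decode (code_tl c) = tl (list_decode c)"
  by (cases c) (auto simp: code_tl_def split: prod.splits)

lemma list_decode_code_hd: "c \<noteq> 0 \<Longrightarrow> list_decode c = code_hd c # list_decode (code_tl c)"
  by (cases c) (auto simp: code_hd_def code_tl_def split: prod.splits)

lemma computable_prod_decode:
  "computable F \<Longrightarrow> computable (\<lambda>x. fst (prod_decode (F x)))"
  "computable F \<Longrightarrow> computable (\<lambda>x. snd (prod_decode (F x)))"
  unfolding computable_def encode_nat_def
  by (auto intro: computable_nat_compose[OF computable_nat_prod_decode(1)]
      computable_nat_compose[OF computable_nat_prod_decode(2)])

lemma computable_code_hd_tl: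
  "computable F \<Longrightarrow> computable (\<lambda>x. code_hd (F x))"
  "computable F \<Longrightarrow> computable (\<lambda>x. code_tl (F x))"
  unfolding code_hd_def code_tl_def by (intro computable_prod_decode computable_intros; simp)+

text \<open>The recursion is run from the last element to the first: stage \<open>j\<close> processes the head of the
  suffix obtained by dropping \<open>c - Suc j\<close> elements, and stages where this suffix is empty do nothing.\<close>

lemma rec_list_list_decode:
  "rec_list i (\<lambda>x xs y. s x (list_encode xs) y) (list_decode c)
    = rec_nat i (\<lambda>j y. if (code_tl ^^ (c - Suc j)) c = 0 then y
        else s (code_hd ((code_tl ^^ (c - Suc j)) c)) (code_tl ((code_tl ^^ (c - Suc j)) c)) y) c"
proof -
  define step where "step j y = (if (code_tl ^^ (c - Suc j)) c = 0 then y
        else s (code_hd ((code_tl ^^ (c - Suc j)) c)) (code_tl ((code_tl ^^ (c - Suc j)) c)) y)" for j y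
  define L where "L = rec_list i (\<lambda>x xs y. s x (list_encode xs) y)"
  have drop: "list_decode ((code_tl ^^ k) c) = drop k (list_decode c)" for k
    by (induction k) (auto simp: list_decode_code_tl drop_Suc tl_drop)
  have "j \<le> c \<Longrightarrow> rec_nat i step j = L (drop (c - j) (list_decode c))" for j
  proof (induction j)
    case 0
    then show ?case using length_list_decode_le[of c] by (simp add: L_def)
  next
    case (Suc j)
    define d where "d = (code_tl ^^ (c - Suc j)) c"
    have Suc_diff: "c - j = Suc (c - Suc j)" using Suc.prems by simp
    have d: "list_decode d = drop (c - Suc j) (list_decode c)" unfolding d_def by (rule drop)
    have d': "list_decode (code_tl d) = drop (c - j) (list_decode c)"
      unfolding list_decode_code_tl d Suc_diff by (simp add: drop_Suc tl_drop)
    have IH: "rec_nat i step j = L (drop (c - j) (list_decode c))"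
      using Suc by simp
    show ?case
    proof (cases "d = 0")
      case True
      then have nil: "drop (c - Suc j) (list_decode c) = []" using d by simp
      moreover have "drop (c - j) (list_decode c) = []" using d' True by (simp add: code_tl_def)
      moreover have "step j y = y" for y using True by (simp add: step_def d_def)
      ultimately show ?thesis using IH by (simp add: L_def)
    next
      case False
      from list_decode_code_hd[OF this] d d'
      have eq: "drop (c - Suc j) (list_decode c) = code_hd d # drop (c - j) (list_decode c)" by simp
      have "list_encode (drop (c - j) (list_decode c)) = code_tl d"
        by (metis d' list_decode_inverse)
      then have "L (drop (c - Suc j) (list_decode c)) = s (code_hd d) (code_tl d) (L (drop (c - j) (list_decode c)))"
        unfolding eq by (simp add: L_def)
      moreover have "step j y = s (code_hd d) (code_tl d) y" for y using False by (simp add: step_def d_def)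
      ultimately show ?thesis using IH by simp
    qed
  qed
  from this[of c] show ?thesis unfolding step_def[abs_def] L_def by simp
qed

text \<open>Stated on raw codes because the instance proof for lists, whose normalisation is itself
  a list recursion, depends on it.\<close>

lemma computable_rec_list_code:
  assumes L: "computable L" and I: "computable I"
    and S: "computable (\<lambda>z. S (fst z) (fst (snd z)) (fst (snd (snd z))) (snd (snd (snd z))))"
  shows "computable (\<lambda>e. rec_list (I e) (\<lambda>x xs y. S e x (list_encode xs) y) (list_decode (L e)))"
proof -
  note S4 = computable_comp4[of S, OF S]
  have iter: "(code_tl ^^ k) c = rec_nat c (\<lambda>_. code_tl) k" for k c
    by (induction k) auto
  show ?thesis
    unfolding rec_list_list_decode iter
    by (intro computable_intros S4 computable_code_hd_tl computable_compose[OF L] L I)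
qed

lemma computable_prod_encode:
  "computable F \<Longrightarrow> computable G \<Longrightarrow> computable (\<lambda>x. prod_encode (F x, G x))"
  unfolding computable_def encode_nat_def by (intro computable_nat_arith)

instantiation list :: (effective) effective
begin
definition encode_list :: "'a list \<Rightarrow> nat" where
  "encode_list xs = list_encode (map encode xs)"
definition decode_list :: "nat \<Rightarrow> 'a list" where
  "decode_list n = map decode (list_decode n)"
instance
proof
  have "computable (\<lambda>n. rec_list 0 (\<lambda>x xs y. Suc (prod_encode (encode (decode x :: 'a), y))) (list_decode n))"
    by (intro computable_rec_list_code[where S = "\<lambda>n x c y. Suc (prod_encode (encode (decode x :: 'a), y))"]
        computable_intros computable_prod_encode)
  moreover have "rec_list 0 (\<lambda>x xs y. Suc (prod_encode (encode (decode x :: 'a), y))) xs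
      = list_encode (map (\<lambda>x. encode (decode x :: 'a)) xs)" for xs
    by (induction xs) auto
  ultimately show "computable_nat (\<lambda>n. encode (decode n :: 'a list))"
    by (simp add: computable_def encode_list_def decode_list_def comp_def)
qed (auto simp: encode_list_def decode_list_def comp_def)
end

lemma computable_rec_list [computable_intros]:
  assumes L: "computable L" and I: "computable I"
    and S: "computable (\<lambda>z. S (fst z) (fst (snd z)) (fst (snd (snd z))) (snd (snd (snd z))))"
  shows "computable (\<lambda>e. rec_list (I e) (\<lambda>x xs y. S e x xs y) (L e))"
proof -
  note S4 = computable_comp4[of S, OF S]
  have "computable (\<lambda>e. rec_list (I e) (\<lambda>x xs y. S e (decode x) (decode (list_encode xs)) y)
      (list_decode (encode (L e))))"
    by (intro computable_rec_list_code[where S = "\<lambda>e x c y. S e (decode x) (decode c) y"]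
        computable_intros S4 I computable_compose[OF L] L)
  moreover have "rec_list i (\<lambda>x xs y. s (decode x) (decode (list_encode xs)) y) (map encode l)
      = rec_list i s l" for i and s :: "'b \<Rightarrow> 'b list \<Rightarrow> 'c \<Rightarrow> 'c" and l
    by (induction l) (auto simp: decode_list_def comp_def)
  ultimately show ?thesis by (simp add: encode_list_def)
qed

lemma computable_ball_list [computable_intros]:
  fixes L :: "'a::effective \<Rightarrow> 'b::effective list"
  assumes "computable (\<lambda>z. P (fst z) (snd z))" "computable L"
  shows "computable (\<lambda>e. \<forall>x\<in>set (L e). P e x)"
proof -
  have "computable (\<lambda>e. rec_list True (\<lambda>x xs b. P e x \<and> b) (L e))"
    by (intro computable_intros assms(2) computable_comp2[where G = P, OF assms(1)])
  moreover have "rec_list True (\<lambda>x xs b. Q x \<and> b) l = (\<forall>x\<in>set l. Q x)" for Q :: "'b \<Rightarrow> bool" and l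
    by (induction l) auto
  ultimately show ?thesis by simp
qed

lemma computable_bex_list [computable_intros]:
  fixes L :: "'a::effective \<Rightarrow> 'b::effective list"
  assumes "computable (\<lambda>z. P (fst z) (snd z))" "computable L"
  shows "computable (\<lambda>e. \<exists>x\<in>set (L e). P e x)"
proof -
  have "computable (\<lambda>e. \<not> (\<forall>x\<in>set (L e). \<not> P e x))"
    by (rule computable_Not computable_ball_list assms)+
  moreover have "(\<lambda>e. \<not> (\<forall>x\<in>set (L e). \<not> P e x)) = (\<lambda>e. \<exists>x\<in>set (L e). P e x)" by blast
  ultimately show ?thesis by (rule subst[of _ _ computable, rotated])
qed

lemma computable_mem_list [computable_intros]:
  fixes L :: "'a::effective \<Rightarrow> 'b::effective list"
  assumes "computable F" "computable L"
  shows "computable (\<lambda>e. F e \<in> set (L e))"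
proof -
  have "computable (\<lambda>e. \<exists>x\<in>set (L e). F e = x)"
    by (intro computable_bex_list computable_eq computable_compose[OF assms(1)] computable_fst
        computable_snd computable_id assms)
  then show ?thesis by simp
qed

lemma computable_sorted_wrt [computable_intros]:
  fixes L :: "'a::effective \<Rightarrow> 'b::effective list"
  assumes "computable (\<lambda>z. P (fst z) (snd z))" "computable L"
  shows "computable (\<lambda>e. sorted_wrt P (L e))"
proof -
  have "computable (\<lambda>e. rec_list True (\<lambda>x xs b. (\<forall>y\<in>set xs. P x y) \<and> b) (L e))"
    by (intro computable_intros assms(2) computable_comp2[where G = P, OF assms(1)])
  moreover have "rec_list True (\<lambda>x xs b. (\<forall>y\<in>set xs. P x y) \<and> b) l = sorted_wrt P l" for l
    by (induction l) auto
  ultimately show ?thesis by simp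
qed

lemma computable_Cons [computable_intros]:
  "computable F \<Longrightarrow> computable L \<Longrightarrow> computable (\<lambda>e. F e # L e)"
  unfolding computable_def encode_list_def list.map list_encode.simps encode_nat_def
  by (intro computable_nat_Suc computable_nat_arith)

lemma computable_length [computable_intros]:
  fixes L :: "'a::effective \<Rightarrow> 'b::effective list"
  assumes "computable L"
  shows "computable (\<lambda>e. length (L e))"
proof -
  have "computable (\<lambda>e. rec_list 0 (\<lambda>x xs n. Suc n) (L e))"
    by (intro computable_intros assms)
  moreover have "rec_list 0 (\<lambda>x xs n. Suc n) l = length l" for l :: "'b list"
    by (induction l) auto
  ultimately show ?thesis by simp
qed

lemma computable_drop [computable_intros]:
  fixes L :: "'a::effective \<Rightarrow> 'b::effective list"
  assumes "computable N" "computable L"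
  shows "computable (\<lambda>e. drop (N e) (L e))"
proof -
  have "computable (\<lambda>e. rec_nat (L e) (\<lambda>n l. rec_list [] (\<lambda>x xs y. xs) l) (N e))"
    by (intro computable_intros assms)
  moreover have "rec_list [] (\<lambda>x xs y. xs) l = tl l" for l :: "'b list"
    by (cases l) auto
  moreover have "rec_nat l (\<lambda>n l. tl l) n = drop n l" for n and l :: "'b list"
    by (induction n) (auto simp: drop_Suc tl_drop)
  ultimately show ?thesis by simp
qed

text \<open>\<open>nth_default\<close> replaces \<open>!\<close> in every computable definition,
  since reading past the end must have a known value.\<close>

lemma computable_nth_default [computable_intros]:
  fixes L :: "'a::effective \<Rightarrow> 'b::effective list"
  assumes "computable L" "computable N"
  shows "computable (\<lambda>e. nth_default d (L e) (N e))"
proof -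
  have "computable (\<lambda>e. rec_list d (\<lambda>x xs y. x) (drop (N e) (L e)))"
    by (intro computable_intros assms)
  moreover have "rec_list d (\<lambda>x xs y. x) (drop n l) = nth_default d l n" for n and l :: "'b list"
  proof (induction l arbitrary: n)
    case (Cons a l)
    then show ?case by (cases n) auto
  qed simp
  ultimately show ?thesis by simp
qed

lemma computable_sum_list [computable_intros]:
  fixes F :: "'a::effective \<Rightarrow> 'b::effective \<Rightarrow> 'c::{effective, comm_monoid_add}"
  assumes "computable (\<lambda>z. F (fst z) (snd z))" "computable L"
    and add: "computable (\<lambda>z. fst z + snd z :: 'c)"
  shows "computable (\<lambda>e. \<Sum>x\<leftarrow>L e. F e x)"
proof -
  have "computable (\<lambda>e. rec_list 0 (\<lambda>x xs y. F e x + y) (L e))"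
    by (intro computable_intros computable_comp2[where G = "(+)", OF add]
        computable_comp2[where G = F, OF assms(1)] assms(2))
  moreover have "rec_list 0 (\<lambda>x xs y. G x + y) l = (\<Sum>x\<leftarrow>l. G x)" for l :: "'b list" and G :: "'b \<Rightarrow> 'c"
    by (induction l) auto
  ultimately show ?thesis by simp
qed

lemma computable_prod_lessThan [computable_intros]:
  fixes F :: "'a::effective \<Rightarrow> nat \<Rightarrow> 'c::{effective, comm_monoid_mult}"
  assumes "computable (\<lambda>z. F (fst z) (snd z))" "computable N"
    and mult: "computable (\<lambda>z. fst z * snd z :: 'c)"
  shows "computable (\<lambda>e. \<Prod>i<N e. F e i)"
proof -
  have "computable (\<lambda>e. rec_nat 1 (\<lambda>i y. y * F e i) (N e))"
    by (intro computable_intros computable_comp2[where G = "(*)", OF mult]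
        computable_comp2[where G = F, OF assms(1)] assms(2))
  moreover have "rec_nat 1 (\<lambda>i y. y * G i) n = (\<Prod>i<n. G i)" for n and G :: "nat \<Rightarrow> 'c"
    by (induction n) auto
  ultimately show ?thesis by simp
qed

lemma computable_power_nat [computable_intros]:
  fixes F N :: "'a::effective \<Rightarrow> nat"
  assumes "computable F" "computable N"
  shows "computable (\<lambda>e. F e ^ N e)"
proof -
  have "computable (\<lambda>e. rec_nat 1 (\<lambda>i y. F e * y) (N e))"
    by (intro computable_intros assms(2) computable_compose[OF assms(1)])
  moreover have "rec_nat 1 (\<lambda>i y. a * y) n = a ^ n" for n a :: nat
    by (induction n) auto
  ultimately show ?thesis by simp
qed

lemma computable_dvd_nat [computable_intros]:
  fixes F G :: "'a::effective \<Rightarrow> nat"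
  assumes "computable F" "computable G"
  shows "computable (\<lambda>e. F e dvd G e)"
proof -
  have "computable (\<lambda>e. \<exists>q<Suc (G e). G e = F e * q)"
    by (intro computable_ex_less computable_eq computable_arith computable_Suc
        computable_compose[OF assms(1)] computable_compose[OF assms(2)]
        computable_fst computable_snd computable_id assms)
  moreover have "(\<exists>q<Suc n. n = m * q) = (m dvd n)" for m n :: nat
  proof
    assume "m dvd n"
    then obtain q where q: "n = m * q" by blast
    \<comment> \<open>For \<open>m = 0\<close> the given quotient may exceed the bound, but then
      \<open>n = 0\<close> and the quotient \<open>0\<close> serves.\<close>
    show "\<exists>q<Suc n. n = m * q"
    proof (cases "m = 0")
      case True
      then show ?thesis using q by (intro exI[of _ 0]) auto
    next
      case False
      then show ?thesis using q by (intro exI[of _ q]) (auto simp: less_Suc_eq_le)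
    qed
  qed auto
  ultimately show ?thesis by simp
qed

lemma computable_coprime_nat [computable_intros]:
  fixes F G :: "'a::effective \<Rightarrow> nat"
  assumes "computable F" "computable G"
  shows "computable (\<lambda>e. coprime (F e) (G e))"
proof -
  have "computable (\<lambda>e. \<forall>d<Suc (F e + G e). d dvd F e \<longrightarrow> d dvd G e \<longrightarrow> d = 1)"
    by (intro computable_all_less computable_eq computable_arith computable_Suc
        computable_imp computable_dvd_nat computable_const
        computable_compose[OF assms(1)] computable_compose[OF assms(2)]
        computable_fst computable_snd computable_id assms)
  moreover have "(\<forall>d<Suc (m + n). d dvd m \<longrightarrow> d dvd n \<longrightarrow> d = 1) = coprime m n" for m n :: nat
  proof
    assume *: "\<forall>d<Suc (m + n). d dvd m \<longrightarrow> d dvd n \<longrightarrow> d = 1"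
    show "coprime m n"
    proof (cases "m + n = 0")
      case True
      then show ?thesis using * by auto
    next
      case False
      have "gcd m n \<le> m + n"
      proof (cases "m = 0")
        case False
        from gcd_le1_nat[OF this, of n] show ?thesis by linarith
      qed simp
      then have "gcd m n = 1" using *[rule_format, of "gcd m n"] by simp
      then show ?thesis by (simp only: coprime_iff_gcd_eq_1)
    qed
  next
    assume "coprime m n"
    then show "\<forall>d<Suc (m + n). d dvd m \<longrightarrow> d dvd n \<longrightarrow> d = 1"
      using coprime_common_divisor_nat[of m n] by blast
  qed
  ultimately show ?thesis by simp
qed

section \<open>Integers and rationals as effective types\<close>

instantiation int :: effective
begin
definition encode_int :: "int \<Rightarrow> nat" where "encode_int = int_encode"
definition decode_int :: "nat \<Rightarrow> int" where "decode_int = int_decode"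
instance by standard (auto simp: encode_int_def decode_int_def intro: computable_nat_id)
end

text \<open>\<open>int_encode\<close> uses even codes for nonnegative and odd codes for negative
  integers, so both parts are read off from the halved code. All integer arithmetic is reduced to
  these two parts.\<close>

lemma computable_nat_int:
  assumes "computable F"
  shows "computable (\<lambda>e. nat (F e))" "computable (\<lambda>e. nat (- F e))"
proof -
  define half where "half n = (LEAST k. n \<le> 2 * k + 1)" for n :: nat
  have [computable_intros]: "computable (\<lambda>e. half (G e))" if "computable G" for G :: "'a \<Rightarrow> nat"
    unfolding half_def
    by (intro computable_intros computable_compose[OF that]) presburger
  have half: "half n = n div 2" for n
    unfolding half_def by (rule Least_equality) auto
  have *: "nat i = (if 2 * half (encode i) = encode i then half (encode i) else 0)"
    "nat (- i) = (if 2 * half (encode i) = encode i then 0 else Suc (half (encode i)))" for i :: int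
    by (auto simp: half encode_int_def int_encode_def sum_encode_def nat_eq_iff)
  show "computable (\<lambda>e. nat (F e))" unfolding *(1) by (intro computable_intros assms)
  show "computable (\<lambda>e. nat (- F e))" unfolding *(2) by (intro computable_intros assms)
qed

lemma computable_int_diff_of_nat:
  assumes "computable A" "computable B"
  shows "computable (\<lambda>e. int (A e) - int (B e))"
proof -
  have eq: "encode (int a - int b) = (if b \<le> a then 2 * (a - b) else 2 * (b - a) - 1)" for a b
    by (auto simp: encode_int_def int_encode_def sum_encode_def)
  have "computable (\<lambda>e. encode (int (A e) - int (B e)))"
    unfolding eq by (intro computable_intros assms)
  then show ?thesis by (simp add: computable_def)
qed

lemmas [computable_intros] = computable_nat_int(1)

lemma computable_uminus_int [computable_intros]:
  fixes F :: "'a::effective \<Rightarrow> int"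
  assumes F: "computable F" shows "computable (\<lambda>e. - F e)"
proof -
  have "- i = int (nat (- i)) - int (nat i)" for i by simp
  note this[of "F _"]
  moreover have "computable (\<lambda>e. int (nat (- F e)) - int (nat (F e)))"
    by (intro computable_nat_int computable_int_diff_of_nat F)
  ultimately show ?thesis by simp
qed

lemma computable_int_arith [computable_intros]:
  fixes F G :: "'a::effective \<Rightarrow> int"
  assumes F: "computable F" and G: "computable G"
  shows "computable (\<lambda>e. F e + G e)" "computable (\<lambda>e. F e * G e)" "computable (\<lambda>e. F e < G e)"
proof -
  have "i + j = int (nat i + nat j) - int (nat (- i) + nat (- j))" for i j by simp
  note this[of "F _" "G _"]
  moreover have "computable (\<lambda>e. int (nat (F e) + nat (G e)) - int (nat (- F e) + nat (- G e)))"
    by (intro computable_intros computable_int_diff_of_nat F G)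
  ultimately show "computable (\<lambda>e. F e + G e)" by simp
  have "i * j = int (nat i * nat j + nat (- i) * nat (- j)) - int (nat i * nat (- j) + nat (- i) * nat j)" for i j
    by (cases "i \<ge> 0"; cases "j \<ge> 0") auto
  note this[of "F _" "G _"]
  moreover have "computable (\<lambda>e. int (nat (F e) * nat (G e) + nat (- F e) * nat (- G e))
      - int (nat (F e) * nat (- G e) + nat (- F e) * nat (G e)))"
    by (intro computable_intros computable_int_diff_of_nat F G)
  ultimately show "computable (\<lambda>e. F e * G e)" by simp
  have "(i < j) = (nat i + nat (- j) < nat j + nat (- i))" for i j
    by (cases "i \<ge> 0"; cases "j \<ge> 0") auto
  note this[of "F _" "G _"]
  moreover have "computable (\<lambda>e. nat (F e) + nat (- G e) < nat (G e) + nat (- F e))"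
    by (intro computable_intros F G)
  ultimately show "computable (\<lambda>e. F e < G e)" by simp
qed

lemma computable_int_of_nat [computable_intros]:
  assumes "computable F" shows "computable (\<lambda>e. int (F e))"
  using computable_int_diff_of_nat[OF assms computable_const[of 0]] by simp


lemma encode_int_nat_bij: "encode (decode n :: int \<times> nat) = n"
  by (simp add: encode_prod_def decode_prod_def encode_int_def decode_int_def)

text \<open>Cross-multiplication and coprimality are decidable, so the canonical code of a fraction
  can be found by search, without computing a gcd. The sum \<open>nat a + nat (- a)\<close> is the
  absolute value.\<close>

definition reduced_code :: "int \<times> nat \<Rightarrow> nat \<Rightarrow> bool" where
  "reduced_code p c \<longleftrightarrow> (let q = decode c :: int \<times> nat in
    0 < snd q \<and> fst q * int (snd p) = fst p * int (snd q) \<and>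
    coprime (nat (fst q) + nat (- fst q)) (snd q))"

lemma reduced_code_iff:
  assumes "snd p > 0"
  shows "reduced_code p c \<longleftrightarrow> c = enc_rat (Fract (fst p) (int (snd p)))"
proof -
  have enc: "enc_rat r = encode (fst (quotient_of r), nat (snd (quotient_of r)))" for r
    by (simp add: enc_rat_def encode_prod_def encode_int_def case_prod_beta)
  define q where "q = (decode c :: int \<times> nat)"
  have c: "c = encode q" unfolding q_def by (simp add: encode_int_nat_bij)
  have abs: "int (nat a + nat (- a)) = \<bar>a\<bar>" for a :: int by simp
  have "reduced_code p c \<longleftrightarrow> 0 < snd q \<and> Fract (fst q) (int (snd q)) = Fract (fst p) (int (snd p))
      \<and> coprime (fst q) (int (snd q))"
    using assms unfolding reduced_code_def Let_def q_def[symmetric] coprime_int_iff[symmetric] abs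
    by (auto simp: eq_rat)
  also have "\<dots> \<longleftrightarrow> quotient_of (Fract (fst p) (int (snd p))) = (fst q, int (snd q))"
  proof
    assume *: "0 < snd q \<and> Fract (fst q) (int (snd q)) = Fract (fst p) (int (snd p))
      \<and> coprime (fst q) (int (snd q))"
    then show "quotient_of (Fract (fst p) (int (snd p))) = (fst q, int (snd q))"
      unfolding quotient_of_def
      by (intro the1_equality[OF quotient_of_unique]) auto
  next
    assume *: "quotient_of (Fract (fst p) (int (snd p))) = (fst q, int (snd q))"
    show "0 < snd q \<and> Fract (fst q) (int (snd q)) = Fract (fst p) (int (snd p))
      \<and> coprime (fst q) (int (snd q))"
      using quotient_of_eq[OF *] quotient_of_denom_pos[OF *] quotient_of_coprime[OF *] by simp
  qed
  also have "\<dots> \<longleftrightarrow> c = enc_rat (Fract (fst p) (int (snd p)))"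
    using quotient_of_denom_pos'[of "Fract (fst p) (int (snd p))"]
    unfolding enc c encode_eq_iff by (auto simp: prod_eq_iff)
  finally show ?thesis .
qed

instantiation rat :: effective
begin
definition encode_rat :: "rat \<Rightarrow> nat" where "encode_rat = enc_rat"
definition decode_rat :: "nat \<Rightarrow> rat" where
  "decode_rat n = Fract (fst (decode n :: int \<times> nat)) (int (snd (decode n :: int \<times> nat)))"
instance
proof
  show "decode (encode x) = x" for x :: rat
  proof -
    obtain a b where ab: "quotient_of x = (a, b)" by fastforce
    then have "b > 0" by (rule quotient_of_denom_pos)
    moreover have "decode (encode x) = Fract a (int (nat b))"
      unfolding decode_rat_def encode_rat_def enc_rat_def ab
      by (simp add: decode_prod_def decode_int_def)
    ultimately show ?thesis using quotient_of_div[OF ab] by (simp add: Fract_of_int_quotient)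
  qed
  \<comment> \<open>\<open>Fract a 0\<close> equals \<open>0\<close>; replacing such a pair by
    \<open>(0, 1)\<close> gives a positive denominator and leaves the decoded rational
    unchanged.\<close>
  define p where "p n = (if snd (decode n :: int \<times> nat) = 0 then (0, 1) else (decode n :: int \<times> nat))" for n
  have p: "snd (p n) > 0" "decode n = Fract (fst (p n)) (int (snd (p n)))" for n
    by (auto simp: p_def decode_rat_def eq_rat rat_number_collapse)
  have "computable (\<lambda>n. LEAST c. reduced_code (p n) c)"
  proof (rule computable_Least)
    show "computable (\<lambda>z. reduced_code (p (fst z)) (snd z))"
      unfolding reduced_code_def p_def Let_def by (intro computable_intros)
  qed (use p(1) reduced_code_iff in blast)
  moreover have "(LEAST c. reduced_code (p n) c) = encode (decode n :: rat)" for n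
    unfolding reduced_code_iff[OF p(1)] p(2) encode_rat_def by (rule Least_equality) auto
  ultimately show "computable_nat (\<lambda>n. encode (decode n :: rat))"
    by (simp add: computable_def)
qed
end

lemma encode_rat_quotient_of:
  "encode q = encode (fst (quotient_of q), nat (snd (quotient_of q)))"
  by (simp add: encode_rat_def enc_rat_def encode_prod_def encode_int_def case_prod_beta)

lemma computable_quotient_of:
  assumes "computable F"
  shows "computable (\<lambda>e. fst (quotient_of (F e)))" "computable (\<lambda>e. nat (snd (quotient_of (F e))))"
proof -
  have *: "computable (\<lambda>e. (fst (quotient_of (F e)), nat (snd (quotient_of (F e)))))"
    using assms unfolding computable_def encode_rat_quotient_of .
  show "computable (\<lambda>e. fst (quotient_of (F e)))" "computable (\<lambda>e. nat (snd (quotient_of (F e))))"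
    using computable_fst[OF *] computable_snd[OF *] by simp_all
qed

lemma computable_Fract:
  assumes "computable A" "computable B"
  shows "computable (\<lambda>e. Fract (A e) (int (B e)))"
  using computable_decode[OF computable_encode[OF computable_Pair[OF assms]], where 'b = rat]
  by (simp add: decode_rat_def)

lemma computable_rat_arith [computable_intros]:
  fixes F G :: "'a::effective \<Rightarrow> rat"
  assumes F: "computable F" and G: "computable G"
  shows "computable (\<lambda>e. F e + G e)" "computable (\<lambda>e. F e * G e)" "computable (\<lambda>e. F e < G e)"
proof -
  define n d where "n q = fst (quotient_of q)" and "d q = nat (snd (quotient_of q))" for q
  have pos: "d q > 0" for q
    using quotient_of_denom_pos'[of q] by (simp add: d_def)
  have eq: "q = Fract (n q) (int (d q))" for q
    using quotient_of_div[of q "n q" "int (d q)"] quotient_of_denom_pos'[of q]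
    by (simp add: n_def d_def Fract_of_int_quotient)
  have plus: "q + r = Fract (n q * int (d r) + n r * int (d q)) (int (d q * d r))" for q r
    using pos[of q] pos[of r] by (subst (1 2) eq) simp
  have times: "q * r = Fract (n q * n r) (int (d q * d r))" for q r
    by (subst (1 2) eq) simp
  have less: "q < r \<longleftrightarrow> n q * int (d r) < n r * int (d q)" for q r
    using pos[of q] pos[of r] by (subst (1 2) eq) simp
  note c = computable_quotient_of[folded n_def d_def]
  show "computable (\<lambda>e. F e + G e)" "computable (\<lambda>e. F e * G e)" "computable (\<lambda>e. F e < G e)"
    unfolding plus times less by (intro computable_intros computable_Fract c F G)+
qed

section \<open>Semidecidable predicates and the normal form theorem\<close>

definition semidecidable :: "('a::effective \<Rightarrow> bool) \<Rightarrow> bool" where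
  "semidecidable P \<longleftrightarrow> (\<exists>R. computable (\<lambda>z. R (fst z) (snd z :: nat)) \<and> (\<forall>e. P e \<longleftrightarrow> (\<exists>w. R e w)))"

named_theorems semidecidable_intros

lemma semidecidable_computable:
  assumes "computable P" shows "semidecidable P"
  unfolding semidecidable_def
  by (intro exI[of _ "\<lambda>e w. P e"] conjI computable_compose[OF assms] computable_fst computable_id) auto

lemma semidecidable_compose:
  assumes "semidecidable P" "computable F"
  shows "semidecidable (\<lambda>e. P (F e))"
proof -
  obtain R where R: "computable (\<lambda>z. R (fst z) (snd z :: nat))" "\<And>e. P e \<longleftrightarrow> (\<exists>w. R e w)"
    using assms(1) unfolding semidecidable_def by auto
  show ?thesis
    unfolding semidecidable_def R(2)
    by (intro exI[of _ "\<lambda>e w. R (F e) w"] conjI computable_comp2[where G = R, OF R(1)]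
        computable_compose[OF assms(2)] computable_intros) auto
qed

lemma semidecidable_comp2:
  assumes "semidecidable (\<lambda>z. P (fst z) (snd z))" "computable F" "computable G"
  shows "semidecidable (\<lambda>e. P (F e) (G e))"
  using semidecidable_compose[OF assms(1) computable_Pair[OF assms(2,3)]] by simp

lemma semidecidable_ex [semidecidable_intros]:
  fixes P :: "'a::effective \<Rightarrow> 'b::effective \<Rightarrow> bool"
  assumes "semidecidable (\<lambda>z. P (fst z) (snd z))"
  shows "semidecidable (\<lambda>e. \<exists>x. P e x)"
proof -
  obtain R where R: "computable (\<lambda>z. R (fst z) (snd z :: nat))"
    "\<And>e x. P e x \<longleftrightarrow> (\<exists>w. R (e, x) w)"
    using assms unfolding semidecidable_def by auto
  have eq: "(\<exists>x. P e x) \<longleftrightarrow> (\<exists>w. R (e, fst (decode w :: 'b \<times> nat)) (snd (decode w :: 'b \<times> nat)))" for e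
    unfolding R(2) by (metis decode_encode fst_conv snd_conv)
  show ?thesis
    unfolding semidecidable_def eq
    by (intro exI[of _ "\<lambda>e w. R (e, fst (decode w :: 'b \<times> nat)) (snd (decode w :: 'b \<times> nat))"] conjI
        computable_comp2[where G = R, OF R(1)] computable_intros) auto
qed

lemma semidecidable_conj [semidecidable_intros]:
  assumes "semidecidable P" "semidecidable Q"
  shows "semidecidable (\<lambda>e. P e \<and> Q e)"
proof -
  obtain R S where R: "computable (\<lambda>z. R (fst z) (snd z :: nat))" "\<And>e. P e \<longleftrightarrow> (\<exists>w. R e w)"
    and S: "computable (\<lambda>z. S (fst z) (snd z :: nat))" "\<And>e. Q e \<longleftrightarrow> (\<exists>w. S e w)"
    using assms unfolding semidecidable_def by auto
  have "semidecidable (\<lambda>e. \<exists>w. \<exists>v. R e w \<and> S e v)"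
    by (intro semidecidable_ex semidecidable_computable computable_conj
        computable_comp2[where G = R, OF R(1)] computable_comp2[where G = S, OF S(1)] computable_intros)
  then show ?thesis unfolding R(2) S(2) by simp
qed

text \<open>A common bound for finitely many witnesses lets a bounded universal quantifier pass
  inside: a single number \<open>W\<close> is searched for, and the rest is a bounded check.\<close>

lemma bounded_witnesses:
  fixes R :: "'a \<Rightarrow> nat \<Rightarrow> bool"
  assumes "finite A" "\<And>x. x \<in> A \<Longrightarrow> \<exists>w. R x w"
  shows "\<exists>W. \<forall>x\<in>A. \<exists>w<W. R x w"
  using assms
proof (induction A)
  case (insert a A)
  obtain W where W: "\<forall>x\<in>A. \<exists>w<W. R x w" using insert by auto
  obtain w where w: "R a w" using insert.prems by auto
  have "\<forall>x\<in>insert a A. \<exists>v<max W (Suc w). R x v"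
    using W w by (auto simp: less_max_iff_disj)
  then show ?case by blast
qed simp

lemma semidecidable_ball_list [semidecidable_intros]:
  fixes L :: "'a::effective \<Rightarrow> 'b::effective list"
  assumes P: "semidecidable (\<lambda>z. P (fst z) (snd z))" and L: "computable L"
  shows "semidecidable (\<lambda>e. \<forall>x\<in>set (L e). P e x)"
proof -
  obtain R where R: "computable (\<lambda>z. R (fst z) (snd z :: nat))"
    "\<And>e x. P e x \<longleftrightarrow> (\<exists>w. R (e, x) w)"
    using P unfolding semidecidable_def by auto
  have "semidecidable (\<lambda>e. \<exists>W::nat. \<forall>x\<in>set (L e). \<exists>w<W. R (e, x) w)"
    by (intro semidecidable_ex semidecidable_computable computable_ball_list computable_ex_less
        computable_comp2[where G = R, OF R(1)] computable_compose[OF L]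
        computable_Pair computable_fst computable_snd computable_id)
  moreover have "(\<forall>x\<in>set (L e). P e x) \<longleftrightarrow> (\<exists>W::nat. \<forall>x\<in>set (L e). \<exists>w<W. R (e, x) w)" for e
    unfolding R(2) using bounded_witnesses[of "set (L e)" "\<lambda>x w. R (e, x) w"] by auto
  ultimately show ?thesis by simp
qed

lemma semidecidable_all_less [semidecidable_intros]:
  fixes N :: "'a::effective \<Rightarrow> nat"
  assumes P: "semidecidable (\<lambda>z. P (fst z) (snd z))" and N: "computable N"
  shows "semidecidable (\<lambda>e. \<forall>i<N e. P e i)"
proof -
  obtain R where R: "computable (\<lambda>z. R (fst z) (snd z :: nat))"
    "\<And>e x. P e x \<longleftrightarrow> (\<exists>w. R (e, x) w)"
    using P unfolding semidecidable_def by auto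
  have "semidecidable (\<lambda>e. \<exists>W::nat. \<forall>i<N e. \<exists>w<W. R (e, i) w)"
    by (intro semidecidable_ex semidecidable_computable computable_all_less computable_ex_less
        computable_comp2[where G = R, OF R(1)] computable_compose[OF N]
        computable_Pair computable_fst computable_snd computable_id)
  moreover have "(\<forall>i<N e. P e i) \<longleftrightarrow> (\<exists>W::nat. \<forall>i<N e. \<exists>w<W. R (e, i) w)" for e
    unfolding R(2) using bounded_witnesses[of "{..<N e}" "\<lambda>x w. R (e, x) w"]
    unfolding Ball_def lessThan_iff by blast
  ultimately show ?thesis by simp
qed

section \<open>The evaluation relation of a fixed term is functional and semidecidable\<close>

lemma computes_Zero_iff: "computes Zero xs y \<longleftrightarrow> y = 0"
  by (auto intro: computes.Zero elim: computes.cases)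

lemma computes_Succ_iff: "computes Succ xs y \<longleftrightarrow> (\<exists>x. xs = [x] \<and> y = Suc x)"
  by (auto intro: computes.Succ elim: computes.cases)

lemma computes_Proj_iff: "computes (Proj i) xs y \<longleftrightarrow> i < length xs \<and> y = nth_default 0 xs i"
  by (auto simp: nth_default_def intro: computes.Proj elim: computes.cases)

lemma computes_Comp_iff:
  "computes (Comp f gs) xs z \<longleftrightarrow> (\<exists>ys. list_all2 (\<lambda>g. computes g xs) gs ys \<and> computes f ys z)"
proof
  show "computes (Comp f gs) xs z \<Longrightarrow> \<exists>ys. list_all2 (\<lambda>g. computes g xs) gs ys \<and> computes f ys z"
    by (erule computes.cases) auto
qed (auto intro: computes.Comp)

lemma computes_Mu_iff:
  "computes (Mu f) xs n \<longleftrightarrow> computes f (n # xs) 0 \<and> (\<forall>m<n. \<exists>y. y \<noteq> 0 \<and> computes f (m # xs) y)"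
proof
  show "computes (Mu f) xs n \<Longrightarrow> computes f (n # xs) 0 \<and> (\<forall>m<n. \<exists>y. y \<noteq> 0 \<and> computes f (m # xs) y)"
    by (erule computes.cases) auto
qed (auto intro: computes.Mu)

lemma computes_PrimRec_0_iff: "computes (PrimRec f g) (0 # xs) y \<longleftrightarrow> computes f xs y"
  by (auto intro: computes.PrimRec_0 elim: computes.cases)

lemma computes_PrimRec_Suc_iff:
  "computes (PrimRec f g) (Suc n # xs) z
    \<longleftrightarrow> (\<exists>y. computes (PrimRec f g) (n # xs) y \<and> computes g (n # y # xs) z)"
proof
  show "computes (PrimRec f g) (Suc n # xs) z
    \<Longrightarrow> \<exists>y. computes (PrimRec f g) (n # xs) y \<and> computes g (n # y # xs) z"
    by (erule computes.cases) auto
qed (auto intro: computes.PrimRec_Suc)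

lemma computes_PrimRec_Nil: "\<not> computes (PrimRec f g) [] y"
  by (auto elim: computes.cases)

text \<open>The list of intermediate values is one finite witness for a recursion of arbitrary
  depth. Thanks to \<open>nth_default\<close> the list needs no length condition.\<close>

lemma computes_PrimRec_history:
  "computes (PrimRec f g) (n # xs) y \<longleftrightarrow>
    (\<exists>l. computes f xs (nth_default 0 l 0)
      \<and> (\<forall>i<n. computes g (i # nth_default 0 l i # xs) (nth_default 0 l (Suc i)))
      \<and> y = nth_default 0 l n)"
proof
  have "computes (PrimRec f g) (n # xs) y \<Longrightarrow>
    \<exists>l. length l = Suc n \<and> computes f xs (l ! 0)
      \<and> (\<forall>i<n. computes g (i # l ! i # xs) (l ! Suc i)) \<and> y = l ! n"
  proof (induction n arbitrary: y)
    case 0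
    then show ?case by (intro exI[of _ "[y]"]) (simp add: computes_PrimRec_0_iff)
  next
    case (Suc n)
    from Suc.prems obtain y' where y': "computes (PrimRec f g) (n # xs) y'" "computes g (n # y' # xs) y"
      unfolding computes_PrimRec_Suc_iff by auto
    from Suc.IH[OF y'(1)] obtain l where l: "length l = Suc n" "computes f xs (l ! 0)"
      "\<forall>i<n. computes g (i # l ! i # xs) (l ! Suc i)" "y' = l ! n" by auto
    show ?case
      by (intro exI[of _ "l @ [y]"]) (use l y'(2) in \<open>auto simp: nth_append less_Suc_eq\<close>)
  qed
  moreover assume "computes (PrimRec f g) (n # xs) y"
  ultimately obtain l where l: "length l = Suc n" "computes f xs (l ! 0)"
      "\<forall>i<n. computes g (i # l ! i # xs) (l ! Suc i)" "y = l ! n" by blast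
  show "\<exists>l. computes f xs (nth_default 0 l 0)
      \<and> (\<forall>i<n. computes g (i # nth_default 0 l i # xs) (nth_default 0 l (Suc i)))
      \<and> y = nth_default 0 l n"
    by (intro exI[of _ l]) (use l in \<open>simp add: nth_default_nth\<close>)
next
  assume "\<exists>l. computes f xs (nth_default 0 l 0)
      \<and> (\<forall>i<n. computes g (i # nth_default 0 l i # xs) (nth_default 0 l (Suc i)))
      \<and> y = nth_default 0 l n"
  then obtain l where l: "computes f xs (nth_default 0 l 0)"
      "\<forall>i<n. computes g (i # nth_default 0 l i # xs) (nth_default 0 l (Suc i))"
      "y = nth_default 0 l n" by auto
  have "i \<le> n \<Longrightarrow> computes (PrimRec f g) (i # xs) (nth_default 0 l i)" for i
    by (induction i) (use l in \<open>auto intro: computes.intros\<close>)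
  then show "computes (PrimRec f g) (n # xs) y" using l(3) by simp
qed

text \<open>Used to know that a term realising a characteristic function has no further value there.
  For \<open>Mu\<close>, two different results would make the smaller one both a zero and a nonzero
  of the searched function.\<close>

lemma computes_functional: "computes f xs y \<Longrightarrow> computes f xs z \<Longrightarrow> y = z"
proof (induction arbitrary: z rule: computes.induct)
  case (Comp xs gs ys f y)
  from Comp.prems obtain ys' where ys': "list_all2 (\<lambda>g. computes g xs) gs ys'" "computes f ys' z"
    unfolding computes_Comp_iff by auto
  have "ys = ys'"
    using Comp.IH(1) ys'(1) by (auto simp: list_all2_conv_all_nth intro: nth_equalityI)
  then show ?case using Comp.IH ys'(2) by auto
next
  case (PrimRec_Suc f g n xs y z')
  then show ?case unfolding computes_PrimRec_Suc_iff by blast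
next
  case (Mu f n xs)
  from Mu.prems have z: "computes f (z # xs) 0" "\<forall>m<z. \<exists>y. y \<noteq> 0 \<and> computes f (m # xs) y"
    unfolding computes_Mu_iff by auto
  show ?case
  proof (cases n z rule: linorder_cases)
    case less
    then show ?thesis using z(2) Mu.IH(1) by force
  next
    case greater
    then show ?thesis using Mu.IH(2)[of z] z(1) by force
  qed simp
qed (auto simp: computes_Zero_iff computes_Succ_iff computes_Proj_iff computes_PrimRec_0_iff nth_default_def)

lemma semidecidable_list_all2:
  assumes "\<And>g. g \<in> set gs \<Longrightarrow> semidecidable (\<lambda>z. C g (fst z) (snd z))"
  shows "semidecidable (\<lambda>z. list_all2 (\<lambda>g. C g (fst z)) gs (snd z))"
  using assms
proof (induction gs)
  case Nil
  show ?case unfolding list_all2_Nil by (intro semidecidable_computable computable_intros)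
next
  case (Cons g gs)
  show ?case
    unfolding list_all2_Cons1
    by (intro semidecidable_ex semidecidable_conj
        semidecidable_comp2[where P = "C g", OF Cons.prems[of g]]
        semidecidable_comp2[where P = "\<lambda>x. list_all2 (\<lambda>g. C g x) gs", OF Cons.IH[OF Cons.prems]])
      (auto intro!: semidecidable_computable computable_intros)
qed

text \<open>By induction on the term, so that no universal machine is needed.\<close>

lemma semidecidable_computes: "semidecidable (\<lambda>z. computes f (fst z) (snd z))"
proof (induction f)
  case Zero
  show ?case unfolding computes_Zero_iff by (intro semidecidable_computable computable_intros)
next
  case Succ
  show ?case unfolding computes_Succ_iff
    by (intro semidecidable_ex semidecidable_computable computable_intros)
next
  case (Proj i)
  show ?case unfolding computes_Proj_iff by (intro semidecidable_computable computable_intros)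
next
  case (Comp f gs)
  show ?case unfolding computes_Comp_iff
    by (intro semidecidable_ex semidecidable_conj
        semidecidable_comp2[where P = "computes f", OF Comp(1)]
        semidecidable_comp2[where P = "\<lambda>x. list_all2 (\<lambda>g. computes g x) gs",
          OF semidecidable_list_all2[OF Comp(2)]] computable_intros)
next
  case (PrimRec f g)
  have eq: "computes (PrimRec f g) xs y \<longleftrightarrow> (\<exists>n ys l. xs = n # ys \<and> computes f ys (nth_default 0 l 0)
      \<and> (\<forall>i<n. computes g (i # nth_default 0 l i # ys) (nth_default 0 l (Suc i)))
      \<and> y = nth_default 0 l n)" for xs y
    by (cases xs) (simp_all add: computes_PrimRec_Nil computes_PrimRec_history)
  show ?case
    unfolding eq
    by (intro semidecidable_ex semidecidable_conj semidecidable_all_less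
        semidecidable_comp2[where P = "computes f", OF PrimRec(1)]
        semidecidable_comp2[where P = "computes g", OF PrimRec(2)]
        semidecidable_computable[OF computable_eq] computable_intros)
next
  case (Mu f)
  show ?case
    unfolding computes_Mu_iff
    by (intro semidecidable_ex semidecidable_conj semidecidable_all_less
        semidecidable_comp2[where P = "computes f", OF Mu]
        semidecidable_computable[OF computable_Not] computable_intros)
qed

text \<open>The domain of a term is semidecidable because evaluation is; conversely a
  \<open>Mu\<close> search for a witness halts exactly on the members.\<close>

lemma ce_nat_iff_semidecidable: "ce_nat A \<longleftrightarrow> semidecidable (\<lambda>n. n \<in> A)"
proof
  assume "ce_nat A"
  then obtain f where A: "A = {n. \<exists>y. computes f [n] y}" unfolding ce_nat_def by auto
  show "semidecidable (\<lambda>n. n \<in> A)"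
    unfolding A mem_Collect_eq
    by (intro semidecidable_ex semidecidable_comp2[where P = "computes f", OF semidecidable_computes]
        computable_intros)
next
  assume "semidecidable (\<lambda>n. n \<in> A)"
  then obtain R where R: "computable (\<lambda>z. R (fst z) (snd z :: nat))" "\<And>n. n \<in> A \<longleftrightarrow> (\<exists>w. R n w)"
    unfolding semidecidable_def by auto
  have "computable (\<lambda>z::nat. 1 - of_bool (R (snd (prod_decode z)) (fst (prod_decode z))) :: nat)"
    by (intro computable_intros computable_comp2[where G = R, OF R(1)] computable_prod_decode)
  then have "recursive 1 (\<lambda>xs. 1 - of_bool (R (snd (prod_decode (xs ! 0))) (fst (prod_decode (xs ! 0)))))"
    by (simp add: computable_def computable_nat_def)
  from recursive_comp1[OF this recursive_prod_encode]
  have "recursive 2 (\<lambda>xs. 1 - of_bool (R (xs ! 1) (xs ! 0)))" by simp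
  then obtain r where r: "\<And>xs. length xs = 2 \<Longrightarrow> computes r xs (1 - of_bool (R (xs ! 1) (xs ! 0)))"
    unfolding recursive_def by auto
  have r': "computes r [w, n] y \<longleftrightarrow> y = 1 - of_bool (R n w)" for w n y
    using r[of "[w, n]"] computes_functional[of r "[w, n]"] by auto
  have "n \<in> A \<longleftrightarrow> (\<exists>y. computes (Mu r) [n] y)" for n
  proof
    assume "n \<in> A"
    then have ex: "\<exists>w. R n w" by (simp add: R(2))
    have "computes (Mu r) [n] (LEAST w. R n w)"
      unfolding computes_Mu_iff r'
      using LeastI_ex[OF ex] by (auto dest: not_less_Least)
    then show "\<exists>y. computes (Mu r) [n] y" by blast
  next
    assume "\<exists>y. computes (Mu r) [n] y"
    then obtain y where "computes r [y, n] 0" unfolding computes_Mu_iff by auto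
    then have "R n y" unfolding r' by (cases "R n y") auto
    then show "n \<in> A" unfolding R(2) by blast
  qed
  then show "ce_nat A" unfolding ce_nat_def by blast
qed

text \<open>Transfer between objects and codes is possible because the range of
  \<open>encode\<close> is decidable.\<close>

lemma ce_encode_iff: "ce encode A \<longleftrightarrow> semidecidable (\<lambda>x. x \<in> A)"
proof -
  have mem: "n \<in> encode ` A \<longleftrightarrow> decode n \<in> A \<and> encode (decode n :: 'a) = n" for n :: nat
    by (metis decode_encode image_iff)
  have mem': "x \<in> A \<longleftrightarrow> encode x \<in> encode ` A" for x :: 'a
    by auto
  show ?thesis
    unfolding ce_def ce_nat_iff_semidecidable
  proof
    assume "semidecidable (\<lambda>n. n \<in> encode ` A)"
    then show "semidecidable (\<lambda>x. x \<in> A)"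
      unfolding mem' by (rule semidecidable_compose) (intro computable_intros)
  next
    assume A: "semidecidable (\<lambda>x. x \<in> A)"
    show "semidecidable (\<lambda>n. n \<in> encode ` A)"
      unfolding mem
      by (intro semidecidable_conj semidecidable_compose[OF A] semidecidable_computable computable_intros)
  qed
qed

text \<open>The codings fixed in the definitions of the tests are the overloaded ones, so the
  closure rules apply to \<open>ce\<close>.\<close>

lemma enc_eq_encode:
  "enc_string = encode" "enc_rat = encode" "enc_pair encode encode = encode" "enc_list encode = encode"
proof -
  have *: "encode = (of_bool :: bool \<Rightarrow> nat)" by (simp add: fun_eq_iff)
  show "enc_string = encode" unfolding fun_eq_iff enc_string_def encode_list_def * by simp
qed (auto simp: fun_eq_iff encode_rat_def enc_pair_def enc_list_def encode_prod_def encode_list_def)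

section \<open>Measures on Cantor space\<close>

definition pre :: "(nat \<Rightarrow> bool) \<Rightarrow> nat \<Rightarrow> bool list" where
  "pre x n = map x [0..<n]"

lemma length_pre [simp]: "length (pre x n) = n"
  by (simp add: pre_def)

lemma nth_pre [simp]: "i < n \<Longrightarrow> pre x n ! i = x i"
  by (simp add: pre_def)

lemma mem_cylinder_iff: "x \<in> cylinder \<sigma> \<longleftrightarrow> pre x (length \<sigma>) = \<sigma>"
  by (auto simp: cylinder_def list_eq_iff_nth_eq)

lemma mem_cylinder_pre [simp]: "x \<in> cylinder (pre x n)"
  by (simp add: cylinder_def)

lemma finite_strings: "finite {\<sigma> :: bool list. length \<sigma> = n \<and> P \<sigma>}"
  using finite_lists_length_eq[of "UNIV :: bool set" n] by (simp add: Collect_conj_eq)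

text \<open>Required for identifying the Borel sets of the product topology with the product
  sigma-algebra.\<close>

instance bool :: second_countable_topology
proof
  show "\<exists>B :: bool set set. countable B \<and> open = generate_topology B"
    by (intro exI[of _ UNIV] conjI ext) (auto simp: discrete_topology_class.open_discrete generate_topology.Basis)
qed

lemma sets_borel_cantor:
  "sets (borel :: (nat \<Rightarrow> bool) measure) = sets (PiM UNIV (\<lambda>_. count_space UNIV))"
proof -
  have "sets (PiM UNIV (\<lambda>_::nat. borel :: bool measure)) = sets (PiM UNIV (\<lambda>_::nat. count_space (UNIV :: bool set)))"
    by (rule sets_PiM_cong) (auto simp: sets_borel_eq_count_space)
  then show ?thesis using sets_PiM_equal_borel[where 'a = nat and 'b = bool] by simp
qed

lemma measurable_cantor_coord [measurable]:
  "(\<lambda>x :: nat \<Rightarrow> bool. x i) \<in> borel \<rightarrow>\<^sub>M count_space UNIV"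
proof -
  have "(\<lambda>x :: nat \<Rightarrow> bool. x i) \<in> PiM UNIV (\<lambda>_. count_space UNIV) \<rightarrow>\<^sub>M count_space UNIV"
    by simp
  then show ?thesis by (simp add: measurable_cong_sets[OF sets_borel_cantor refl])
qed

lemma sets_cylinder [measurable]: "cylinder \<sigma> \<in> sets borel"
proof -
  have "cylinder \<sigma> = {x \<in> space borel. \<forall>i\<in>{..<length \<sigma>}. x i = \<sigma> ! i}"
    by (auto simp: cylinder_def)
  also have "\<dots> \<in> sets borel" by measurable
  finally show ?thesis .
qed

lemma measurable_pre [measurable]: "(\<lambda>x. pre x n) \<in> borel \<rightarrow>\<^sub>M count_space UNIV"
proof (subst measurable_count_space_eq2_countable, intro conjI ballI)
  fix \<sigma> :: "bool list"
  have "(\<lambda>x. pre x n) -` {\<sigma>} \<inter> space borel = (if length \<sigma> = n then cylinder \<sigma> else {})"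
    by (auto simp: mem_cylinder_iff)
  then show "(\<lambda>x. pre x n) -` {\<sigma>} \<inter> space borel \<in> sets borel" by simp
qed auto

lemma sets_pre [measurable]: "{x. pre x n \<in> S} \<in> sets borel"
proof -
  have "(\<lambda>x. pre x n) -` S \<inter> space borel \<in> sets borel"
    by (rule measurable_sets[OF measurable_pre]) simp
  then show ?thesis by (simp add: vimage_def)
qed

lemma measure_pre:
  assumes "finite_measure M" "sets M = sets borel"
  shows "measure M {x. pre x n \<in> S} = (\<Sum>\<sigma> | length \<sigma> = n \<and> \<sigma> \<in> S. measure M (cylinder \<sigma>))"
proof -
  interpret finite_measure M by fact
  have "{x. pre x n \<in> S} = (\<Union>\<sigma>\<in>{\<sigma>. length \<sigma> = n \<and> \<sigma> \<in> S}. cylinder \<sigma>)"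
    by (auto simp: mem_cylinder_iff)
  also have "measure M \<dots> = (\<Sum>\<sigma> | length \<sigma> = n \<and> \<sigma> \<in> S. measure M (cylinder \<sigma>))"
    by (rule finite_measure_finite_Union)
      (auto simp: finite_strings assms disjoint_family_on_def mem_cylinder_iff)
  finally show ?thesis .
qed

lemma measure_cylinder_append:
  assumes "finite_measure M" "sets M = sets borel"
  shows "measure M (cylinder \<sigma>) = measure M (cylinder (\<sigma> @ [False])) + measure M (cylinder (\<sigma> @ [True]))"
proof -
  interpret finite_measure M by fact
  have "cylinder \<sigma> = cylinder (\<sigma> @ [False]) \<union> cylinder (\<sigma> @ [True])"
    by (auto simp: cylinder_def nth_append less_Suc_eq)
  moreover have "cylinder (\<sigma> @ [False]) \<inter> cylinder (\<sigma> @ [True]) = {}"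
    by (auto simp: cylinder_def nth_append dest!: spec[of _ "length \<sigma>"])
  ultimately show ?thesis by (simp add: finite_measure_Union assms)
qed

lemma semimeasure_measure:
  assumes "M \<in> cantor_measures"
  shows "semimeasure (\<lambda>\<sigma>. measure M (cylinder \<sigma>))"
proof -
  interpret prob_space M using assms by (simp add: cantor_measures_def)
  have fin: "finite_measure M" by unfold_locales
  show ?thesis
    unfolding semimeasure_def
  proof (intro conjI allI)
    show "measure M (cylinder (\<sigma> @ [False])) + measure M (cylinder (\<sigma> @ [True])) \<le> measure M (cylinder \<sigma>)" for \<sigma>
      using assms by (simp only: measure_cylinder_append[OF fin, of \<sigma>] cantor_measures_def mem_Collect_eq order_refl)
  qed simp
qed

text \<open>The sets that can be approximated form a sigma-algebra containing the coordinate sets. A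
  single clopen set serves both measures, as the comparison of \<open>M\<close> and \<open>N\<close>
  on it demands.\<close>

lemma clopen_approximation:
  assumes "finite_measure M" "finite_measure N" "sets M = sets borel" "sets N = sets borel"
    and "A \<in> sets borel" "e > 0"
  shows "\<exists>n S. measure M (sym_diff A {x. pre x n \<in> S}) < e \<and> measure N (sym_diff A {x. pre x n \<in> S}) < e"
proof -
  interpret M: finite_measure M by fact
  interpret N: finite_measure N by fact
  note [measurable_cong] = assms(3,4)
  have space: "space M = UNIV" "space N = UNIV"
    using sets_eq_imp_space_eq[OF assms(3)] sets_eq_imp_space_eq[OF assms(4)] by auto
  have borel: "sets borel = sigma_sets UNIV {{x :: nat \<Rightarrow> bool. x i \<in> A} | i A. True}"
    unfolding sets_borel_cantor sets_PiM_single by (simp add: PiE_def)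
  from assms(5) have "A \<in> sigma_sets UNIV {{x :: nat \<Rightarrow> bool. x i \<in> A} | i A. True}"
    by (simp add: borel)
  then show ?thesis using assms(6)
  proof (induction A arbitrary: e rule: sigma_sets.induct)
    case (Basic A)
    then obtain i B where A: "A = {x. x i \<in> B}" by auto
    define S where "S = {\<sigma>. \<sigma> ! i \<in> B}"
    have "{x. pre x (Suc i) \<in> S} = A" by (auto simp: A S_def)
    then have "sym_diff A {x. pre x (Suc i) \<in> S} = {}" by auto
    then show ?case using Basic.prems by (intro exI[of _ "Suc i"] exI[of _ S]) (simp only: measure_empty)
  next
    case Empty
    then show ?case by (intro exI[of _ 0] exI[of _ "{}"]) simp
  next
    case (Compl A)
    obtain n S where nS: "measure M (sym_diff A {x. pre x n \<in> S}) < e" "measure N (sym_diff A {x. pre x n \<in> S}) < e"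
      using Compl.IH Compl.prems by blast
    have "sym_diff (UNIV - A) {x. pre x n \<in> - S} = sym_diff A {x. pre x n \<in> S}" by auto
    with nS show ?case by metis
  next
    case (Union A)
    have A [measurable]: "A i \<in> sets borel" for i using Union.hyps by (simp add: borel)
    define U where "U k = (\<Union>i<k. A i)" for k
    have [measurable]: "U k \<in> sets borel" for k unfolding U_def by measurable
    have lim: "(\<lambda>k. measure K ((\<Union>i. A i) - U k)) \<longlonglongrightarrow> 0"
      if "finite_measure K" "sets K = sets borel" for K
    proof -
      interpret K: finite_measure K by fact
      have "(\<lambda>k. measure K ((\<Union>i. A i) - U k)) \<longlonglongrightarrow> measure K (\<Inter>k. (\<Union>i. A i) - U k)"
      proof (rule K.finite_Lim_measure_decseq)
        have "(\<Union>i. A i) - U k \<in> sets borel" for k by measurable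
        then show "range (\<lambda>k. (\<Union>i. A i) - U k) \<subseteq> sets K" unfolding that(2) by blast
        show "decseq (\<lambda>k. (\<Union>i. A i) - U k)"
          unfolding decseq_def U_def using less_le_trans by blast
      qed
      moreover have "(\<Inter>k. (\<Union>i. A i) - U k) = {}" unfolding U_def by blast
      ultimately show ?thesis by (simp only: measure_empty)
    qed
    have "\<forall>\<^sub>F k in sequentially. measure M ((\<Union>i. A i) - U k) < e / 2 \<and> measure N ((\<Union>i. A i) - U k) < e / 2"
      using Union.prems
      by (intro eventually_conj order_tendstoD(2)[OF lim[OF assms(1,3)]]
          order_tendstoD(2)[OF lim[OF assms(2,4)]]) simp_all
    then obtain k where k: "measure M ((\<Union>i. A i) - U k) < e / 2" "measure N ((\<Union>i. A i) - U k) < e / 2"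
      by (auto simp: eventually_sequentially)
    \<comment> \<open>Half of \<open>e\<close> is spent on the tail of the union; the other half is
      shared by \<open>k\<close> approximations, with \<open>k + 1\<close> avoiding division by
      zero.\<close>
    define d where "d = e / (2 * (k + 1))"
    have d: "d > 0" "k * d < e / 2" using Union.prems by (auto simp: d_def field_simps)
    have "\<forall>i. \<exists>n S. measure M (sym_diff (A i) {x. pre x n \<in> S}) < d \<and> measure N (sym_diff (A i) {x. pre x n \<in> S}) < d"
      using Union.IH d(1) by blast
    then obtain n S where nS: "\<And>i. measure M (sym_diff (A i) {x. pre x (n i) \<in> S i}) < d"
      "\<And>i. measure N (sym_diff (A i) {x. pre x (n i) \<in> S i}) < d" by metis
    \<comment> \<open>A length at least every \<open>n i\<close>, so that all \<open>k\<close>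
      clopen sets are read off from the same prefix.\<close>
    define m where "m = (\<Sum>i<k. n i)"
    have m: "n i \<le> m" if "i < k" for i unfolding m_def using that by (intro member_le_sum) auto
    define T where "T = {\<sigma>. \<exists>i<k. take (n i) \<sigma> \<in> S i}"
    have take: "take (n i) (pre x m) = pre x (n i)" if "i < k" for i x
      using m[OF that] by (simp add: pre_def take_map)
    have T: "{x. pre x m \<in> T} = (\<Union>i<k. {x. pre x (n i) \<in> S i})"
      by (auto simp: T_def take)
    have *: "measure K (sym_diff (\<Union>i. A i) {x. pre x m \<in> T}) < e"
      if K: "finite_measure K" "sets K = sets borel" and "measure K ((\<Union>i. A i) - U k) < e / 2"
        "\<And>i. measure K (sym_diff (A i) {x. pre x (n i) \<in> S i}) < d" for K
    proof -
      interpret K: finite_measure K by fact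
      note [measurable_cong] = K(2)
      have "sym_diff (\<Union>i. A i) {x. pre x m \<in> T}
          \<subseteq> ((\<Union>i. A i) - U k) \<union> (\<Union>i<k. sym_diff (A i) {x. pre x (n i) \<in> S i})"
        unfolding T U_def by blast
      then have "measure K (sym_diff (\<Union>i. A i) {x. pre x m \<in> T})
          \<le> measure K (((\<Union>i. A i) - U k) \<union> (\<Union>i<k. sym_diff (A i) {x. pre x (n i) \<in> S i}))"
        by (intro K.finite_measure_mono) (auto simp: K(2))
      also have "\<dots> \<le> measure K ((\<Union>i. A i) - U k) + measure K (\<Union>i<k. sym_diff (A i) {x. pre x (n i) \<in> S i})"
        by (intro measure_Un_le) (auto simp: K(2))
      also have "measure K (\<Union>i<k. sym_diff (A i) {x. pre x (n i) \<in> S i})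
          \<le> (\<Sum>i<k. measure K (sym_diff (A i) {x. pre x (n i) \<in> S i}))"
        by (intro measure_UNION_le) (auto simp: K(2))
      also have "\<dots> \<le> (\<Sum>i<k. d)" using that(4) by (intro sum_mono less_imp_le)
      finally show ?thesis using that(3) d(2) by simp
    qed
    show ?case
      using *[OF assms(1,3) k(1) nS(1)] *[OF assms(2,4) k(2) nS(2)] by blast
  qed
qed

text \<open>A clopen set is a finite disjoint union of cylinders, so the inequality holds there; a
  simultaneous approximation carries it to Borel sets.\<close>

lemma cylinder_domination:
  assumes M: "finite_measure M" "sets M = sets borel" and N: "finite_measure N" "sets N = sets borel"
    and c: "c \<ge> 0" and le: "\<And>\<sigma>. c * measure N (cylinder \<sigma>) \<le> measure M (cylinder \<sigma>)"
    and A: "A \<in> sets borel"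
  shows "c * measure N A \<le> measure M A"
proof (rule field_le_epsilon)
  fix e :: real assume "e > 0"
  interpret M: finite_measure M by fact
  interpret N: finite_measure N by fact
  \<comment> \<open>The error is \<open>c * d\<close> on the side of \<open>N\<close> and
    \<open>d\<close> on the side of \<open>M\<close>.\<close>
  define d where "d = e / (c + 1)"
  have d: "d > 0" "(c + 1) * d = e" using \<open>e > 0\<close> c by (auto simp: d_def)
  obtain n S where nS: "measure M (sym_diff A {x. pre x n \<in> S}) < d" "measure N (sym_diff A {x. pre x n \<in> S}) < d"
    using clopen_approximation[OF M(1) N(1) M(2) N(2) A d(1)] by blast
  let ?C = "{x. pre x n \<in> S}"
  have "measure N A \<le> measure N (?C \<union> sym_diff A ?C)"
    using A by (intro N.finite_measure_mono) (auto simp: N)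
  also have "\<dots> \<le> measure N ?C + measure N (sym_diff A ?C)"
    using A by (intro measure_Un_le) (auto simp: N)
  finally have 1: "measure N A \<le> measure N ?C + d" using nS by simp
  have "measure M ?C \<le> measure M (A \<union> sym_diff A ?C)"
    using A by (intro M.finite_measure_mono) (auto simp: M)
  also have "\<dots> \<le> measure M A + measure M (sym_diff A ?C)"
    using A by (intro measure_Un_le) (auto simp: M)
  finally have 2: "measure M ?C \<le> measure M A + d" using nS by simp
  have "c * measure N A \<le> c * measure N ?C + c * d"
    using mult_left_mono[OF 1 c] by (simp add: algebra_simps)
  also have "c * measure N ?C \<le> measure M ?C"
    unfolding measure_pre[OF M] measure_pre[OF N] sum_distrib_left by (intro sum_mono le)
  finally show "c * measure N A \<le> measure M A + e" using 2 d(2) by (simp add: algebra_simps)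
qed

text \<open>Fair independent bits; the image under the identity only replaces the product
  sigma-algebra by the Borel one.\<close>

definition coin :: "(nat \<Rightarrow> bool) measure" where
  "coin = distr (PiM UNIV (\<lambda>_. measure_pmf (pmf_of_set UNIV))) borel (\<lambda>x. x)"

lemma measurable_id_coin:
  "(\<lambda>x. x) \<in> PiM UNIV (\<lambda>_::nat. measure_pmf (pmf_of_set (UNIV :: bool set))) \<rightarrow>\<^sub>M borel"
proof -
  have "sets (PiM UNIV (\<lambda>_::nat. measure_pmf (pmf_of_set (UNIV :: bool set)))) = sets borel"
    unfolding sets_borel_cantor by (rule sets_PiM_cong) auto
  then show ?thesis by (rule measurable_ident_sets)
qed

lemma sets_coin [simp, measurable_cong]: "sets coin = sets borel"
  by (simp add: coin_def)

lemma space_coin [simp]: "space coin = UNIV"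
  by (simp add: coin_def)

lemma prob_space_coin: "prob_space coin"
  unfolding coin_def by (intro prob_space.prob_space_distr prob_space_PiM measurable_id_coin prob_space_measure_pmf)

lemma coin_in_cantor_measures: "coin \<in> cantor_measures"
  by (simp add: cantor_measures_def prob_space_coin)

lemma measure_coin_Collect:
  "measure coin {z. \<forall>i<n. z i \<in> A i} = (\<Prod>i<n. real (card (A i)) / 2)"
proof -
  interpret P: product_prob_space "\<lambda>_::nat. measure_pmf (pmf_of_set (UNIV :: bool set))" UNIV
    by unfold_locales
  have sp: "space (PiM UNIV (\<lambda>_::nat. measure_pmf (pmf_of_set (UNIV :: bool set)))) = UNIV"
    by (simp add: space_PiM PiE_def)
  have [measurable]: "{z :: nat \<Rightarrow> bool. \<forall>i<n. z i \<in> A i} \<in> sets borel"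
  proof -
    have "{z :: nat \<Rightarrow> bool. \<forall>i<n. z i \<in> A i} = {z \<in> space borel. \<forall>i\<in>{..<n}. z i \<in> A i}" by auto
    also have "\<dots> \<in> sets borel" by measurable
    finally show ?thesis .
  qed
  have "measure coin {z. \<forall>i<n. z i \<in> A i}
      = measure (PiM UNIV (\<lambda>_. measure_pmf (pmf_of_set UNIV))) {z. \<forall>i<n. z i \<in> A i}"
    unfolding coin_def by (subst measure_distr[OF measurable_id_coin]) (auto simp: sp)
  also have "\<dots> = measure (PiM UNIV (\<lambda>_. measure_pmf (pmf_of_set UNIV)))
      (prod_emb UNIV (\<lambda>_. measure_pmf (pmf_of_set UNIV)) {..<n} (Pi\<^sub>E {..<n} A))"
    by (rule arg_cong2[where f = measure]) (auto simp: prod_emb_def PiE_def Pi_def extensional_def)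
  also have "\<dots> = (\<Prod>i<n. measure (measure_pmf (pmf_of_set UNIV)) (A i))"
    by (rule P.measure_PiM_emb) auto
  also have "\<dots> = (\<Prod>i<n. real (card (A i)) / 2)"
    by (simp add: measure_pmf_of_set card_UNIV_bool)
  finally show ?thesis .
qed

lemma measure_coin_cylinder: "measure coin (cylinder \<sigma>) = (1 / 2) ^ length \<sigma>"
proof -
  have "cylinder \<sigma> = {z. \<forall>i<length \<sigma>. z i \<in> {\<sigma> ! i}}" by (simp add: cylinder_def)
  then show ?thesis by (simp only: measure_coin_Collect) simp
qed

section \<open>Thinning random bits to a prescribed density\<close>

text \<open>The 2-adic valuation of a positive number, phrased as a least-number search so that its
  computability is immediate.\<close>

definition v2 :: "nat \<Rightarrow> nat" where
  "v2 n = (LEAST i. \<not> 2 ^ Suc i dvd n)"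

lemma ex_not_power2_dvd: "n > 0 \<Longrightarrow> \<exists>i. \<not> 2 ^ Suc i dvd (n::nat)"
proof -
  assume "n > 0"
  have "n < 2 ^ n" by (rule less_exp)
  also have "(2::nat) ^ n \<le> 2 ^ Suc n" by simp
  finally have "\<not> 2 ^ Suc n dvd n" using \<open>n > 0\<close> by (auto dest: dvd_imp_le)
  then show ?thesis by blast
qed

lemma v2_odd: "odd n \<Longrightarrow> v2 n = 0"
  unfolding v2_def by (rule Least_eq_0) simp

lemma v2_double: "n > 0 \<Longrightarrow> v2 (2 * n) = Suc (v2 n)"
proof -
  assume n: "n > 0"
  obtain i where i: "\<not> 2 ^ Suc i dvd 2 * n" using ex_not_power2_dvd[of "2 * n"] n by auto
  have "v2 (2 * n) = Suc (LEAST i. \<not> 2 ^ Suc (Suc i) dvd 2 * n)"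
    unfolding v2_def by (rule Least_Suc[where P = "\<lambda>i. \<not> 2 ^ Suc i dvd 2 * n", OF i]) simp
  then show ?thesis unfolding v2_def by simp
qed

lemma power2_v2_dvd: "n > 0 \<Longrightarrow> 2 ^ v2 n dvd n"
proof (cases "v2 n")
  case (Suc i)
  then show ?thesis using not_less_Least[of i "\<lambda>i. \<not> 2 ^ Suc i dvd n"] unfolding v2_def[symmetric] by simp
qed simp

text \<open>The source of the logarithmic dependence on \<open>y\<close>: it allows
  \<open>measure_blended_ge\<close> to fix only \<open>m\<close> bits.\<close>

lemma v2_less: "n > 0 \<Longrightarrow> n < 2 ^ m \<Longrightarrow> v2 n < m"
proof (rule ccontr)
  assume *: "n > 0" "n < 2 ^ m" "\<not> v2 n < m"
  then have "(2::nat) ^ m \<le> 2 ^ v2 n" by (intro power_increasing) auto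
  also have "\<dots> \<le> n" using dvd_imp_le[OF power2_v2_dvd] * by simp
  finally show False using * by simp
qed

lemma v2_Suc_le: "v2 (Suc k) \<le> k"
  using v2_less[of "Suc k" "Suc k"] less_exp[of "Suc k"] by simp

text \<open>The shift to \<open>Suc k\<close> is needed because \<open>0\<close> is divisible by
  every power of two and has no valuation.\<close>

definition blend :: "(nat \<Rightarrow> bool) \<Rightarrow> (nat \<Rightarrow> bool) \<Rightarrow> nat \<Rightarrow> bool" where
  "blend y z k \<longleftrightarrow> y (v2 (Suc k)) \<and> z k"

definition active :: "(nat \<Rightarrow> bool) \<Rightarrow> nat \<Rightarrow> nat" where
  "active y n = (\<Sum>k<n. of_bool (y (v2 (Suc k))))"

text \<open>Among the numbers from 1 to \<open>n\<close>, the odd ones number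
  \<open>n - n div 2\<close> and consult bit 0; the even ones are the doubles of 1 to
  \<open>n div 2\<close>, with every valuation raised by one.\<close>

lemma active_halve: "active y n = of_bool (y 0) * (n - n div 2) + active (\<lambda>i. y (Suc i)) (n div 2)"
proof (induction n)
  case (Suc n)
  have step: "active w (Suc m) = active w m + of_bool (w (v2 (Suc m)))" for w m
    by (simp add: active_def)
  show ?case
  proof (cases "even n")
    case True
    then have "v2 (Suc n) = 0" "Suc n div 2 = n div 2" by (auto simp: v2_odd)
    then show ?thesis using Suc by (simp add: step Suc_diff_le)
  next
    case False
    then obtain m where m: "n = 2 * m + 1" by (auto elim: oddE)
    then have "v2 (Suc n) = Suc (v2 (Suc m))" "Suc n div 2 = Suc m" "n div 2 = m"
      using v2_double[of "Suc m"] by auto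
    then show ?thesis using Suc unfolding m by (simp add: step)
  qed
qed (simp add: active_def)

section \<open>Binary expansions and the density of surviving positions\<close>

definition binval :: "(nat \<Rightarrow> bool) \<Rightarrow> real" where
  "binval y = (\<Sum>i. of_bool (y i) * (1 / 2) ^ Suc i)"

lemma summable_binval: "summable (\<lambda>i. of_bool (y i) * (1 / 2) ^ Suc i :: real)"
proof (rule summable_comparison_test')
  show "summable (\<lambda>i. (1 / 2) ^ i :: real)" by (rule summable_geometric) simp
  show "norm (of_bool (y i) * (1 / 2) ^ Suc i :: real) \<le> (1 / 2) ^ i" for i
    by simp
qed

lemma binval_halve: "binval y = (of_bool (y 0) + binval (\<lambda>i. y (Suc i))) / 2"
proof -
  have "binval y = (\<Sum>i. of_bool (y (i + 1)) * (1 / 2) ^ Suc (i + 1)) + of_bool (y 0) * (1 / 2) ^ Suc 0"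
    unfolding binval_def using suminf_split_initial_segment[OF summable_binval[of y], of 1] by simp
  also have "(\<Sum>i. of_bool (y (i + 1)) * (1 / 2) ^ Suc (i + 1)) = (\<Sum>i. 1 / 2 * (of_bool (y (Suc i)) * (1 / 2) ^ Suc i) :: real)"
    by (simp add: mult_ac)
  also have "\<dots> = 1 / 2 * binval (\<lambda>i. y (Suc i))"
    unfolding binval_def by (rule suminf_mult[OF summable_binval])
  finally show ?thesis by simp
qed

lemma binval_bounds: "0 \<le> binval y" "binval y \<le> 1"
proof -
  show "0 \<le> binval y" unfolding binval_def by (intro suminf_nonneg summable_binval) simp
  have "binval y \<le> (\<Sum>i. (1 / 2) ^ Suc i)"
    unfolding binval_def by (intro suminf_le summable_binval) (auto intro: sums_summable[OF power_half_series])
  also have "\<dots> = 1" by (rule sums_unique[OF power_half_series, symmetric])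
  finally show "binval y \<le> 1" .
qed

text \<open>Both quantities obey the same halving recursion. At each level the rounding of
  \<open>n / 2\<close> enters twice, each time with error at most \<open>1 / 2\<close>, so the error
  grows by at most one per level.\<close>

lemma active_approx: "n < 2 ^ m \<Longrightarrow> \<bar>real n * binval y - real (active y n)\<bar> \<le> real m"
proof (induction m arbitrary: n y)
  case 0
  then show ?case by (simp add: active_def)
next
  case (Suc m)
  define a where "a = n div 2"
  define w where "w = (\<lambda>i. y (Suc i))"
  have "a < 2 ^ m" using Suc.prems by (auto simp: a_def)
  from Suc.IH[OF this] have IH: "\<bar>real a * binval w - real (active w a)\<bar> \<le> real m" .
  have act: "real (active y n) = of_bool (y 0) * (real n - real a) + real (active w a)"
    unfolding a_def w_def by (subst active_halve) (simp add: of_nat_diff)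
  have half: "\<bar>real n / 2 - real a\<bar> \<le> 1 / 2"
  proof -
    have "2 * a \<le> n" "n \<le> 2 * a + 1" unfolding a_def by auto
    then have "2 * real a \<le> real n" "real n \<le> 2 * real a + 1" by linarith+
    then show ?thesis by linarith
  qed
  have "real n * binval y - real (active y n)
      = - of_bool (y 0) * (real n / 2 - real a) + (real n / 2 - real a) * binval w
        + (real a * binval w - real (active w a))"
    unfolding act binval_halve[of y] w_def[symmetric] by (simp add: field_simps)
  also have "\<bar>\<dots>\<bar> \<le> \<bar>- of_bool (y 0) * (real n / 2 - real a)\<bar> + \<bar>(real n / 2 - real a) * binval w\<bar>
        + \<bar>real a * binval w - real (active w a)\<bar>"
    by (intro order_trans[OF abs_triangle_ineq] add_mono abs_triangle_ineq order_refl)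
  also have "\<bar>- of_bool (y 0) * (real n / 2 - real a)\<bar> \<le> 1 / 2" using half by auto
  also have "\<bar>(real n / 2 - real a) * binval w\<bar> \<le> 1 / 2 * 1"
    unfolding abs_mult using half binval_bounds[of w] by (intro mult_mono) auto
  finally show ?case using IH by simp
qed

text \<open>\<open>m\<close> will be the number of bits of \<open>y\<close> that matter for the
  first \<open>n\<close> positions; the upper bound keeps \<open>(1 / 2) ^ m\<close> at least
  \<open>1 / (2 * Suc n)\<close>.\<close>

lemma ex_power2_near: "\<exists>m. n < 2 ^ m \<and> 2 ^ m \<le> 2 * Suc n"
proof (induction n)
  case 0
  show ?case by (intro exI[of _ 0]) simp
next
  case (Suc n)
  then obtain m where m: "n < 2 ^ m" "2 ^ m \<le> 2 * Suc n" by auto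
  show ?case
  proof (cases "Suc n < 2 ^ m")
    case True
    then show ?thesis using m by (intro exI[of _ m]) simp
  next
    case False
    then show ?thesis using m by (intro exI[of _ "Suc m"]) simp
  qed
qed

text \<open>The conditional probability, given \<open>y\<close>, that the blended sequence begins
  with \<sigma>: a surviving position is a fair bit, an erased one must show 0.\<close>

definition coin_weight :: "(nat \<Rightarrow> bool) \<Rightarrow> bool list \<Rightarrow> real" where
  "coin_weight y \<sigma> = (\<Prod>k<length \<sigma>. if y (v2 (Suc k)) then 1 / 2 else if \<sigma> ! k then 0 else 1)"

lemma measure_coin_blend: "measure coin {z. blend y z \<in> cylinder \<sigma>} = coin_weight y \<sigma>"
proof -
  have "{z. blend y z \<in> cylinder \<sigma>} = {z. \<forall>k<length \<sigma>. z k \<in> {b. (y (v2 (Suc k)) \<and> b) = \<sigma> ! k}}"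
    by (auto simp: cylinder_def blend_def)
  moreover have "real (card {b. (p \<and> b) = s}) / 2 = (if p then 1 / 2 else if s then 0 else 1)" for p s
  proof -
    have "{b. (p \<and> b) = s} = (if p then {s} else if s then {} else UNIV)" by auto
    then show ?thesis by (simp add: card_UNIV_bool)
  qed
  ultimately show ?thesis by (simp only: measure_coin_Collect coin_weight_def)
qed

lemma coin_weight_nonneg: "0 \<le> coin_weight y \<sigma>"
  unfolding coin_weight_def by (intro prod_nonneg) auto

lemma power_half_active: "(1 / 2 :: real) ^ active y n = (\<Prod>k<n. if y (v2 (Suc k)) then 1 / 2 else 1)"
  by (induction n) (auto simp: active_def)

lemma coin_weight_le: "coin_weight y \<sigma> \<le> (1 / 2) ^ active y (length \<sigma>)"
  unfolding coin_weight_def power_half_active by (intro prod_mono) auto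

text \<open>The upper bound of \<open>coin_weight_le\<close> is attained on strings that
  \<open>blend y\<close> produces, as their erased positions never show a 1.\<close>

lemma coin_weight_pre_blend: "coin_weight y (pre (blend y z) n) = (1 / 2) ^ active y n"
  unfolding coin_weight_def power_half_active by (intro prod.cong) (auto simp: blend_def)

lemma coin_weight_cong:
  assumes "\<And>k. k < length \<sigma> \<Longrightarrow> y (v2 (Suc k)) = w (v2 (Suc k))"
  shows "coin_weight y \<sigma> = coin_weight w \<sigma>"
  unfolding coin_weight_def by (intro prod.cong) (auto simp: assms)

section \<open>The mixture of the blended sequences over \<open>y\<close> and its cylinder
  masses\<close>

lemma measurable_blend_pair [measurable]:
  assumes [measurable_cong]: "sets M = sets borel"
  shows "(\<lambda>p. blend (fst p) (snd p)) \<in> M \<Otimes>\<^sub>M coin \<rightarrow>\<^sub>M borel"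
proof -
  have "(\<lambda>p. blend (fst p) (snd p)) \<in> M \<Otimes>\<^sub>M coin \<rightarrow>\<^sub>M PiM UNIV (\<lambda>_. count_space UNIV)"
  proof (rule measurable_PiM_single')
    fix k :: nat
    show "(\<lambda>p. blend (fst p) (snd p) k) \<in> M \<Otimes>\<^sub>M coin \<rightarrow>\<^sub>M count_space UNIV"
      unfolding blend_def by measurable
  qed (auto simp: space_PiM PiE_def)
  then show ?thesis using measurable_cong_sets[OF refl sets_borel_cantor] by blast
qed

lemma measurable_blend [measurable]: "blend y \<in> coin \<rightarrow>\<^sub>M borel"
proof -
  have "blend y \<in> coin \<rightarrow>\<^sub>M PiM UNIV (\<lambda>_. count_space UNIV)"
  proof (rule measurable_PiM_single')
    fix k :: nat
    show "(\<lambda>z. blend y z k) \<in> coin \<rightarrow>\<^sub>M count_space UNIV"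
      unfolding blend_def by measurable
  qed (auto simp: space_PiM PiE_def)
  then show ?thesis using measurable_cong_sets[OF refl sets_borel_cantor] by blast
qed

definition blended :: "(nat \<Rightarrow> bool) measure \<Rightarrow> (nat \<Rightarrow> bool) measure" where
  "blended \<mu> = distr (\<mu> \<Otimes>\<^sub>M coin) borel (\<lambda>p. blend (fst p) (snd p))"

lemma emeasure_blended:
  assumes "\<mu> \<in> cantor_measures" "A \<in> sets borel"
  shows "emeasure (blended \<mu>) A = (\<integral>\<^sup>+ y. emeasure coin {z. blend y z \<in> A} \<partial>\<mu>)"
proof -
  have sets [measurable_cong]: "sets \<mu> = sets borel" using assms by (simp add: cantor_measures_def)
  note [measurable] = assms(2)
  have sp: "space \<mu> = UNIV" using sets_eq_imp_space_eq[OF sets] by simp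
  interpret coin: prob_space coin by (rule prob_space_coin)
  have "emeasure (blended \<mu>) A = emeasure (\<mu> \<Otimes>\<^sub>M coin) ((\<lambda>p. blend (fst p) (snd p)) -` A \<inter> space (\<mu> \<Otimes>\<^sub>M coin))"
    unfolding blended_def by (rule emeasure_distr) measurable
  also have "\<dots> = (\<integral>\<^sup>+ y. emeasure coin (Pair y -` ((\<lambda>p. blend (fst p) (snd p)) -` A \<inter> space (\<mu> \<Otimes>\<^sub>M coin))) \<partial>\<mu>)"
    by (rule coin.emeasure_pair_measure_alt) measurable
  also have "\<dots> = (\<integral>\<^sup>+ y. emeasure coin {z. blend y z \<in> A} \<partial>\<mu>)"
    by (simp add: sp space_pair_measure vimage_def)
  finally show ?thesis .
qed

lemma blended_in_cantor_measures:
  assumes "\<mu> \<in> cantor_measures" shows "blended \<mu> \<in> cantor_measures"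
proof -
  have sets: "sets \<mu> = sets borel" using assms by (simp add: cantor_measures_def)
  interpret \<mu>: prob_space \<mu> using assms by (simp add: cantor_measures_def)
  interpret coin: prob_space coin by (rule prob_space_coin)
  interpret pair_prob_space \<mu> coin ..
  show ?thesis
    unfolding cantor_measures_def blended_def
    by (simp add: prob_space_distr[OF measurable_blend_pair[OF sets]])
qed

lemma nn_integral_pre:
  assumes "sets M = sets borel"
  shows "(\<integral>\<^sup>+ y. f (pre y n) \<partial>M) = (\<Sum>\<tau> | length \<tau> = n. f \<tau> * emeasure M (cylinder \<tau>))"
proof -
  note [measurable_cong] = assms
  have fin: "finite {\<tau> :: bool list. length \<tau> = n}" using finite_strings[of n "\<lambda>_. True"] by simp
  have "f (pre y n) = (\<Sum>\<tau> | length \<tau> = n. f \<tau> * indicator (cylinder \<tau>) y)" for y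
  proof -
    have "(\<Sum>\<tau> | length \<tau> = n. f \<tau> * indicator (cylinder \<tau>) y) = (\<Sum>\<tau> | length \<tau> = n. if \<tau> = pre y n then f \<tau> else 0)"
      by (intro sum.cong) (auto simp: indicator_def mem_cylinder_iff)
    then show ?thesis using fin by (simp add: sum.delta)
  qed
  then have "(\<integral>\<^sup>+ y. f (pre y n) \<partial>M) = (\<integral>\<^sup>+ y. (\<Sum>\<tau> | length \<tau> = n. f \<tau> * indicator (cylinder \<tau>) y) \<partial>M)"
    by simp
  also have "\<dots> = (\<Sum>\<tau> | length \<tau> = n. (\<integral>\<^sup>+ y. f \<tau> * indicator (cylinder \<tau>) y \<partial>M))"
    by (rule nn_integral_sum) measurable
  also have "\<dots> = (\<Sum>\<tau> | length \<tau> = n. f \<tau> * emeasure M (cylinder \<tau>))"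
    by (intro sum.cong refl nn_integral_cmult_indicator) (simp add: assms)
  finally show ?thesis .
qed

lemma emeasure_blended_cylinder:
  assumes "\<mu> \<in> cantor_measures"
  shows "emeasure (blended \<mu>) (cylinder \<sigma>) = (\<integral>\<^sup>+ y. ennreal (coin_weight y \<sigma>) \<partial>\<mu>)"
proof -
  interpret coin: prob_space coin by (rule prob_space_coin)
  show ?thesis
    unfolding emeasure_blended[OF assms sets_cylinder] coin.emeasure_eq_measure measure_coin_blend ..
qed

text \<open>As \<open>v2 (Suc k) \<le> k\<close>, as many bits of \<open>y\<close> as \<sigma> has
  entries determine the weight. This crude bound suffices to make the mass a finite sum, hence
  approximable from below; \<open>nth_default False\<close> pads the strings with zeros.\<close>

lemma measure_blended_cylinder:
  assumes "\<mu> \<in> cantor_measures"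
  shows "measure (blended \<mu>) (cylinder \<sigma>)
    = (\<Sum>\<tau> | length \<tau> = length \<sigma>. measure \<mu> (cylinder \<tau>) * coin_weight (nth_default False \<tau>) \<sigma>)"
proof -
  interpret \<mu>: prob_space \<mu> using assms by (simp add: cantor_measures_def)
  interpret Q: prob_space "blended \<mu>" using blended_in_cantor_measures[OF assms] by (simp add: cantor_measures_def)
  have "coin_weight y \<sigma> = coin_weight (nth_default False (pre y (length \<sigma>))) \<sigma>" for y
    by (intro coin_weight_cong) (use le_less_trans[OF v2_Suc_le] in \<open>simp add: nth_default_nth\<close>)
  then have "emeasure (blended \<mu>) (cylinder \<sigma>) = (\<integral>\<^sup>+ y. ennreal (coin_weight (nth_default False (pre y (length \<sigma>))) \<sigma>) \<partial>\<mu>)"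
    unfolding emeasure_blended_cylinder[OF assms] by simp
  also have "\<dots> = (\<Sum>\<tau> | length \<tau> = length \<sigma>. ennreal (coin_weight (nth_default False \<tau>) \<sigma>) * emeasure \<mu> (cylinder \<tau>))"
    using assms by (intro nn_integral_pre) (simp add: cantor_measures_def)
  also have "\<dots> = ennreal (\<Sum>\<tau> | length \<tau> = length \<sigma>. measure \<mu> (cylinder \<tau>) * coin_weight (nth_default False \<tau>) \<sigma>)"
    by (simp add: \<mu>.emeasure_eq_measure coin_weight_nonneg mult.commute flip: ennreal_mult)
  finally show ?thesis
    unfolding Q.emeasure_eq_measure
    by (subst (asm) ennreal_inj) (auto intro!: sum_nonneg mult_nonneg_nonneg coin_weight_nonneg)
qed

text \<open>All \<open>w\<close> that share the first \<open>m\<close> bits of \<open>y\<close>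
  erase the same positions below \<open>n\<close>, so each gives the string the same weight as
  \<open>y\<close>; the rest of the mixture is discarded.\<close>

lemma measure_blended_ge:
  assumes "\<mu> \<in> cantor_measures" "n < 2 ^ m"
  shows "measure \<mu> (cylinder (pre y m)) * (1 / 2) ^ active y n \<le> measure (blended \<mu>) (cylinder (pre (blend y z) n))"
proof -
  interpret \<mu>: prob_space \<mu> using assms by (simp add: cantor_measures_def)
  interpret Q: prob_space "blended \<mu>" using blended_in_cantor_measures[OF assms(1)] by (simp add: cantor_measures_def)
  let ?\<sigma> = "pre (blend y z) n"
  have sets: "sets \<mu> = sets borel" using assms by (simp add: cantor_measures_def)
  have "ennreal (measure \<mu> (cylinder (pre y m)) * (1 / 2) ^ active y n)
      = ennreal ((1 / 2) ^ active y n) * emeasure \<mu> (cylinder (pre y m))"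
    by (simp add: \<mu>.emeasure_eq_measure ennreal_mult mult.commute)
  also have "\<dots> = (\<integral>\<^sup>+ w. ennreal ((1 / 2) ^ active y n) * indicator (cylinder (pre y m)) w \<partial>\<mu>)"
    by (rule nn_integral_cmult_indicator[symmetric]) (simp add: sets)
  also have "\<dots> \<le> (\<integral>\<^sup>+ w. ennreal (coin_weight w ?\<sigma>) \<partial>\<mu>)"
  proof (intro nn_integral_mono)
    fix w
    have "coin_weight w ?\<sigma> = (1 / 2) ^ active y n" if "w \<in> cylinder (pre y m)"
    proof -
      have "coin_weight w ?\<sigma> = coin_weight y ?\<sigma>"
      proof (rule coin_weight_cong)
        fix k assume "k < length ?\<sigma>"
        then have "v2 (Suc k) < m" using assms(2) by (intro v2_less) auto
        then show "w (v2 (Suc k)) = y (v2 (Suc k))" using that by (simp add: cylinder_def)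
      qed
      then show ?thesis by (simp add: coin_weight_pre_blend)
    qed
    then show "ennreal ((1 / 2) ^ active y n) * indicator (cylinder (pre y m)) w \<le> ennreal (coin_weight w ?\<sigma>)"
      by (auto simp: indicator_def)
  qed
  also have "\<dots> = ennreal (measure (blended \<mu>) (cylinder ?\<sigma>))"
    by (simp only: emeasure_blended_cylinder[OF assms(1), symmetric] Q.emeasure_eq_measure)
  finally show ?thesis by simp
qed

section \<open>Pointwise dimension\<close>

text \<open>The open ball of radius \<open>(1 / 2) ^ n\<close> fixes \<open>Suc n\<close>
  coordinates, hence the mismatch between numerator and denominator.\<close>

definition scale_dim :: "(nat \<Rightarrow> bool) measure \<Rightarrow> (nat \<Rightarrow> bool) \<Rightarrow> nat \<Rightarrow> ereal" where
  "scale_dim \<mu> x n = log_prob (measure \<mu> (cylinder (pre x (Suc n)))) / ereal (ln ((1 / 2) ^ n))"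

text \<open>Positive distances are powers of \<open>1 / 2\<close>, and none lies strictly between
  two consecutive ones; the half-open range for \<open>r\<close> reflects that balls are
  open.\<close>

lemma cantor_ball_eq_cylinder:
  assumes "(1 / 2) ^ Suc n < r" "r \<le> (1 / 2) ^ n"
  shows "cantor_ball r x = cylinder (pre x (Suc n))"
proof -
  have "cantor_dist x y < r \<longleftrightarrow> (\<forall>i<Suc n. y i = x i)" for y
  proof (cases "x = y")
    case True
    have "0 < r" using assms(1) by (rule le_less_trans[rotated]) simp
    then show ?thesis using True by (simp add: cantor_dist_def)
  next
    case False
    define m where "m = (LEAST m. y m \<noteq> x m)"
    have "\<exists>m. y m \<noteq> x m" using False by auto
    then have m: "y m \<noteq> x m" unfolding m_def by (rule LeastI_ex)
    have less: "y i = x i" if "i < m" for i using that not_less_Least unfolding m_def by blast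
    have d: "cantor_dist x y = (1 / 2) ^ m" using False by (simp add: cantor_dist_def m_def power_divide eq_commute)
    have "(1 / 2) ^ m < r \<longleftrightarrow> n < m"
    proof
      assume "n < m"
      then have "(1 / 2 :: real) ^ m \<le> (1 / 2) ^ Suc n" by (intro power_decreasing) auto
      then show "(1 / 2) ^ m < r" using assms(1) by linarith
    next
      assume *: "(1 / 2) ^ m < r"
      show "n < m"
      proof (rule ccontr)
        assume "\<not> n < m"
        then have "(1 / 2 :: real) ^ n \<le> (1 / 2) ^ m" by (intro power_decreasing) auto
        then show False using assms(2) * by linarith
      qed
    qed
    also have "n < m \<longleftrightarrow> (\<forall>i<Suc n. y i = x i)"
      using m less by (metis less_SucI less_antisym less_trans not_less_eq)
    finally show ?thesis unfolding d .
  qed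
  then show ?thesis by (simp add: cantor_ball_def cylinder_def)
qed

lemma ex_dyadic_scale:
  fixes r :: real
  assumes "0 < r" "r \<le> 1"
  shows "\<exists>n. (1 / 2) ^ Suc n < r \<and> r \<le> (1 / 2) ^ n"
proof -
  define m where "m = (LEAST m. (1 / 2) ^ m < r)"
  have "\<exists>m. (1 / 2) ^ m < r" using real_arch_pow_inv[OF assms(1), of "1 / 2"] by auto
  then have m: "(1 / 2) ^ m < r" unfolding m_def by (rule LeastI_ex)
  then have "m \<noteq> 0" using assms by (intro notI) simp
  then obtain n where n: "m = Suc n" by (cases m) auto
  have "\<not> (1 / 2) ^ n < r" using not_less_Least[of n "\<lambda>m. (1 / 2) ^ m < r"] n unfolding m_def by simp
  then show ?thesis using m n by auto
qed

text \<open>Dyadic radii are special radii, which gives one inequality. For the other, the ball is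
  constant between consecutive dyadic radii while \<open>ln r\<close> varies there by a factor
  tending to 1.\<close>

lemma pointwise_dim_eq_liminf:
  assumes "prob_space \<mu>"
  shows "pointwise_dim \<mu> x = liminf (scale_dim \<mu> x)"
proof (rule antisym)
  interpret prob_space \<mu> by fact
  define val where "val r = log_prob (measure \<mu> (cantor_ball r x)) / ereal (ln r)" for r
  have dim: "pointwise_dim \<mu> x = Liminf (at_right 0) val" by (simp add: pointwise_dim_def val_def[abs_def])
  have val: "val ((1 / 2) ^ n) = scale_dim \<mu> x n" for n
    unfolding val_def scale_dim_def by (subst cantor_ball_eq_cylinder[of n]) auto
  have lim: "filterlim (\<lambda>n. (1 / 2 :: real) ^ n) (at_right 0) sequentially"
    unfolding filterlim_at by (auto intro!: LIMSEQ_power_zero)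
  show "pointwise_dim \<mu> x \<le> liminf (scale_dim \<mu> x)"
    unfolding le_Liminf_iff
  proof (intro allI impI)
    fix y assume "y < pointwise_dim \<mu> x"
    then have "eventually (\<lambda>r. y < val r) (at_right 0)"
      unfolding dim by (rule less_LiminfD)
    from eventually_compose_filterlim[OF this lim]
    show "eventually (\<lambda>n. y < scale_dim \<mu> x n) sequentially" by (simp add: val)
  qed
  show "liminf (scale_dim \<mu> x) \<le> pointwise_dim \<mu> x"
    unfolding dim le_Liminf_iff
  proof (intro allI impI)
    fix y assume y: "y < liminf (scale_dim \<mu> x)"
    \<comment> \<open>This factor pays for replacing \<open>ln ((1 / 2) ^ n)\<close> by
      \<open>ln ((1 / 2) ^ Suc n)\<close>, which bounds \<open>ln r\<close> from below; its limit 1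
      leaves the liminf unchanged.\<close>
    have "(\<lambda>n. ereal (real n / real (Suc n))) \<longlonglongrightarrow> ereal 1"
      unfolding lim_ereal by real_asymp
    then have "liminf (\<lambda>n. ereal (real n / real (Suc n)) * scale_dim \<mu> x n) = ereal 1 * liminf (scale_dim \<mu> x)"
      by (rule ereal_liminf_lim_mult) auto
    with y have "y < liminf (\<lambda>n. ereal (real n / real (Suc n)) * scale_dim \<mu> x n)"
      by (simp add: one_ereal_def[symmetric])
    then have "eventually (\<lambda>n. y < ereal (real n / real (Suc n)) * scale_dim \<mu> x n) sequentially"
      by (rule less_LiminfD)
    then obtain N where N: "\<And>n. n \<ge> N \<Longrightarrow> y < ereal (real n / real (Suc n)) * scale_dim \<mu> x n"
      by (auto simp: eventually_sequentially)
    have ev: "eventually (\<lambda>r. r < (1 / 2) ^ Suc N \<and> r > (0::real)) (at_right 0)"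
      by (intro eventually_conj eventually_at_right_less order_tendstoD[OF tendsto_ident_at]) auto
    show "eventually (\<lambda>r. y < val r) (at_right 0)"
      using ev
    proof eventually_elim
      case (elim r)
      have "(1 / 2 :: real) ^ Suc N \<le> 1" by (intro power_le_one) auto
      with elim have r: "0 < r" "r < 1" by auto
      then obtain n where n: "(1 / 2) ^ Suc n < r" "r \<le> (1 / 2) ^ n" using ex_dyadic_scale[of r] by auto
      have "N < n"
      proof (rule ccontr)
        assume "\<not> N < n"
        then have "(1 / 2 :: real) ^ Suc N \<le> (1 / 2) ^ Suc n" by (intro power_decreasing) auto
        then show False using n elim by linarith
      qed
      define p where "p = measure \<mu> (cylinder (pre x (Suc n)))"
      have p: "0 \<le> p" "p \<le> 1" by (auto simp: p_def)
      have ln_r: "ln r < 0" using r by simp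
      have ln_n: "ln ((1 / 2) ^ n) = - real n * ln (2::real)"
        by (simp add: ln_realpow ln_div)
      have "ereal (real n / real (Suc n)) * scale_dim \<mu> x n \<le> val r"
      proof (cases "p = 0")
        \<comment> \<open>Here minus infinity is divided by the negative number \<open>ln r\<close>,
          so \<open>val r\<close> is plus infinity.\<close>
        case True
        then show ?thesis using ln_r unfolding val_def cantor_ball_eq_cylinder[OF n] p_def[symmetric]
          by (simp add: log_prob_def divide_ereal_def)
      next
        case False
        have "ln ((1 / 2 :: real) ^ Suc n) < ln r" using n(1) r by (subst ln_less_cancel_iff) auto
        also have "ln ((1 / 2 :: real) ^ Suc n) = - real (Suc n) * ln 2" by (simp add: ln_realpow ln_div algebra_simps)
        finally have *: "- real (Suc n) * ln 2 < ln r" .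
        have "ln p \<le> 0" using p False by simp
        have "a / b * (P / (- a * l)) = P / (- b * l)" if "a \<noteq> 0" "b \<noteq> 0" "l \<noteq> 0" for a b P l :: real
          using that by (simp add: field_simps)
        from this[of "real n" "real (Suc n)" "ln 2" "ln p"]
        have "real n / real (Suc n) * (ln p / (- real n * ln 2)) = ln p / (- real (Suc n) * ln 2)"
          using \<open>N < n\<close> by simp
        also have "\<dots> \<le> ln p / ln r"
        proof (rule divide_left_mono_neg)
          show "0 < - real (Suc n) * ln 2 * ln r" using ln_r by (intro mult_neg_neg mult_neg_pos) auto
        qed (use * \<open>ln p \<le> 0\<close> in auto)
        finally show ?thesis
          using False unfolding val_def cantor_ball_eq_cylinder[OF n] scale_dim_def p_def[symmetric] ln_n
          using \<open>N < n\<close> ln_r by (simp add: log_prob_def)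
      qed
      then show ?case using N[of n] \<open>N < n\<close> by (meson less_imp_le less_le_trans)
    qed
  qed
qed

lemma measurable_pointwise_dim [measurable]:
  assumes "prob_space \<mu>"
  shows "pointwise_dim \<mu> \<in> borel_measurable borel"
proof -
  have "(\<lambda>x. scale_dim \<mu> x n) \<in> borel_measurable borel" for n
    unfolding scale_dim_def
    by (rule measurable_compose[OF measurable_pre, of "\<lambda>\<sigma>. log_prob (measure \<mu> (cylinder \<sigma>)) / ereal (ln ((1 / 2) ^ n))"]) simp
  then have "(\<lambda>x. liminf (scale_dim \<mu> x)) \<in> borel_measurable borel"
    by measurable
  moreover have "pointwise_dim \<mu> = (\<lambda>x. liminf (scale_dim \<mu> x))"
    by (intro ext pointwise_dim_eq_liminf assms)
  ultimately show ?thesis by (simp only:)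
qed

text \<open>After taking logarithms and dividing by \<open>n * ln 2\<close>, the polynomial factors
  and the logarithmic error of \<open>active_approx\<close> are of order
  \<open>ln n / n\<close>.\<close>

lemma pointwise_dim_eqI:
  assumes \<mu>: "prob_space \<mu>" and C: "C > 0" and K: "K > 0"
    and lower: "\<And>n. C / real (Suc n) * (1 / 2) ^ active y n \<le> measure \<mu> (cylinder (pre x n))"
    and upper: "\<And>n. measure \<mu> (cylinder (pre x n)) \<le> K * real (Suc n) ^ 2 * (1 / 2) ^ active y n"
  shows "pointwise_dim \<mu> x = ereal (binval y)"
proof -
  define g where "g n = ln (measure \<mu> (cylinder (pre x (Suc n)))) / (- real n * ln 2)" for n
  \<comment> \<open>The 2 bounds the term \<open>2 * ln 2\<close> that comes from the error
    \<open>real m + 1\<close> in the count of survivors.\<close>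
  define B where "B = \<bar>ln C\<bar> + \<bar>ln K\<bar> + 2"
  have pos: "measure \<mu> (cylinder (pre x n)) > 0" for n
    by (rule less_le_trans[OF _ lower]) (use C in auto)
  have bound: "\<bar>g n - binval y\<bar> \<le> (B + 4 * ln (real n + 2)) / (real n * ln 2)" if n: "n > 0" for n
  proof -
    let ?p = "measure \<mu> (cylinder (pre x (Suc n)))"
    let ?s = "real (active y (Suc n))"
    have s: "ln ((1 / 2 :: real) ^ active y (Suc n)) = - ?s * ln 2"
      by (simp add: ln_realpow ln_div)
    have "ln (C / real (Suc (Suc n)) * (1 / 2) ^ active y (Suc n)) \<le> ln ?p"
      by (rule ln_le_cancel_iff[THEN iffD2]) (use C pos lower[of "Suc n"] in auto)
    also have "ln (C / real (Suc (Suc n)) * (1 / 2) ^ active y (Suc n)) = ln C - ln (real n + 2) - ?s * ln 2"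
      using C by (simp add: ln_mult ln_div s add_ac)
    finally have lo: "ln C - ln (real n + 2) - ?s * ln 2 \<le> ln ?p" .
    have "ln ?p \<le> ln (K * real (Suc (Suc n)) ^ 2 * (1 / 2) ^ active y (Suc n))"
      by (rule ln_le_cancel_iff[THEN iffD2]) (use K pos upper[of "Suc n"] in auto)
    also have "\<dots> = ln K + 2 * ln (real n + 2) - ?s * ln 2"
      using K by (simp add: ln_mult ln_realpow ln_div add_ac)
    finally have hi: "ln ?p \<le> ln K + 2 * ln (real n + 2) - ?s * ln 2" .
    obtain m where m: "Suc n < 2 ^ m" "2 ^ m \<le> 2 * Suc (Suc n)" using ex_power2_near by blast
    have "(2::real) ^ m \<le> 2 * (real n + 2)" using m(2) by (simp flip: of_nat_le_iff[where 'a = real])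
    then have "ln ((2::real) ^ m) \<le> ln (2 * (real n + 2))" by (subst ln_le_cancel_iff) auto
    moreover have "ln (2 * (real n + 2)) = ln 2 + ln (real n + 2)" by (subst ln_mult) auto
    ultimately have mln: "real m * ln 2 \<le> ln 2 + ln (real n + 2)" by (simp only: ln_realpow zero_less_numeral)
    have "\<bar>real (Suc n) * binval y - ?s\<bar> \<le> real m" by (rule active_approx[OF m(1)])
    then have "\<bar>real n * binval y - ?s\<bar> \<le> real m + 1"
      using binval_bounds[of y] by (simp add: algebra_simps)
    then have "\<bar>real n * binval y - ?s\<bar> * ln 2 \<le> (real m + 1) * ln 2"
      by (intro mult_right_mono) auto
    also have "\<dots> \<le> 2 * ln 2 + ln (real n + 2)" using mln by (simp add: algebra_simps)
    finally have "\<bar>(real n * binval y - ?s) * ln 2\<bar> \<le> 2 * ln 2 + ln (real n + 2)" by (simp add: abs_mult)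
    moreover have "ln (2::real) \<le> 1" using ln_2_less_1 by simp
    moreover have "ln (real n + 2) \<ge> 0" by simp
    moreover have "(real n * binval y - ?s) * ln 2 = real n * binval y * ln 2 - ?s * ln 2" by (simp add: algebra_simps)
    ultimately have "\<bar>- ln ?p - real n * binval y * ln 2\<bar> \<le> B + 4 * ln (real n + 2)"
      using lo hi unfolding B_def by linarith
    moreover have "g n - binval y = (- ln ?p - real n * binval y * ln 2) / (real n * ln 2)"
      using n by (simp add: g_def field_simps)
    ultimately show ?thesis using n by (simp add: abs_divide divide_right_mono)
  qed
  have "(\<lambda>n. g n - binval y) \<longlonglongrightarrow> 0"
  proof (rule Lim_null_comparison)
    show "eventually (\<lambda>n. norm (g n - binval y) \<le> (B + 4 * ln (real n + 2)) / (real n * ln 2)) sequentially"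
      using eventually_gt_at_top[of 0] by eventually_elim (simp add: bound)
    show "(\<lambda>n. (B + 4 * ln (real n + 2)) / (real n * ln 2)) \<longlonglongrightarrow> 0" by real_asymp
  qed
  then have "g \<longlonglongrightarrow> binval y" using LIM_zero_cancel by blast
  then have "(\<lambda>n. ereal (g n)) \<longlonglongrightarrow> ereal (binval y)" by simp
  moreover have "eventually (\<lambda>n. ereal (g n) = scale_dim \<mu> x n) sequentially"
    using eventually_gt_at_top[of 0]
  proof eventually_elim
    case (elim n)
    have "ln ((1 / 2) ^ n) = - real n * ln (2::real)" by (simp add: ln_realpow ln_div)
    then show ?case using elim pos[of "Suc n"] by (simp add: scale_dim_def g_def log_prob_def)
  qed
  ultimately have "scale_dim \<mu> x \<longlonglongrightarrow> ereal (binval y)" by (rule Lim_transform_eventually)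
  then show ?thesis
    unfolding pointwise_dim_eq_liminf[OF \<mu>] by (intro lim_imp_Liminf) auto
qed

text \<open>Each string of length \<open>n\<close> has weight at most
  \<open>(1 / 2) ^ active y n\<close>, and the \<mu>-masses of these strings add up to 1; this
  bounds the expectation. Division by \<open>real (Suc n) ^ 2\<close> makes the expectations
  summable, so the series is almost surely finite and bounds each of its terms.\<close>

lemma AE_coin_measure_blend_le:
  assumes "\<mu> \<in> cantor_measures"
  shows "AE z in coin. \<exists>K>0. \<forall>n. measure \<mu> (cylinder (pre (blend y z) n)) \<le> K * real (Suc n) ^ 2 * (1 / 2) ^ active y n"
proof -
  interpret \<mu>: prob_space \<mu> using assms by (simp add: cantor_measures_def)
  have sets: "sets \<mu> = sets borel" and sp: "space \<mu> = UNIV"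
    using assms sets_eq_imp_space_eq[of \<mu> borel] by (auto simp: cantor_measures_def)
  interpret coin: prob_space coin by (rule prob_space_coin)
  define p where "p n z = measure \<mu> (cylinder (pre (blend y z) n))" for n z
  define F where "F n z = ennreal (2 ^ active y n / real (Suc n) ^ 2) * ennreal (p n z)" for n z
  have meas_p [measurable]: "(\<lambda>z. ennreal (p n z)) \<in> borel_measurable coin" for n
    unfolding p_def
    by (rule measurable_compose[OF measurable_blend measurable_compose[OF measurable_pre,
            of "\<lambda>\<sigma>. ennreal (measure \<mu> (cylinder \<sigma>))"]]) simp
  have int_p: "(\<integral>\<^sup>+ z. ennreal (p n z) \<partial>coin) \<le> ennreal ((1 / 2) ^ active y n)" for n
  proof -
    define Q where "Q = distr coin borel (blend y)"
    have "(\<integral>\<^sup>+ z. ennreal (p n z) \<partial>coin) = (\<integral>\<^sup>+ x. ennreal (measure \<mu> (cylinder (pre x n))) \<partial>Q)"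
      unfolding Q_def p_def
      by (rule nn_integral_distr[symmetric]) (use measurable_compose[OF measurable_pre, of "\<lambda>\<sigma>. ennreal (measure \<mu> (cylinder \<sigma>))" borel n] in auto)
    also have "\<dots> = (\<Sum>\<tau> | length \<tau> = n. ennreal (measure \<mu> (cylinder \<tau>)) * emeasure Q (cylinder \<tau>))"
      by (rule nn_integral_pre) (simp add: Q_def)
    also have "\<dots> \<le> (\<Sum>\<tau> | length \<tau> = n. ennreal (measure \<mu> (cylinder \<tau>)) * ennreal ((1 / 2) ^ active y n))"
    proof (intro sum_mono mult_left_mono)
      fix \<tau> :: "bool list" assume "\<tau> \<in> {\<tau>. length \<tau> = n}"
      then have "coin_weight y \<tau> \<le> (1 / 2) ^ active y n" using coin_weight_le[of y \<tau>] by simp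
      moreover have "emeasure Q (cylinder \<tau>) = ennreal (coin_weight y \<tau>)"
        unfolding Q_def measure_coin_blend[symmetric] coin.emeasure_eq_measure[symmetric]
        by (subst emeasure_distr) (auto simp: vimage_def)
      ultimately show "emeasure Q (cylinder \<tau>) \<le> ennreal ((1 / 2) ^ active y n)"
        by (simp add: ennreal_leI)
    qed simp
    also have "\<dots> = ennreal ((\<Sum>\<tau> | length \<tau> = n. measure \<mu> (cylinder \<tau>)) * (1 / 2) ^ active y n)"
      by (simp add: sum_distrib_right ennreal_mult sum_nonneg flip: sum_ennreal)
    also have "(\<Sum>\<tau> | length \<tau> = n. measure \<mu> (cylinder \<tau>)) = 1"
      using measure_pre[OF \<mu>.finite_measure_axioms sets, of n UNIV] \<mu>.prob_space by (simp add: sp)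
    finally show ?thesis by simp
  qed
  have int_F: "(\<integral>\<^sup>+ z. F n z \<partial>coin) \<le> ennreal (1 / real (Suc n) ^ 2)" for n
  proof -
    have "(\<integral>\<^sup>+ z. F n z \<partial>coin) = ennreal (2 ^ active y n / real (Suc n) ^ 2) * (\<integral>\<^sup>+ z. ennreal (p n z) \<partial>coin)"
      unfolding F_def by (rule nn_integral_cmult) measurable
    also have "\<dots> \<le> ennreal (2 ^ active y n / real (Suc n) ^ 2) * ennreal ((1 / 2) ^ active y n)"
      by (intro mult_left_mono int_p) simp
    also have "\<dots> = ennreal (1 / real (Suc n) ^ 2)"
      by (simp add: power_divide flip: ennreal_mult)
    finally show ?thesis .
  qed
  have meas_F [measurable]: "F n \<in> borel_measurable coin" for n
    unfolding F_def by measurable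
  have "(\<integral>\<^sup>+ z. (\<Sum>n. F n z) \<partial>coin) = (\<Sum>n. \<integral>\<^sup>+ z. F n z \<partial>coin)"
    by (rule nn_integral_suminf) measurable
  also have "\<dots> \<le> (\<Sum>n. ennreal (1 / real (Suc n) ^ 2))"
    by (intro suminf_le int_F) auto
  also have "\<dots> < \<infinity>"
    using sums_summable[OF inverse_squares_sums] by (subst suminf_ennreal2) (auto simp: add_ac)
  finally have "AE z in coin. (\<Sum>n. F n z) \<noteq> \<infinity>"
    by (intro nn_integral_PInf_AE) auto
  then show ?thesis
  proof eventually_elim
    case (elim z)
    obtain K where K: "(\<Sum>n. F n z) = ennreal K" "K \<ge> 0" using elim by (cases "\<Sum>n. F n z") auto
    \<comment> \<open>\<open>K + 1\<close> in place of \<open>K\<close>, because the constant has to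
      be positive and the sum might vanish.\<close>
    have "measure \<mu> (cylinder (pre (blend y z) n)) \<le> (K + 1) * real (Suc n) ^ 2 * (1 / 2) ^ active y n" for n
    proof -
      have "F n z \<le> (\<Sum>n. F n z)" using sum_le_suminf[of "\<lambda>n. F n z" "{n}"] by simp
      moreover have "ennreal (2 ^ active y n / real (Suc n) ^ 2 * p n z) = F n z"
        unfolding F_def by (rule ennreal_mult) (auto simp: p_def)
      ultimately have "ennreal (2 ^ active y n / real (Suc n) ^ 2 * p n z) \<le> ennreal K"
        unfolding K by (simp only:)
      then have "2 ^ active y n / real (Suc n) ^ 2 * p n z \<le> K" using K(2) by simp
      then have "p n z \<le> K * real (Suc n) ^ 2 / 2 ^ active y n" by (simp add: field_simps)
      also have "\<dots> \<le> (K + 1) * real (Suc n) ^ 2 / 2 ^ active y n"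
        by (intro divide_right_mono mult_right_mono) auto
      finally show ?thesis by (simp add: p_def power_divide)
    qed
    then show ?case using K(2) by (intro exI[of _ "K + 1"]) auto
  qed
qed

section \<open>Neutral measures dominate computable mixtures\<close>

lemma undergraph_inj:
  assumes "undergraph f = undergraph g" shows "f = g"
proof
  fix \<sigma>
  have *: "of_rat q < f \<sigma> \<longleftrightarrow> of_rat q < g \<sigma>" for q
  proof -
    have "(\<sigma>, q) \<in> undergraph f \<longleftrightarrow> (\<sigma>, q) \<in> undergraph g" by (simp only: assms)
    then show ?thesis by (simp add: undergraph_def)
  qed
  show "f \<sigma> = g \<sigma>"
  proof (cases "f \<sigma>" "g \<sigma>" rule: linorder_cases)
    case less
    from of_rat_dense[OF this] obtain q where "f \<sigma> < of_rat q" "of_rat q < g \<sigma>" by blast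
    then show ?thesis using *[of q] by simp
  next
    case greater
    from of_rat_dense[OF this] obtain q where "g \<sigma> < of_rat q" "of_rat q < f \<sigma>" by blast
    then show ?thesis using *[of q] by simp
  qed
qed

lemma test_semimeasure_eqI:
  assumes "semimeasure f" "test_output T \<mu> = undergraph f"
  shows "test_semimeasure T \<mu> = f"
  unfolding test_semimeasure_def
  by (rule the_equality) (use assms undergraph_inj in auto)

lemma neutral_dominates:
  assumes "neutral \<mu>" "ce_test T"
  shows "\<exists>c>0. \<forall>\<sigma>. c * test_semimeasure T \<mu> \<sigma> \<le> measure \<mu> (cylinder \<sigma>)"
proof -
  from assms(1) obtain U where \<mu>: "\<mu> \<in> cantor_measures" and U: "universal_ce_test U" "passes \<mu> U"
    unfolding neutral_def by auto
  from U(1) assms(2) obtain c :: rat where c: "c > 0"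
    "\<forall>\<mu> \<in> cantor_measures. \<forall>\<sigma>. test_semimeasure U \<mu> \<sigma> \<ge> of_rat c * test_semimeasure T \<mu> \<sigma>"
    unfolding universal_ce_test_def by blast
  have "of_rat c * test_semimeasure T \<mu> \<sigma> \<le> measure \<mu> (cylinder \<sigma>)" for \<sigma>
    using c(2) \<mu> U(2) unfolding passes_def by (meson order_trans)
  moreover have "(0::real) < of_rat c" using c(1) by simp
  ultimately show ?thesis by blast
qed

lemma ce_test_iff:
  "ce_test T \<longleftrightarrow> semidecidable (\<lambda>x. x \<in> T) \<and>
    (\<forall>\<mu> \<in> cantor_measures. \<exists>f. semimeasure f \<and> test_output T \<mu> = undergraph f)"
  unfolding ce_test_def by (simp only: enc_eq_encode ce_encode_iff)

text \<open>With an empty list of conditions the output does not depend on the measure. The power of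
  \<open>1 / 2\<close> is written as a product, the form for which a computability rule on rationals
  is available.\<close>

definition uniform_test :: test where
  "uniform_test = {p. fst p = [] \<and> snd (snd p) < (\<Prod>i<length (fst (snd p)). 1 / 2)}"

lemma test_output_uniform_test:
  "test_output uniform_test \<mu> = undergraph (\<lambda>\<sigma>. measure coin (cylinder \<sigma>))"
proof -
  have "q < (1 / 2) ^ n \<longleftrightarrow> real_of_rat q < (1 / 2) ^ n" for q n
    using of_rat_less[where 'a = real, of q "(1 / 2) ^ n"] by (simp add: of_rat_power of_rat_divide)
  then show ?thesis
    by (auto simp: test_output_def uniform_test_def undergraph_def measure_coin_cylinder)
qed

lemma ce_test_uniform_test: "ce_test uniform_test"
  unfolding ce_test_iff
proof
  show "semidecidable (\<lambda>x. x \<in> uniform_test)"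
    unfolding uniform_test_def mem_Collect_eq
    by (intro semidecidable_computable computable_intros)
  show "\<forall>\<mu>\<in>cantor_measures. \<exists>f. semimeasure f \<and> test_output uniform_test \<mu> = undergraph f"
    using test_output_uniform_test semimeasure_measure[OF coin_in_cantor_measures] by blast
qed

text \<open>Serves twice: as full support when uniform tests are bounded at every point, and
  quantitatively for the mass of the bits of \<open>y\<close> that fix the erased positions.\<close>

lemma neutral_dominates_coin:
  assumes "neutral \<mu>"
  shows "\<exists>c>0. \<forall>\<sigma>. c * (1 / 2) ^ length \<sigma> \<le> measure \<mu> (cylinder \<sigma>)"
  using neutral_dominates[OF assms ce_test_uniform_test]
    test_semimeasure_eqI[OF semimeasure_measure[OF coin_in_cantor_measures] test_output_uniform_test]
  by (simp add: measure_coin_cylinder)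

text \<open>The rational, hence codable, version of \<open>coin_weight\<close> for a zero-padded
  string.\<close>

definition string_weight :: "bool list \<Rightarrow> bool list \<Rightarrow> rat" where
  "string_weight \<tau> \<sigma> = (\<Prod>k<length \<sigma>. if nth_default False \<tau> (v2 (Suc k)) then 1 / 2
    else if nth_default False \<sigma> k then 0 else 1)"

lemma of_rat_prod: "of_rat (prod f A) = (\<Prod>x\<in>A. of_rat (f x) :: 'a::field_char_0)"
  by (induction A rule: infinite_finite_induct) (auto simp: of_rat_mult)

lemma of_rat_string_weight: "of_rat (string_weight \<tau> \<sigma>) = coin_weight (nth_default False \<tau>) \<sigma>"
  unfolding string_weight_def coin_weight_def of_rat_prod
  by (intro prod.cong) (auto simp: nth_default_nth of_rat_divide)

lemma computable_v2_Suc [computable_intros]: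
  assumes "computable F"
  shows "computable (\<lambda>e. v2 (Suc (F e)))"
  unfolding v2_def
proof (rule computable_Least)
  show "computable (\<lambda>z. \<not> 2 ^ Suc (snd z) dvd Suc (F (fst z)))"
    by (intro computable_intros computable_compose[OF assms])
qed (use ex_not_power2_dvd in blast)

lemma computable_string_weight [computable_intros]:
  assumes "computable F" "computable G"
  shows "computable (\<lambda>e. string_weight (F e) (G e))"
proof (rule computable_comp2[OF _ assms])
  show "computable (\<lambda>z. string_weight (fst z) (snd z))"
    unfolding string_weight_def by (intro computable_intros)
qed

text \<open>Lower bounds for \<open>\<mu>\<close> at distinct strings of the length of \<open>\<sigma>\<close> add up to a lower bound for
  \<open>blended \<mu>\<close> at \<open>\<sigma>\<close>.\<close>

definition blend_test :: test where
  "blend_test = {p. (\<forall>c\<in>set (fst p). length (fst c) = length (fst (snd p)))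
    \<and> sorted_wrt (\<lambda>c d. fst c \<noteq> fst d) (fst p)
    \<and> snd (snd p) < (\<Sum>c\<leftarrow>fst p. snd c * string_weight (fst c) (fst (snd p)))}"

text \<open>A strict inequality leaves room to replace every real factor by a slightly smaller
  rational; this is how a true inequality is turned into a finite certificate.\<close>

lemma rational_lower_bounds:
  fixes m w :: "'a \<Rightarrow> real"
  assumes w: "\<And>t. t \<in> set ts \<Longrightarrow> w t \<ge> 0" and q: "q < (\<Sum>t\<leftarrow>ts. m t * w t)"
  shows "\<exists>l :: 'a \<Rightarrow> rat. (\<forall>t. of_rat (l t) < m t) \<and> q < (\<Sum>t\<leftarrow>ts. of_rat (l t) * w t)"
proof -
  define W where "W = (\<Sum>t\<leftarrow>ts. w t)"
  have W: "W \<ge> 0" unfolding W_def using w by (intro sum_list_nonneg) auto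
  \<comment> \<open>Lowering each \<open>m t\<close> by at most \<open>d\<close> loses at most
    \<open>d * W\<close>, which is below the available gap; \<open>W + 1\<close> avoids division by
    zero.\<close>
  define d where "d = ((\<Sum>t\<leftarrow>ts. m t * w t) - q) / (W + 1)"
  have d: "d > 0" using q W by (simp add: d_def)
  have dW: "d * W < (\<Sum>t\<leftarrow>ts. m t * w t) - q"
  proof -
    have "d * W < d * (W + 1)" using d by simp
    also have "\<dots> = (\<Sum>t\<leftarrow>ts. m t * w t) - q" using W by (simp add: d_def)
    finally show ?thesis .
  qed
  have "\<exists>r. m t - d < of_rat r \<and> of_rat r < m t" for t using of_rat_dense[of "m t - d" "m t"] d by auto
  then obtain l where l: "\<And>t. m t - d < of_rat (l t)" "\<And>t. of_rat (l t) < m t" by metis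
  have "(\<Sum>t\<leftarrow>ts. m t * w t) - d * W = (\<Sum>t\<leftarrow>ts. (m t - d) * w t)"
    unfolding W_def by (simp add: left_diff_distrib sum_list_subtractf sum_list_const_mult)
  also have "\<dots> \<le> (\<Sum>t\<leftarrow>ts. of_rat (l t) * w t)"
    by (intro sum_list_mono mult_right_mono less_imp_le[OF l(1)] w)
  finally show ?thesis using l(2) dW by (intro exI[of _ l]) auto
qed

lemma distinct_map_iff_sorted_wrt: "distinct (map f xs) \<longleftrightarrow> sorted_wrt (\<lambda>x y. f x \<noteq> f y) xs"
  by (induction xs) auto

lemma of_rat_sum_list: "of_rat (\<Sum>x\<leftarrow>xs. f x) = (\<Sum>x\<leftarrow>xs. of_rat (f x) :: 'a::field_char_0)"
  by (induction xs) (auto simp: of_rat_add)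

lemma test_output_blend_test:
  assumes "\<mu> \<in> cantor_measures"
  shows "test_output blend_test \<mu> = undergraph (\<lambda>\<sigma>. measure (blended \<mu>) (cylinder \<sigma>))"
proof -
  let ?m = "\<lambda>\<tau>. measure \<mu> (cylinder \<tau>)" and ?w = "\<lambda>\<tau>. coin_weight (nth_default False \<tau>)"
  have "(\<sigma>, q) \<in> test_output blend_test \<mu> \<longleftrightarrow> of_rat q < measure (blended \<mu>) (cylinder \<sigma>)" for \<sigma> q
  proof
    assume "(\<sigma>, q) \<in> test_output blend_test \<mu>"
    then obtain cs where cs: "\<forall>c\<in>set cs. length (fst c) = length \<sigma>" "sorted_wrt (\<lambda>c d. fst c \<noteq> fst d) cs"
        "q < (\<Sum>c\<leftarrow>cs. snd c * string_weight (fst c) \<sigma>)" "\<forall>c\<in>set cs. of_rat (snd c) < ?m (fst c)"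
      unfolding test_output_def blend_test_def by force
    have dist: "distinct (map fst cs)"
      unfolding distinct_map_iff_sorted_wrt by (rule cs(2))
    have "real_of_rat q < of_rat (\<Sum>c\<leftarrow>cs. snd c * string_weight (fst c) \<sigma>)"
      using cs(3) by (simp only: of_rat_less)
    also have "\<dots> = (\<Sum>c\<leftarrow>cs. of_rat (snd c) * ?w (fst c) \<sigma>)"
      by (simp add: of_rat_sum_list of_rat_mult of_rat_string_weight)
    also have "\<dots> \<le> (\<Sum>c\<leftarrow>cs. ?m (fst c) * ?w (fst c) \<sigma>)"
      using cs(4) by (intro sum_list_mono mult_right_mono coin_weight_nonneg) auto
    also have "\<dots> = (\<Sum>\<tau>\<leftarrow>map fst cs. ?m \<tau> * ?w \<tau> \<sigma>)" by (simp add: comp_def)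
    also have "\<dots> = (\<Sum>\<tau>\<in>set (map fst cs). ?m \<tau> * ?w \<tau> \<sigma>)"
      by (rule sum_list_distinct_conv_sum_set[OF dist])
    \<comment> \<open>Distinctness prevents double counting, and strings missing from the
      certificate contribute nonnegative terms.\<close>
    also have "\<dots> \<le> (\<Sum>\<tau> | length \<tau> = length \<sigma>. ?m \<tau> * ?w \<tau> \<sigma>)"
      using cs(1) finite_strings[of "length \<sigma>" "\<lambda>_. True"]
      by (intro sum_mono2) (auto intro!: mult_nonneg_nonneg coin_weight_nonneg)
    finally show "of_rat q < measure (blended \<mu>) (cylinder \<sigma>)"
      unfolding measure_blended_cylinder[OF assms] .
  next
    assume q: "of_rat q < measure (blended \<mu>) (cylinder \<sigma>)"
    obtain ts where ts: "set ts = {\<tau> :: bool list. length \<tau> = length \<sigma>}" "distinct ts"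
      using finite_distinct_list[OF finite_strings[of "length \<sigma>" "\<lambda>_. True"]] by auto
    have "real_of_rat q < (\<Sum>\<tau>\<leftarrow>ts. ?m \<tau> * ?w \<tau> \<sigma>)"
      using q unfolding measure_blended_cylinder[OF assms] sum_list_distinct_conv_sum_set[OF ts(2)] ts(1) .
    from rational_lower_bounds[OF _ this] obtain l where l: "\<And>\<tau>. of_rat (l \<tau>) < ?m \<tau>"
      "of_rat q < (\<Sum>\<tau>\<leftarrow>ts. of_rat (l \<tau>) * ?w \<tau> \<sigma>)" using coin_weight_nonneg by blast
    define cs where "cs = map (\<lambda>\<tau>. (\<tau>, l \<tau>)) ts"
    have "real_of_rat q < of_rat (\<Sum>c\<leftarrow>cs. snd c * string_weight (fst c) \<sigma>)"
      using l(2) unfolding cs_def by (simp add: of_rat_sum_list of_rat_mult of_rat_string_weight comp_def)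
    then have "q < (\<Sum>c\<leftarrow>cs. snd c * string_weight (fst c) \<sigma>)" by (simp only: of_rat_less)
    moreover have "sorted_wrt (\<lambda>c d. fst c \<noteq> fst d) cs"
      unfolding distinct_map_iff_sorted_wrt[symmetric] using ts(2) by (simp add: cs_def comp_def)
    ultimately have "(cs, (\<sigma>, q)) \<in> blend_test"
      unfolding blend_test_def using ts(1) by (auto simp: cs_def)
    then show "(\<sigma>, q) \<in> test_output blend_test \<mu>"
      unfolding test_output_def using l(1) by (auto simp: cs_def intro!: exI[of _ cs])
  qed
  then show ?thesis by (auto simp: undergraph_def)
qed

lemma semimeasure_blended:
  "\<mu> \<in> cantor_measures \<Longrightarrow> semimeasure (\<lambda>\<sigma>. measure (blended \<mu>) (cylinder \<sigma>))"
  by (intro semimeasure_measure blended_in_cantor_measures)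

lemma ce_test_blend_test: "ce_test blend_test"
  unfolding ce_test_iff
proof
  show "semidecidable (\<lambda>x. x \<in> blend_test)"
    unfolding blend_test_def mem_Collect_eq
    by (intro semidecidable_computable computable_intros)
  show "\<forall>\<mu>\<in>cantor_measures. \<exists>f. semimeasure f \<and> test_output blend_test \<mu> = undergraph f"
    using test_output_blend_test semimeasure_blended by blast
qed

text \<open>The passage from cylinders to Borel sets is essential, since the inequality will be
  applied to a set defined by the pointwise dimension.\<close>

lemma neutral_dominates_blended:
  assumes "neutral \<mu>"
  shows "\<exists>c>0. \<forall>A\<in>sets borel. c * measure (blended \<mu>) A \<le> measure \<mu> A"
proof -
  have \<mu>: "\<mu> \<in> cantor_measures" using assms by (simp add: neutral_def)
  have fin: "finite_measure M \<and> sets M = sets borel" if "M \<in> cantor_measures" for M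
    using that prob_space.finite_measure by (auto simp: cantor_measures_def)
  have eq: "test_semimeasure blend_test \<mu> = (\<lambda>\<sigma>. measure (blended \<mu>) (cylinder \<sigma>))"
    by (intro test_semimeasure_eqI semimeasure_blended test_output_blend_test \<mu>)
  from neutral_dominates[OF assms ce_test_blend_test] obtain c where c: "c > 0"
    "\<And>\<sigma>. c * measure (blended \<mu>) (cylinder \<sigma>) \<le> measure \<mu> (cylinder \<sigma>)"
    unfolding eq by blast
  have "c * measure (blended \<mu>) A \<le> measure \<mu> A" if "A \<in> sets borel" for A
    by (rule cylinder_domination[OF conjunct1[OF fin[OF \<mu>]] conjunct2[OF fin[OF \<mu>]]
          conjunct1[OF fin[OF blended_in_cantor_measures[OF \<mu>]]]
          conjunct2[OF fin[OF blended_in_cantor_measures[OF \<mu>]]] less_imp_le[OF c(1)] c(2) that])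
  with c(1) show ?thesis by blast
qed

section \<open>Pulling back uniform tests along the binary expansion\<close>

text \<open>\<open>lo\<close> and \<open>hi\<close> are the endpoints of the dyadic interval of a
  string, written as a list recursion with rational sums and products so that the closure rules
  apply.\<close>

definition lo :: "bool list \<Rightarrow> rat" where
  "lo \<tau> = rec_list 0 (\<lambda>b bs y. (if b then 1 / 2 else 0) + y * (1 / 2)) \<tau>"

definition hi :: "bool list \<Rightarrow> rat" where
  "hi \<tau> = rec_list 1 (\<lambda>b bs y. (if b then 1 / 2 else 0) + y * (1 / 2)) \<tau>"

text \<open>The expansion map sends a cylinder into the closed dyadic interval, so strict
  inequalities place the image inside an open one. Relative neighbourhoods of 0 and 1 are named with
  endpoints outside the unit interval, so nothing is lost there.\<close>

definition fits :: "bool list \<Rightarrow> rat \<times> rat \<Rightarrow> bool" where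
  "fits \<tau> I \<longleftrightarrow> fst I < lo \<tau> \<and> hi \<tau> < snd I"

text \<open>Neither string is a prefix of the other: a decidable form of disjointness of the
  cylinders.\<close>

definition incompatible :: "bool list \<Rightarrow> bool list \<Rightarrow> bool" where
  "incompatible \<sigma> \<tau> \<longleftrightarrow> (\<exists>i<length \<sigma>. i < length \<tau> \<and> nth_default False \<sigma> i \<noteq> nth_default False \<tau> i)"

text \<open>In this argument order the second string extends the first.\<close>

definition extends :: "bool list \<Rightarrow> bool list \<Rightarrow> bool" where
  "extends \<sigma> \<tau> \<longleftrightarrow> length \<sigma> \<le> length \<tau> \<and> (\<forall>i<length \<sigma>. nth_default False \<sigma> i = nth_default False \<tau> i)"

lemma computable_fits [computable_intros]:
  assumes "computable F" "computable G"
  shows "computable (\<lambda>e. fits (F e) (G e))"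
proof (rule computable_comp2[OF _ assms])
  show "computable (\<lambda>z. fits (fst z) (snd z))"
    unfolding fits_def lo_def hi_def by (intro computable_intros)
qed

lemma computable_incompatible [computable_intros]:
  assumes "computable F" "computable G"
  shows "computable (\<lambda>e. incompatible (F e) (G e))"
proof (rule computable_comp2[OF _ assms])
  show "computable (\<lambda>z. incompatible (fst z) (snd z))"
    unfolding incompatible_def by (intro computable_intros)
qed

lemma computable_extends [computable_intros]:
  assumes "computable F" "computable G"
  shows "computable (\<lambda>e. extends (F e) (G e))"
proof (rule computable_comp2[OF _ assms])
  show "computable (\<lambda>z. extends (fst z) (snd z))"
    unfolding extends_def by (intro computable_intros)
qed

lemma lo_hi_Cons:
  "lo [] = 0" "hi [] = 1"
  "lo (b # \<tau>) = (of_bool b + lo \<tau>) / 2" "hi (b # \<tau>) = (of_bool b + hi \<tau>) / 2"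
  by (auto simp: lo_def hi_def field_simps)

lemma hi_minus_lo: "hi \<tau> - lo \<tau> = (1 / 2) ^ length \<tau>"
  by (induction \<tau>) (auto simp: lo_hi_Cons field_simps)

lemma pre_Suc: "pre y (Suc n) = y 0 # pre (\<lambda>i. y (Suc i)) n"
  by (rule nth_equalityI) (auto simp: nth_Cons split: nat.splits)

lemma binval_between_pre: "of_rat (lo (pre y n)) \<le> binval y" "binval y \<le> of_rat (hi (pre y n))"
proof (induction n arbitrary: y)
  case 0
  {
    case 1
    show ?case by (simp add: pre_def lo_hi_Cons binval_bounds)
  next
    case 2
    show ?case by (simp add: pre_def lo_hi_Cons binval_bounds)
  }
next
  case (Suc n)
  {
    case 1
    show ?case using Suc(1)[of "\<lambda>i. y (Suc i)"]
      by (simp add: pre_Suc lo_hi_Cons binval_halve[of y] of_rat_divide of_rat_add of_bool_def)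
  next
    case 2
    show ?case using Suc(2)[of "\<lambda>i. y (Suc i)"]
      by (simp add: pre_Suc lo_hi_Cons binval_halve[of y] of_rat_divide of_rat_add of_bool_def)
  }
qed

lemma binval_between:
  assumes "y \<in> cylinder \<tau>"
  shows "of_rat (lo \<tau>) \<le> binval y" "binval y \<le> of_rat (hi \<tau>)"
  using binval_between_pre[where n = "length \<tau>" and y = y] assms
  by (auto simp: mem_cylinder_iff)

lemma fits_imp_rat_interval:
  assumes "fits \<tau> I" "y \<in> cylinder \<tau>"
  shows "binval y \<in> rat_interval I"
proof -
  have "(of_rat (fst I) :: real) < of_rat (lo \<tau>)" "(of_rat (hi \<tau>) :: real) < of_rat (snd I)"
    using assms(1) by (auto simp: fits_def of_rat_less)
  with binval_between[OF assms(2)] binval_bounds[of y] show ?thesis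
    by (auto simp: rat_interval_def)
qed

lemma eventually_fits:
  assumes "binval y \<in> rat_interval I"
  shows "eventually (\<lambda>n. fits (pre y n) I) sequentially"
proof -
  define a b :: real where "a = of_rat (fst I)" and "b = of_rat (snd I)"
  have ab: "a < binval y" "binval y < b" using assms by (auto simp: rat_interval_def a_def b_def)
  have "eventually (\<lambda>n. (1 / 2 :: real) ^ n < min (binval y - a) (b - binval y)) sequentially"
    by (rule order_tendstoD(2)[OF LIMSEQ_power_zero]) (use ab in auto)
  then show ?thesis
  proof eventually_elim
    case (elim n)
    have "real_of_rat (hi (pre y n) - lo (pre y n)) = (1 / 2) ^ n"
      unfolding hi_minus_lo by (simp add: of_rat_power of_rat_divide)
    then have "real_of_rat (hi (pre y n)) = of_rat (lo (pre y n)) + (1 / 2) ^ n"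
      by (simp add: of_rat_diff)
    then have "a < of_rat (lo (pre y n))" "of_rat (hi (pre y n)) < b"
      using binval_between_pre[where n = n and y = y] elim by auto
    then show ?case by (simp add: fits_def a_def b_def of_rat_less)
  qed
qed

text \<open>Digits are produced by the doubling map; peeling off one digit halves the error, which
  therefore lies below every power of \<open>1 / 2\<close>.\<close>

lemma binval_surj:
  assumes "0 \<le> x" "x \<le> 1"
  shows "\<exists>y. binval y = x"
proof -
  \<comment> \<open>With a non-strict comparison the point 1 is fixed and receives the digits 1, 1,
    1 and so on.\<close>
  define next_x where "next_x v = (if v \<ge> 1 / 2 then 2 * v - 1 else 2 * v)" for v :: real
  define X where "X n = (next_x ^^ n) x" for n
  define y where "y n \<longleftrightarrow> X n \<ge> 1 / 2" for n
  have X: "0 \<le> X n \<and> X n \<le> 1" for n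
    by (induction n) (use assms in \<open>auto simp: X_def next_x_def\<close>)
  have step: "X n = (of_bool (y n) + X (Suc n)) / 2" for n
    by (simp add: X_def y_def next_x_def)
  have shift: "binval (\<lambda>i. y (n + i)) = (of_bool (y n) + binval (\<lambda>i. y (Suc n + i))) / 2" for n
    using binval_halve[of "\<lambda>i. y (n + i)"] by simp
  have "\<bar>binval y - x\<bar> = (1 / 2) ^ n * \<bar>binval (\<lambda>i. y (n + i)) - X n\<bar>" for n
  proof (induction n)
    case 0
    show ?case by (simp add: X_def)
  next
    case (Suc n)
    have "binval (\<lambda>i. y (n + i)) - X n = (binval (\<lambda>i. y (Suc n + i)) - X (Suc n)) / 2"
      unfolding shift[of n] step[of n] by (simp add: field_simps)
    then have "\<bar>binval (\<lambda>i. y (n + i)) - X n\<bar> = \<bar>binval (\<lambda>i. y (Suc n + i)) - X (Suc n)\<bar> / 2"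
      by (simp only: abs_divide abs_numeral)
    then show ?case using Suc by simp
  qed
  moreover have "\<bar>binval (\<lambda>i. y (n + i)) - X n\<bar> \<le> 1" for n
    using binval_bounds[of "\<lambda>i. y (n + i)"] X[of n] by auto
  ultimately have "\<bar>binval y - x\<bar> \<le> (1 / 2) ^ n" for n
    by (metis mult.right_neutral mult_left_mono zero_le_divide_1_iff zero_le_numeral zero_le_power)
  then have "\<bar>binval y - x\<bar> \<le> 0"
    by (intro LIMSEQ_le_const[OF LIMSEQ_power_zero[of "1 / 2 :: real"]]) auto
  then show ?thesis by auto
qed

section \<open>The image measure on the unit interval and certificates for uniform tests\<close>

lemma measurable_binval [measurable]: "binval \<in> borel_measurable borel"
  unfolding binval_def[abs_def] by measurable

definition binval_distr :: "(nat \<Rightarrow> bool) measure \<Rightarrow> real measure" where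
  "binval_distr \<mu> = distr \<mu> (restrict_space borel {0..1}) binval"

lemma measurable_binval_unit:
  assumes "sets \<mu> = sets borel"
  shows "binval \<in> \<mu> \<rightarrow>\<^sub>M restrict_space borel {0..1}"
proof (rule measurable_restrict_space2)
  show "binval \<in> borel_measurable \<mu>"
    using measurable_binval measurable_cong_sets[OF assms refl] by blast
qed (auto simp: binval_bounds)

lemma binval_distr_in_unit_measures:
  assumes "\<mu> \<in> cantor_measures"
  shows "binval_distr \<mu> \<in> unit_measures"
  using assms unfolding unit_measures_def cantor_measures_def binval_distr_def
  by (simp add: prob_space.prob_space_distr measurable_binval_unit)

lemma sets_rat_interval [measurable]: "rat_interval I \<in> sets (restrict_space borel {0..1})"
  unfolding rat_interval_def by (subst sets_restrict_space_iff) auto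

lemma measure_binval_distr_rat_interval:
  assumes "\<mu> \<in> cantor_measures"
  shows "measure (binval_distr \<mu>) (rat_interval I) = measure \<mu> {y. binval y \<in> rat_interval I}"
proof -
  have sets: "sets \<mu> = sets borel" using assms by (simp add: cantor_measures_def)
  have "space \<mu> = UNIV" using sets_eq_imp_space_eq[OF sets] by simp
  then show ?thesis
    unfolding binval_distr_def
    by (subst measure_distr[OF measurable_binval_unit[OF sets] sets_rat_interval]) (simp add: vimage_def)
qed

text \<open>An item \<open>(I\<^sub>i, q\<^sub>i), J, q\<close> of a uniform test is certified by a list of lower bounds for cylinder
  measures if each condition \<open>\<nu> I\<^sub>i > q\<^sub>i\<close> on the image \<open>\<nu>\<close> of the measure follows from the bounds
  at disjoint cylinders that the binary expansion maps into \<open>I\<^sub>i\<close>.\<close>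

type_synonym item = "((rat \<times> rat) \<times> rat) list \<times> ((rat \<times> rat) \<times> rat)"

definition certified :: "(bool list \<times> rat) list \<Rightarrow> item \<Rightarrow> bool" where
  "certified cs e \<longleftrightarrow> (\<forall>c\<in>set (fst e). \<exists>as. (\<forall>a\<in>set as. a \<in> set cs \<and> fits (fst a) (fst c))
    \<and> sorted_wrt (\<lambda>a b. incompatible (fst a) (fst b)) as \<and> snd c < (\<Sum>a\<leftarrow>as. snd a))"

text \<open>An entry \<open>((\<tau>, l), e)\<close> stands for a step of a lower approximation to
  the integral of \<open>t\<close> over the cylinder of \<sigma>: \<tau> extends \<sigma>,
  \<open>l\<close> is a lower bound for its mass, and the certified item \<open>e\<close> guarantees
  that \<open>t\<close> is at least its value on the image of \<tau>. Incompatibility makes the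
  steps disjoint.\<close>

definition payoff_list :: "unit_test \<Rightarrow> (bool list \<times> rat) list \<Rightarrow> bool list
    \<Rightarrow> ((bool list \<times> rat) \<times> item) list \<Rightarrow> bool" where
  "payoff_list E cs \<sigma> ds \<longleftrightarrow> (\<forall>d\<in>set ds. fst d \<in> set cs \<and> extends \<sigma> (fst (fst d)) \<and> snd d \<in> E
      \<and> fits (fst (fst d)) (fst (snd (snd d))) \<and> certified cs (snd d))
    \<and> sorted_wrt (\<lambda>d d'. incompatible (fst (fst d)) (fst (fst d'))) ds"

definition payoff :: "((bool list \<times> rat) \<times> item) list \<Rightarrow> rat" where
  "payoff ds = (\<Sum>d\<leftarrow>ds. snd (fst d) * snd (snd (snd d)))"

definition interval_test :: "unit_test \<Rightarrow> test" where
  "interval_test E = {p. \<exists>ds. payoff_list E (fst p) (fst (snd p)) ds \<and> snd (snd p) < payoff ds}"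

lemma semidecidable_interval_test:
  assumes E: "semidecidable (\<lambda>e. e \<in> E)"
  shows "semidecidable (\<lambda>p. p \<in> interval_test E)"
  unfolding interval_test_def mem_Collect_eq payoff_list_def certified_def payoff_def
  \<comment> \<open>The semidecidability rules come first; only what they leave over is treated as
    computable, as unbounded quantifiers and membership in \<open>E\<close> have no computability
    rule.\<close>
  by ((rule semidecidable_ex semidecidable_conj semidecidable_ball_list semidecidable_compose[OF E])
      | (rule semidecidable_computable) | (rule computable_intros))+

definition sound :: "(nat \<Rightarrow> bool) measure \<Rightarrow> (bool list \<times> rat) list \<Rightarrow> bool" where
  "sound \<mu> cs \<longleftrightarrow> (\<forall>c\<in>set cs. of_rat (snd c) < measure \<mu> (cylinder (fst c)))"

definition holds :: "real measure \<Rightarrow> item \<Rightarrow> bool" where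
  "holds \<nu> e \<longleftrightarrow> (\<forall>c\<in>set (fst e). of_rat (snd c) < measure \<nu> (rat_interval (fst c)))"

lemma test_output_interval_test:
  "test_output (interval_test E) \<mu> = {(\<sigma>, q). \<exists>cs ds. sound \<mu> cs \<and> payoff_list E cs \<sigma> ds \<and> q < payoff ds}"
proof -
  have "(\<sigma>, q) \<in> test_output (interval_test E) \<mu>
      \<longleftrightarrow> (\<exists>cs ds. sound \<mu> cs \<and> payoff_list E cs \<sigma> ds \<and> q < payoff ds)" for \<sigma> q
    by (simp add: test_output_def interval_test_def sound_def case_prod_beta) blast
  then show ?thesis by auto
qed

lemma sum_list_ennreal:
  assumes "\<And>x. x \<in> set xs \<Longrightarrow> 0 \<le> f x"
  shows "(\<Sum>x\<leftarrow>xs. ennreal (f x)) = ennreal (\<Sum>x\<leftarrow>xs. f x)"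
  using assms
proof (induction xs)
  case (Cons a xs)
  have "0 \<le> f a" "0 \<le> (\<Sum>x\<leftarrow>xs. f x)" by (auto intro!: sum_list_nonneg Cons.prems)
  then show ?case using Cons by (simp add: ennreal_plus)
qed simp

lemma incompatible_disjoint: "incompatible \<sigma> \<tau> \<Longrightarrow> x \<in> cylinder \<sigma> \<Longrightarrow> x \<notin> cylinder \<tau>"
  by (auto simp: incompatible_def cylinder_def nth_default_nth)

text \<open>Each point lies in at most one of the cylinders, so the weighted sum of indicators stays
  below \<open>g\<close>. Used with weight 1 for certificates and with the values of items for
  payoffs.\<close>

lemma incompatible_sum_le_nn_integral:
  assumes sets: "sets M = sets borel"
    and anti: "sorted_wrt (\<lambda>d d'. incompatible (s d) (s d')) ds"
    and le: "\<And>d y. d \<in> set ds \<Longrightarrow> y \<in> cylinder (s d) \<Longrightarrow> w d \<le> g y"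
  shows "(\<Sum>d\<leftarrow>ds. w d * emeasure M (cylinder (s d))) \<le> (\<integral>\<^sup>+ y. g y \<partial>M)"
proof -
  have m: "(\<lambda>y. w d * indicator (cylinder (s d)) y) \<in> borel_measurable M" for d
    by (intro borel_measurable_times_ennreal borel_measurable_indicator borel_measurable_const)
      (simp add: sets)
  have int: "(\<integral>\<^sup>+ y. (\<Sum>d\<leftarrow>es. w d * indicator (cylinder (s d)) y) \<partial>M)
      = (\<Sum>d\<leftarrow>es. w d * emeasure M (cylinder (s d)))" for es
  proof (induction es)
    case (Cons d es)
    have "(\<lambda>y. \<Sum>d\<leftarrow>es. w d * indicator (cylinder (s d)) y) \<in> borel_measurable M"
    proof (induction es)
      case (Cons a es)
      then show ?case unfolding list.map sum_list.Cons by (intro borel_measurable_add m)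
    qed simp
    then have "(\<integral>\<^sup>+ y. (\<Sum>d\<leftarrow>d # es. w d * indicator (cylinder (s d)) y) \<partial>M)
        = (\<integral>\<^sup>+ y. w d * indicator (cylinder (s d)) y \<partial>M) + (\<integral>\<^sup>+ y. (\<Sum>d\<leftarrow>es. w d * indicator (cylinder (s d)) y) \<partial>M)"
      unfolding list.map sum_list.Cons by (intro nn_integral_add m)
    also have "(\<integral>\<^sup>+ y. w d * indicator (cylinder (s d)) y \<partial>M) = w d * emeasure M (cylinder (s d))"
      by (intro nn_integral_cmult_indicator) (simp add: sets)
    finally show ?case using Cons by simp
  qed simp
  have "(\<Sum>d\<leftarrow>ds. w d * indicator (cylinder (s d)) y) \<le> g y" for y
    using anti le
  proof (induction ds)
    case (Cons d ds)
    show ?case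
    proof (cases "y \<in> cylinder (s d)")
      case True
      then have "\<forall>d'\<in>set ds. y \<notin> cylinder (s d')"
        using Cons.prems(1) incompatible_disjoint by auto
      then have "(\<Sum>d\<leftarrow>ds. w d * indicator (cylinder (s d)) y) = 0"
        by (induction ds) auto
      then have "(\<Sum>d\<leftarrow>d # ds. w d * indicator (cylinder (s d)) y) = w d"
        using True by (simp only: list.map sum_list.Cons indicator_simps mult_1_right add_0_right)
      then show ?thesis using Cons.prems(2)[of d y] True by (simp only: list.set_intros)
    next
      case False
      then show ?thesis using Cons by simp
    qed
  qed simp
  then show ?thesis unfolding int[symmetric] by (intro nn_integral_mono)
qed

text \<open>The certifying cylinders are disjoint and lie in the preimage of the interval, so their
  lower bounds add up to a lower bound for its mass.\<close>

lemma certified_imp_holds: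
  assumes \<mu>: "\<mu> \<in> cantor_measures" and "sound \<mu> cs" "certified cs e"
  shows "holds (binval_distr \<mu>) e"
  unfolding holds_def
proof
  interpret prob_space \<mu> using \<mu> by (simp add: cantor_measures_def)
  have sets: "sets \<mu> = sets borel" using \<mu> by (simp add: cantor_measures_def)
  note [measurable_cong] = sets
  fix c assume "c \<in> set (fst e)"
  then obtain as where as: "\<And>a. a \<in> set as \<Longrightarrow> a \<in> set cs \<and> fits (fst a) (fst c)"
    "sorted_wrt (\<lambda>a b. incompatible (fst a) (fst b)) as" "snd c < (\<Sum>a\<leftarrow>as. snd a)"
    using assms(3) unfolding certified_def by blast
  let ?B = "{y. binval y \<in> rat_interval (fst c)}"
  have B: "?B \<in> sets \<mu>"
  proof -
    have "rat_interval (fst c) \<in> sets borel" unfolding rat_interval_def by auto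
    from measurable_sets[OF measurable_binval this] show ?thesis by (simp add: vimage_def sets)
  qed
  have "(\<Sum>a\<leftarrow>as. 1 * emeasure \<mu> (cylinder (fst a))) \<le> (\<integral>\<^sup>+ y. indicator ?B y \<partial>\<mu>)"
  proof (rule incompatible_sum_le_nn_integral[OF sets as(2)])
    fix a y assume "a \<in> set as" "y \<in> cylinder (fst a)"
    then have "binval y \<in> rat_interval (fst c)" using as(1) fits_imp_rat_interval by blast
    then show "1 \<le> (indicator ?B y :: ennreal)" by simp
  qed
  also have "\<dots> = ennreal (measure \<mu> ?B)"
    by (simp only: nn_integral_indicator[OF B] emeasure_eq_measure)
  finally have "(\<Sum>a\<leftarrow>as. measure \<mu> (cylinder (fst a))) \<le> measure \<mu> ?B"
    by (simp add: emeasure_eq_measure sum_list_ennreal)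
  moreover have "(\<Sum>a\<leftarrow>as. of_rat (snd a)) \<le> (\<Sum>a\<leftarrow>as. measure \<mu> (cylinder (fst a)))"
    using as(1) assms(2) by (intro sum_list_mono) (auto simp: sound_def intro: less_imp_le)
  moreover have "real_of_rat (snd c) < (\<Sum>a\<leftarrow>as. of_rat (snd a))"
    using as(3) by (simp only: of_rat_sum_list[symmetric] of_rat_less)
  ultimately show "of_rat (snd c) < measure (binval_distr \<mu>) (rat_interval (fst c))"
    unfolding measure_binval_distr_rat_interval[OF \<mu>] by linarith
qed

text \<open>The supremum is indexed by items instead of by values, so that an item can be used
  directly as a witness.\<close>

definition represents :: "unit_test \<Rightarrow> (real measure \<Rightarrow> real \<Rightarrow> ennreal) \<Rightarrow> bool" where
  "represents E t \<longleftrightarrow> (\<forall>e\<in>E. snd (snd e) \<ge> 0) \<and> (\<forall>\<nu>\<in>unit_measures. \<forall>x\<in>{0..1}.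
    t \<nu> x = (SUP e\<in>{e\<in>E. holds \<nu> e \<and> x \<in> rat_interval (fst (snd e))}. ennreal (of_rat (snd (snd e)))))"

lemma uniform_ce_test_represents:
  assumes "uniform_ce_test t"
  shows "\<exists>E. semidecidable (\<lambda>e. e \<in> E) \<and> represents E t"
    "\<nu> \<in> unit_measures \<Longrightarrow> (\<integral>\<^sup>+ x. t \<nu> x \<partial>\<nu>) \<le> 1"
proof -
  from assms obtain E :: unit_test where E:
    "ce (enc_pair (enc_list (enc_pair (enc_pair enc_rat enc_rat) enc_rat))
                   (enc_pair (enc_pair enc_rat enc_rat) enc_rat)) E"
    "\<forall>(cs, J, q) \<in> E. q \<ge> 0"
    "\<forall>\<nu> \<in> unit_measures. \<forall>x \<in> {0..1}.
        t \<nu> x = Sup {ennreal (of_rat q) | q. \<exists>cs J. (cs, J, q) \<in> E \<and>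
          (\<forall>(I, p) \<in> set cs. measure \<nu> (rat_interval I) > of_rat p) \<and>
          x \<in> rat_interval J}"
    unfolding uniform_ce_test_def by blast
  have "semidecidable (\<lambda>e. e \<in> E)" using E(1) by (simp only: enc_eq_encode ce_encode_iff)
  moreover have "{ennreal (of_rat q) | q. \<exists>cs J. (cs, J, q) \<in> E \<and>
          (\<forall>(I, p) \<in> set cs. measure \<nu> (rat_interval I) > of_rat p) \<and> x \<in> rat_interval J}
      = (\<lambda>e. ennreal (of_rat (snd (snd e)))) ` {e\<in>E. holds \<nu> e \<and> x \<in> rat_interval (fst (snd e))}" for \<nu> x
    by (force simp: holds_def image_def)
  ultimately show "\<exists>E. semidecidable (\<lambda>e. e \<in> E) \<and> represents E t"
    using E(2,3) by (intro exI[of _ E]) (auto simp: represents_def)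
  show "\<nu> \<in> unit_measures \<Longrightarrow> (\<integral>\<^sup>+ x. t \<nu> x \<partial>\<nu>) \<le> 1"
    using assms unfolding uniform_ce_test_def by blast
qed

text \<open>The change of variables needs measurability of the test at the fixed image measure:
  there it is a supremum of step functions over countably many items.\<close>

lemma nn_integral_represented_test:
  assumes \<mu>: "\<mu> \<in> cantor_measures" and t: "represents E t"
  shows "(\<integral>\<^sup>+ y. t (binval_distr \<mu>) (binval y) \<partial>\<mu>) = (\<integral>\<^sup>+ x. t (binval_distr \<mu>) x \<partial>binval_distr \<mu>)"
proof -
  let ?\<nu> = "binval_distr \<mu>"
  let ?R = "restrict_space borel {0..1::real}"
  have sets: "sets \<mu> = sets borel" using \<mu> by (simp add: cantor_measures_def)
  have \<nu>: "?\<nu> \<in> unit_measures" by (rule binval_distr_in_unit_measures[OF \<mu>])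
  define S where "S = {e\<in>E. holds ?\<nu> e}"
  define g where "g x = (SUP e\<in>S. ennreal (of_rat (snd (snd e))) * indicator (rat_interval (fst (snd e))) x)" for x
  have eq: "t ?\<nu> x = g x" if "x \<in> {0..1}" for x
  proof -
    have "t ?\<nu> x = (SUP e\<in>{e\<in>S. x \<in> rat_interval (fst (snd e))}. ennreal (of_rat (snd (snd e))))"
      using t \<nu> that by (simp add: represents_def S_def conj_assoc)
    also have "\<dots> = g x"
    proof (rule antisym)
      show "(SUP e\<in>{e\<in>S. x \<in> rat_interval (fst (snd e))}. ennreal (of_rat (snd (snd e)))) \<le> g x"
      proof (rule SUP_least)
        fix e assume "e \<in> {e\<in>S. x \<in> rat_interval (fst (snd e))}"
        then show "ennreal (of_rat (snd (snd e))) \<le> g x"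
          unfolding g_def by (intro SUP_upper2[of e]) auto
      qed
      show "g x \<le> (SUP e\<in>{e\<in>S. x \<in> rat_interval (fst (snd e))}. ennreal (of_rat (snd (snd e))))"
        unfolding g_def
      proof (rule SUP_least)
        fix e assume e: "e \<in> S"
        show "ennreal (of_rat (snd (snd e))) * indicator (rat_interval (fst (snd e))) x
          \<le> (SUP e\<in>{e\<in>S. x \<in> rat_interval (fst (snd e))}. ennreal (of_rat (snd (snd e))))"
          by (cases "x \<in> rat_interval (fst (snd e))") (use e in \<open>auto intro: SUP_upper2[of e]\<close>)
      qed
    qed
    finally show ?thesis .
  qed
  have "g \<in> borel_measurable ?R"
    unfolding g_def by (intro borel_measurable_SUP countableI_type) measurable
  then have "t ?\<nu> \<in> borel_measurable ?R"
    by (subst measurable_cong[where g = g]) (auto simp: eq space_restrict_space)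
  then show ?thesis
    unfolding binval_distr_def
    by (subst nn_integral_distr[OF measurable_binval_unit[OF sets]]) (auto simp: binval_distr_def)
qed

text \<open>A payoff is below the integral of the pulled back test, which is at most 1 by the
  condition on uniform tests. This keeps the supremum of payoffs within the range of a
  semimeasure.\<close>

lemma payoff_le_1:
  assumes \<mu>: "\<mu> \<in> cantor_measures" and t: "represents E t"
    and le: "(\<integral>\<^sup>+ x. t (binval_distr \<mu>) x \<partial>binval_distr \<mu>) \<le> 1"
    and cs: "sound \<mu> cs" "payoff_list E cs \<sigma> ds"
  shows "real_of_rat (payoff ds) \<le> 1"
proof -
  let ?\<nu> = "binval_distr \<mu>"
  interpret prob_space \<mu> using \<mu> by (simp add: cantor_measures_def)
  have sets: "sets \<mu> = sets borel" using \<mu> by (simp add: cantor_measures_def)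
  have nonneg: "snd (snd e) \<ge> 0" if "e \<in> E" for e using t that by (simp add: represents_def)
  have ds: "fst d \<in> set cs" "snd d \<in> E" "fits (fst (fst d)) (fst (snd (snd d)))" "certified cs (snd d)"
    if "d \<in> set ds" for d using cs(2) that by (auto simp: payoff_list_def)
  have "real_of_rat (payoff ds) = (\<Sum>d\<leftarrow>ds. of_rat (snd (fst d)) * of_rat (snd (snd (snd d))))"
    by (simp add: payoff_def of_rat_sum_list of_rat_mult)
  also have "\<dots> \<le> (\<Sum>d\<leftarrow>ds. of_rat (snd (snd (snd d))) * measure \<mu> (cylinder (fst (fst d))))"
  proof (rule sum_list_mono)
    fix d assume d: "d \<in> set ds"
    have "of_rat (snd (fst d)) \<le> measure \<mu> (cylinder (fst (fst d)))"
      using ds(1)[OF d] cs(1) by (auto simp: sound_def intro: less_imp_le)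
    then show "of_rat (snd (fst d)) * of_rat (snd (snd (snd d)))
        \<le> of_rat (snd (snd (snd d))) * measure \<mu> (cylinder (fst (fst d)))"
      using nonneg[OF ds(2)[OF d]] by (subst mult.commute) (intro mult_left_mono, auto)
  qed
  finally have "ennreal (of_rat (payoff ds)) \<le> (\<Sum>d\<leftarrow>ds. ennreal (of_rat (snd (snd (snd d)))) * emeasure \<mu> (cylinder (fst (fst d))))"
    using nonneg[OF ds(2)]
    by (simp add: emeasure_eq_measure sum_list_ennreal ennreal_leI cong: map_cong flip: ennreal_mult)
  also have "\<dots> \<le> (\<integral>\<^sup>+ y. t ?\<nu> (binval y) \<partial>\<mu>)"
  proof (rule incompatible_sum_le_nn_integral[OF sets])
    show "sorted_wrt (\<lambda>d d'. incompatible (fst (fst d)) (fst (fst d'))) ds"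
      using cs(2) by (simp add: payoff_list_def)
    fix d y assume d: "d \<in> set ds" and y: "y \<in> cylinder (fst (fst d))"
    have "holds ?\<nu> (snd d)" by (rule certified_imp_holds[OF \<mu> cs(1) ds(4)[OF d]])
    moreover have "binval y \<in> rat_interval (fst (snd (snd d)))"
      by (rule fits_imp_rat_interval[OF ds(3)[OF d] y])
    moreover have "t ?\<nu> (binval y) = (SUP e\<in>{e\<in>E. holds ?\<nu> e \<and> binval y \<in> rat_interval (fst (snd e))}. ennreal (of_rat (snd (snd e))))"
      using t binval_distr_in_unit_measures[OF \<mu>] binval_bounds[of y] by (simp add: represents_def)
    ultimately show "ennreal (of_rat (snd (snd (snd d)))) \<le> t ?\<nu> (binval y)"
      using ds(2)[OF d] by (auto intro: SUP_upper2[of "snd d"])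
  qed
  also have "\<dots> \<le> 1" unfolding nn_integral_represented_test[OF \<mu> t] by (rule le)
  finally show ?thesis by simp
qed

text \<open>A supremum of reals, under control once the payoffs are known to be bounded. No formula
  as an integral is required, only superadditivity.\<close>

definition pulled_back :: "unit_test \<Rightarrow> (nat \<Rightarrow> bool) measure \<Rightarrow> bool list \<Rightarrow> real" where
  "pulled_back E \<mu> \<sigma> = Sup {of_rat (payoff ds) | cs ds. sound \<mu> cs \<and> payoff_list E cs \<sigma> ds}"

lemma extends_append:
  assumes "extends (\<sigma> @ [b]) \<tau>"
  shows "extends \<sigma> \<tau>" "length \<sigma> < length \<tau>" "nth_default False \<tau> (length \<sigma>) = b"
proof -
  have len: "Suc (length \<sigma>) \<le> length \<tau>"
    and nth: "\<And>i. i < Suc (length \<sigma>) \<Longrightarrow> nth_default False (\<sigma> @ [b]) i = nth_default False \<tau> i"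
    using assms by (auto simp: extends_def)
  show "length \<sigma> < length \<tau>" using len by simp
  show "nth_default False \<tau> (length \<sigma>) = b" using nth[of "length \<sigma>"] by (simp add: nth_default_append)
  have "nth_default False \<sigma> i = nth_default False \<tau> i" if "i < length \<sigma>" for i
    using nth[of i] that by (simp add: nth_default_append nth_default_nth)
  then show "extends \<sigma> \<tau>" using len by (simp add: extends_def)
qed

lemma certified_mono: "certified cs e \<Longrightarrow> set cs \<subseteq> set cs' \<Longrightarrow> certified cs' e"
  unfolding certified_def by (meson subsetD)

text \<open>Entries below different children of \<sigma> differ at position
  \<open>length \<sigma>\<close>, hence are incompatible; enlarging the list of lower bounds keeps
  every item certified. This yields the semimeasure inequality.\<close>

lemma payoff_list_append:
  assumes "payoff_list E cs0 (\<sigma> @ [False]) ds0" "payoff_list E cs1 (\<sigma> @ [True]) ds1"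
  shows "payoff_list E (cs0 @ cs1) \<sigma> (ds0 @ ds1)"
proof -
  have "incompatible (fst (fst d)) (fst (fst d'))" if "d \<in> set ds0" "d' \<in> set ds1" for d d'
  proof -
    have "extends (\<sigma> @ [False]) (fst (fst d))" "extends (\<sigma> @ [True]) (fst (fst d'))"
      using assms that by (auto simp: payoff_list_def)
    from extends_append[OF this(1)] extends_append[OF this(2)] show ?thesis
      unfolding incompatible_def by (intro exI[of _ "length \<sigma>"]) auto
  qed
  moreover have "fst d \<in> set (cs0 @ cs1) \<and> extends \<sigma> (fst (fst d)) \<and> snd d \<in> E
      \<and> fits (fst (fst d)) (fst (snd (snd d))) \<and> certified (cs0 @ cs1) (snd d)"
    if "d \<in> set (ds0 @ ds1)" for d
    using that assms extends_append(1) certified_mono[of cs0 "snd d" "cs0 @ cs1"]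
      certified_mono[of cs1 "snd d" "cs0 @ cs1"]
    unfolding payoff_list_def by auto
  moreover have "sorted_wrt (\<lambda>d d'. incompatible (fst (fst d)) (fst (fst d'))) ds0"
    "sorted_wrt (\<lambda>d d'. incompatible (fst (fst d)) (fst (fst d'))) ds1"
    using assms by (auto simp: payoff_list_def)
  ultimately show ?thesis unfolding payoff_list_def sorted_wrt_append by blast
qed

text \<open>The bound is assumed for one fixed measure and supplied by \<open>payoff_le_1\<close>
  for every measure on Cantor space.\<close>

context
  fixes E :: unit_test and \<mu> :: "(nat \<Rightarrow> bool) measure"
  assumes payoff_le: "\<And>cs \<sigma> ds. sound \<mu> cs \<Longrightarrow> payoff_list E cs \<sigma> ds \<Longrightarrow> real_of_rat (payoff ds) \<le> 1"
begin

lemma bdd_payoffs: "bdd_above {real_of_rat (payoff ds) | cs ds. sound \<mu> cs \<and> payoff_list E cs \<sigma> ds}"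
  using payoff_le by (intro bdd_aboveI[of _ 1]) auto

lemma payoff_le_pulled_back:
  "sound \<mu> cs \<Longrightarrow> payoff_list E cs \<sigma> ds \<Longrightarrow> of_rat (payoff ds) \<le> pulled_back E \<mu> \<sigma>"
  unfolding pulled_back_def by (intro cSup_upper bdd_payoffs) auto

lemma payoffs_nonempty: "{real_of_rat (payoff ds) | cs ds. sound \<mu> cs \<and> payoff_list E cs \<sigma> ds} \<noteq> {}"
  by (auto simp: sound_def payoff_list_def intro!: exI[of _ "[]"])

lemma semimeasure_pulled_back: "semimeasure (pulled_back E \<mu>)"
  unfolding semimeasure_def
proof (intro conjI allI)
  fix \<sigma>
  have "of_rat (payoff []) \<le> pulled_back E \<mu> \<sigma>"
    by (rule payoff_le_pulled_back[of "[]"]) (auto simp: sound_def payoff_list_def)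
  then have "0 \<le> pulled_back E \<mu> \<sigma>" by (simp add: payoff_def)
  moreover have "pulled_back E \<mu> \<sigma> \<le> 1"
    unfolding pulled_back_def using payoff_le by (intro cSup_least payoffs_nonempty) auto
  ultimately show "pulled_back E \<mu> \<sigma> \<in> {0..1}" by simp
  have add: "of_rat (payoff ds0) + of_rat (payoff ds1) \<le> pulled_back E \<mu> \<sigma>"
    if "sound \<mu> cs0" "payoff_list E cs0 (\<sigma> @ [False]) ds0" "sound \<mu> cs1" "payoff_list E cs1 (\<sigma> @ [True]) ds1"
    for cs0 ds0 cs1 ds1
  proof -
    have "sound \<mu> (cs0 @ cs1)" using that by (auto simp: sound_def)
    from payoff_le_pulled_back[OF this payoff_list_append[OF that(2,4)]]
    show ?thesis by (simp add: payoff_def of_rat_add)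
  qed
  \<comment> \<open>The two suprema are taken one after the other: over the lists for one child with
    the other list held fixed, then over the latter.\<close>
  have "pulled_back E \<mu> (\<sigma> @ [True]) \<le> pulled_back E \<mu> \<sigma> - of_rat (payoff ds0)"
    if "sound \<mu> cs0" "payoff_list E cs0 (\<sigma> @ [False]) ds0" for cs0 ds0
    unfolding pulled_back_def[of E \<mu> "\<sigma> @ [True]"]
    using add[OF that] by (intro cSup_least payoffs_nonempty) (auto simp: algebra_simps)
  then have "pulled_back E \<mu> (\<sigma> @ [False]) \<le> pulled_back E \<mu> \<sigma> - pulled_back E \<mu> (\<sigma> @ [True])"
    unfolding pulled_back_def[of E \<mu> "\<sigma> @ [False]"]
    by (intro cSup_least payoffs_nonempty) (force simp: algebra_simps)
  then show "pulled_back E \<mu> (\<sigma> @ [False]) + pulled_back E \<mu> (\<sigma> @ [True]) \<le> pulled_back E \<mu> \<sigma>"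
    by simp
qed

lemma test_output_pulled_back:
  "test_output (interval_test E) \<mu> = undergraph (pulled_back E \<mu>)"
proof -
  have "of_rat q < pulled_back E \<mu> \<sigma> \<longleftrightarrow> (\<exists>cs ds. sound \<mu> cs \<and> payoff_list E cs \<sigma> ds \<and> q < payoff ds)" for q \<sigma>
    unfolding pulled_back_def less_cSup_iff[OF payoffs_nonempty bdd_payoffs]
    unfolding of_rat_less[where 'a = real, symmetric] by blast
  then show ?thesis unfolding test_output_interval_test undergraph_def by simp
qed

end

text \<open>The preimage of an open interval is exhausted by cylinders that fit into it. By
  continuity of the measure those of some fixed length already exceed the required bound, and
  rational lower bounds for them form a certificate.\<close>

lemma certified_exists:
  assumes \<mu>: "\<mu> \<in> cantor_measures" and "holds (binval_distr \<mu>) e"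
  shows "\<exists>cs. sound \<mu> cs \<and> certified cs e"
proof -
  interpret prob_space \<mu> using \<mu> by (simp add: cantor_measures_def)
  have sets: "sets \<mu> = sets borel" using \<mu> by (simp add: cantor_measures_def)
  have "\<exists>as. sound \<mu> as \<and> (\<forall>a\<in>set as. fits (fst a) (fst c))
      \<and> sorted_wrt (\<lambda>a b. incompatible (fst a) (fst b)) as \<and> snd c < (\<Sum>a\<leftarrow>as. snd a)"
    if c: "c \<in> set (fst e)" for c
  proof -
    let ?I = "fst c"
    \<comment> \<open>Asking all later prefixes to fit makes the sets increasing by
      definition.\<close>
    define B where "B n = {y. \<forall>k\<ge>n. fits (pre y k) ?I}" for n
    define C where "C n = {y. pre y n \<in> {\<tau>. fits \<tau> ?I}}" for n
    have C: "C n \<in> sets \<mu>" for n unfolding C_def sets by (rule sets_pre)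
    have B: "B n \<in> sets \<mu>" for n
    proof -
      have "B n = (\<Inter>k\<in>{n..}. C k)" by (auto simp: B_def C_def)
      also have "\<dots> \<in> sets \<mu>" by (intro sets.countable_INT) (auto simp: C)
      finally show ?thesis .
    qed
    have "(\<lambda>n. measure \<mu> (B n)) \<longlonglongrightarrow> measure \<mu> (\<Union>n. B n)"
    proof (rule finite_Lim_measure_incseq)
      show "range B \<subseteq> sets \<mu>" using B by blast
      show "incseq B" by (auto simp: incseq_def B_def)
    qed
    moreover have "(\<Union>n. B n) = {y. binval y \<in> rat_interval ?I}"
    proof (intro equalityI subsetI)
      fix y assume "y \<in> (\<Union>n. B n)"
      then obtain n where "fits (pre y n) ?I" by (auto simp: B_def)
      then show "y \<in> {y. binval y \<in> rat_interval ?I}"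
        using fits_imp_rat_interval[of "pre y n" ?I y] by simp
    next
      fix y assume "y \<in> {y. binval y \<in> rat_interval ?I}"
      then show "y \<in> (\<Union>n. B n)"
        using eventually_fits[of y ?I] by (auto simp: B_def eventually_sequentially)
    qed
    moreover have "of_rat (snd c) < measure \<mu> {y. binval y \<in> rat_interval ?I}"
      using assms(2) c by (simp add: holds_def measure_binval_distr_rat_interval[OF \<mu>])
    ultimately have "eventually (\<lambda>n. of_rat (snd c) < measure \<mu> (B n)) sequentially"
      by (metis order_tendstoD(1))
    then obtain n where "of_rat (snd c) < measure \<mu> (B n)" by (auto simp: eventually_sequentially)
    also have "\<dots> \<le> measure \<mu> (C n)" by (intro finite_measure_mono C) (auto simp: B_def C_def)
    also have "\<dots> = (\<Sum>\<tau> | length \<tau> = n \<and> \<tau> \<in> {\<tau>. fits \<tau> ?I}. measure \<mu> (cylinder \<tau>))"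
      unfolding C_def by (rule measure_pre[OF finite_measure_axioms sets])
    finally have less: "of_rat (snd c) < (\<Sum>\<tau> | length \<tau> = n \<and> fits \<tau> ?I. measure \<mu> (cylinder \<tau>))"
      by simp
    obtain ts where ts: "set ts = {\<tau>. length \<tau> = n \<and> fits \<tau> ?I}" "distinct ts"
      using finite_distinct_list[OF finite_strings[of n "\<lambda>\<tau>. fits \<tau> ?I"]] by auto
    have "of_rat (snd c) < (\<Sum>\<tau>\<leftarrow>ts. measure \<mu> (cylinder \<tau>) * 1)"
      using less by (simp add: sum_list_distinct_conv_sum_set[OF ts(2)] ts(1))
    from rational_lower_bounds[OF _ this] obtain l where l: "\<And>\<tau>. of_rat (l \<tau>) < measure \<mu> (cylinder \<tau>)"
      "of_rat (snd c) < (\<Sum>\<tau>\<leftarrow>ts. real_of_rat (l \<tau>) * 1)" by auto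
    define as where "as = map (\<lambda>\<tau>. (\<tau>, l \<tau>)) ts"
    have "real_of_rat (snd c) < of_rat (\<Sum>a\<leftarrow>as. snd a)"
      using l(2) by (simp add: as_def of_rat_sum_list comp_def)
    then have "snd c < (\<Sum>a\<leftarrow>as. snd a)" by (simp only: of_rat_less)
    moreover have "sorted_wrt (\<lambda>a b. incompatible (fst a) (fst b)) as"
    proof -
      have inc: "incompatible \<sigma> \<tau>" if "\<sigma> \<noteq> \<tau>" "length \<sigma> = n" "length \<tau> = n" for \<sigma> \<tau>
        using that by (auto simp: incompatible_def nth_default_nth list_eq_iff_nth_eq)
      have "sorted_wrt (\<noteq>) ts"
        using ts(2) distinct_map_iff_sorted_wrt[of "\<lambda>x. x" ts] by simp
      then have "sorted_wrt incompatible ts"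
        by (rule sorted_wrt_mono_rel[rotated]) (use inc ts(1) in auto)
      then show ?thesis by (simp add: as_def sorted_wrt_map)
    qed
    moreover have "sound \<mu> as" using l(1) by (auto simp: sound_def as_def)
    moreover have "\<forall>a\<in>set as. fits (fst a) ?I" using ts(1) by (auto simp: as_def)
    ultimately show ?thesis by blast
  qed
  then obtain A where A: "\<And>c. c \<in> set (fst e) \<Longrightarrow> sound \<mu> (A c) \<and> (\<forall>a\<in>set (A c). fits (fst a) (fst c))
      \<and> sorted_wrt (\<lambda>a b. incompatible (fst a) (fst b)) (A c) \<and> snd c < (\<Sum>a\<leftarrow>A c. snd a)"
    by metis
  have "sound \<mu> (concat (map A (fst e)))" using A by (auto simp: sound_def)
  moreover have "certified (concat (map A (fst e))) e"
    unfolding certified_def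
  proof
    fix c assume c: "c \<in> set (fst e)"
    show "\<exists>as. (\<forall>a\<in>set as. a \<in> set (concat (map A (fst e))) \<and> fits (fst a) (fst c))
      \<and> sorted_wrt (\<lambda>a b. incompatible (fst a) (fst b)) as \<and> snd c < (\<Sum>a\<leftarrow>as. snd a)"
      by (rule exI[of _ "A c"]) (use A[OF c] c in auto)
  qed
  ultimately show ?thesis by blast
qed

text \<open>Boundedness at every point is obtained directly, with no almost-everywhere statement in
  between: an item that applies at \<open>x\<close> applies on a whole cylinder, which has positive
  mass, and betting on that cylinder alone already bounds the value of the item.\<close>

lemma neutral_unit_binval_distr:
  assumes neutral: "neutral \<mu>"
  shows "neutral_unit (binval_distr \<mu>)"
  unfolding neutral_unit_def
proof (intro conjI allI impI)
  have \<mu>: "\<mu> \<in> cantor_measures" using neutral by (simp add: neutral_def)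
  let ?\<nu> = "binval_distr \<mu>"
  show \<nu>: "?\<nu> \<in> unit_measures" by (rule binval_distr_in_unit_measures[OF \<mu>])
  fix t assume t: "uniform_ce_test t"
  obtain E where E: "semidecidable (\<lambda>e. e \<in> E)" "represents E t"
    using uniform_ce_test_represents(1)[OF t] by blast
  have payoff: "real_of_rat (payoff ds) \<le> 1"
    if "\<mu>' \<in> cantor_measures" "sound \<mu>' cs" "payoff_list E cs \<sigma> ds" for \<mu>' cs \<sigma> ds
    using payoff_le_1[OF that(1) E(2) uniform_ce_test_represents(2)[OF t binval_distr_in_unit_measures[OF that(1)]] that(2,3)] .
  have semi: "semimeasure (pulled_back E \<mu>')" if "\<mu>' \<in> cantor_measures" for \<mu>'
    by (rule semimeasure_pulled_back, rule payoff[OF that])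
  have outp: "test_output (interval_test E) \<mu>' = undergraph (pulled_back E \<mu>')"
    if "\<mu>' \<in> cantor_measures" for \<mu>'
    by (rule test_output_pulled_back, rule payoff[OF that])
  have "ce_test (interval_test E)"
    unfolding ce_test_iff using semidecidable_interval_test[OF E(1)] semi outp by blast
  moreover have "test_semimeasure (interval_test E) \<mu> = pulled_back E \<mu>"
    by (intro test_semimeasure_eqI semi outp \<mu>)
  ultimately obtain c where c: "c > 0" "\<And>\<sigma>. c * pulled_back E \<mu> \<sigma> \<le> measure \<mu> (cylinder \<sigma>)"
    using neutral_dominates[OF neutral] by metis
  obtain c' where c': "c' > 0" "\<And>\<sigma>. c' * (1 / 2) ^ length \<sigma> \<le> measure \<mu> (cylinder \<sigma>)"
    using neutral_dominates_coin[OF neutral] by blast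
  have "real_of_rat (snd (snd e)) \<le> 1 / c"
    if e: "e \<in> E" "holds ?\<nu> e" "x \<in> rat_interval (fst (snd e))" and x: "x \<in> {0..1}" for e x
  proof -
    obtain y where y: "binval y = x" using binval_surj[of x] x by auto
    obtain n where n: "fits (pre y n) (fst (snd e))"
      using eventually_fits[of y "fst (snd e)"] e(3) y by (auto simp: eventually_sequentially)
    let ?\<sigma> = "pre y n" and ?q = "real_of_rat (snd (snd e))"
    have pos: "measure \<mu> (cylinder ?\<sigma>) > 0"
      by (rule less_le_trans[OF _ c'(2)]) (use c'(1) in auto)
    have q: "?q \<ge> 0" using E(2) e(1) by (simp add: represents_def)
    obtain cs where cs: "sound \<mu> cs" "certified cs e" using certified_exists[OF \<mu> e(2)] by blast
    \<comment> \<open>A payoff list with a single entry, betting on the cylinder itself; afterwards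
      \<open>l\<close> approaches the mass of the cylinder.\<close>
    have l: "of_rat l * ?q \<le> pulled_back E \<mu> ?\<sigma>" if "of_rat l < measure \<mu> (cylinder ?\<sigma>)" for l
    proof -
      have s: "sound \<mu> ((?\<sigma>, l) # cs)" using cs(1) that by (auto simp: sound_def)
      have p: "payoff_list E ((?\<sigma>, l) # cs) ?\<sigma> [((?\<sigma>, l), e)]"
        using e(1) n certified_mono[OF cs(2), of "(?\<sigma>, l) # cs"]
        by (auto simp: payoff_list_def extends_def)
      have "of_rat (payoff [((?\<sigma>, l), e)]) \<le> pulled_back E \<mu> ?\<sigma>"
        by (rule payoff_le_pulled_back[OF _ s p], rule payoff[OF \<mu>])
      then show ?thesis by (simp add: payoff_def of_rat_mult)
    qed
    have "measure \<mu> (cylinder ?\<sigma>) * ?q \<le> pulled_back E \<mu> ?\<sigma>"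
    proof (cases "?q = 0")
      case True
      obtain l where "0 < real_of_rat l" "real_of_rat l < measure \<mu> (cylinder ?\<sigma>)" using of_rat_dense[OF pos] by auto
      from l[OF this(2)] True show ?thesis by simp
    next
      case False
      show ?thesis
      proof (rule ccontr)
        assume "\<not> ?thesis"
        then have "pulled_back E \<mu> ?\<sigma> / ?q < measure \<mu> (cylinder ?\<sigma>)"
          using False q by (simp add: field_simps)
        then obtain l where "pulled_back E \<mu> ?\<sigma> / ?q < of_rat l" "of_rat l < measure \<mu> (cylinder ?\<sigma>)"
          using of_rat_dense by blast
        with l[of l] False q show False by (simp add: field_simps)
      qed
    qed
    also have "\<dots> \<le> measure \<mu> (cylinder ?\<sigma>) / c" using c(2)[of ?\<sigma>] c(1) by (simp add: field_simps)
    finally show ?thesis using pos c(1) by (simp add: field_simps)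
  qed
  then have "t ?\<nu> x \<le> ennreal (1 / c)" if x: "x \<in> {0..1}" for x
  proof -
    have "t ?\<nu> x = (SUP e\<in>{e\<in>E. holds ?\<nu> e \<and> x \<in> rat_interval (fst (snd e))}. ennreal (of_rat (snd (snd e))))"
      using E(2) \<nu> x by (simp add: represents_def)
    also have "\<dots> \<le> ennreal (1 / c)"
      using \<open>\<And>x e. e \<in> E \<Longrightarrow> holds ?\<nu> e \<Longrightarrow> x \<in> rat_interval (fst (snd e)) \<Longrightarrow> x \<in> {0..1} \<Longrightarrow> real_of_rat (snd (snd e)) \<le> 1 / c\<close> x
      by (intro SUP_least ennreal_leI) auto
    finally show ?thesis .
  qed
  then have "(SUP x\<in>{0..1}. t ?\<nu> x) \<le> ennreal (1 / c)" by (intro SUP_least)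
  also have "\<dots> < \<infinity>" by simp
  finally show "(SUP x\<in>{0..1}. t ?\<nu> x) < \<infinity>" .
qed

section \<open>The dimension probability\<close>

text \<open>Valid for every \<open>y\<close>, with the exceptional set only in \<open>z\<close>: the
  lower bound on the masses holds for all \<open>z\<close>, and only the upper bound is
  probabilistic.\<close>

lemma AE_pointwise_dim_blend:
  assumes "neutral \<mu>"
  shows "AE z in coin. pointwise_dim \<mu> (blend y z) = ereal (binval y)"
proof -
  have \<mu>: "\<mu> \<in> cantor_measures" using assms by (simp add: neutral_def)
  then have prob: "prob_space \<mu>" by (simp add: cantor_measures_def)
  obtain a where a: "a > 0" "\<And>\<sigma>. a * (1 / 2) ^ length \<sigma> \<le> measure \<mu> (cylinder \<sigma>)"
    using neutral_dominates_coin[OF assms] by blast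
  obtain b where b: "b > 0" "\<And>A. A \<in> sets borel \<Longrightarrow> b * measure (blended \<mu>) A \<le> measure \<mu> A"
    using neutral_dominates_blended[OF assms] by blast
  \<comment> \<open>Domination of \<open>blended \<mu>\<close> contributes \<open>b\<close>, the
    mass of the \<open>m\<close> relevant bits of \<open>y\<close> contributes
    \<open>a * (1 / 2) ^ m\<close>, and \<open>2 ^ m \<le> 2 * Suc n\<close> accounts for the 2 and
    for \<open>real (Suc n)\<close>.\<close>
  have lower: "a * b / 2 / real (Suc n) * (1 / 2) ^ active y n \<le> measure \<mu> (cylinder (pre (blend y z) n))" for n z
  proof -
    obtain m where m: "n < 2 ^ m" "2 ^ m \<le> 2 * Suc n" using ex_power2_near by blast
    have "(2::real) ^ m \<le> 2 * real (Suc n)"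
      using m(2) by (simp flip: of_nat_le_iff[where 'a = real])
    then have "1 / (2 * real (Suc n)) \<le> (1 / 2) ^ m"
      by (simp add: power_divide field_simps)
    then have "a * (1 / (2 * real (Suc n))) \<le> a * (1 / 2) ^ m"
      using a(1) by (intro mult_left_mono) auto
    also have "\<dots> \<le> measure \<mu> (cylinder (pre y m))" using a(2)[of "pre y m"] by simp
    finally have "b * (a * (1 / (2 * real (Suc n))) * (1 / 2) ^ active y n)
        \<le> b * (measure \<mu> (cylinder (pre y m)) * (1 / 2) ^ active y n)"
      using b(1) by (intro mult_left_mono mult_right_mono) auto
    also have "\<dots> \<le> b * measure (blended \<mu>) (cylinder (pre (blend y z) n))"
      using b(1) by (intro mult_left_mono measure_blended_ge[OF \<mu> m(1)]) auto
    also have "\<dots> \<le> measure \<mu> (cylinder (pre (blend y z) n))" by (rule b(2)) simp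
    finally show ?thesis by (simp add: field_simps)
  qed
  from AE_coin_measure_blend_le[OF \<mu>, of y] show ?thesis
  proof eventually_elim
    case (elim z)
    then obtain K where K: "K > 0"
      "\<And>n. measure \<mu> (cylinder (pre (blend y z) n)) \<le> K * real (Suc n) ^ 2 * (1 / 2) ^ active y n" by blast
    show ?case
      by (rule pointwise_dim_eqI[OF prob _ K(1) lower K(2)]) (use a(1) b(1) in simp)
  qed
qed

text \<open>\<open>Ddist \<mu>\<close> is the distribution function of the law of the dimension
  restricted to finite nonnegative values, a finite measure on the line; agreement on half-open
  intervals identifies it with \<open>interval_measure\<close>.\<close>

lemma dim_prob_eq:
  assumes \<mu>: "\<mu> \<in> cantor_measures" and E: "E \<in> sets borel" "E \<subseteq> {0..}"
  shows "emeasure (dim_prob \<mu>) E = emeasure \<mu> {x. pointwise_dim \<mu> x \<in> ereal ` E}"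
proof -
  interpret prob_space \<mu> using \<mu> by (simp add: cantor_measures_def)
  have prob: "prob_space \<mu>" by unfold_locales
  have sets: "sets \<mu> = sets borel" using \<mu> by (simp add: cantor_measures_def)
  have sp: "space \<mu> = UNIV" using sets_eq_imp_space_eq[OF sets] by simp
  let ?d = "pointwise_dim \<mu>"
  have meas [measurable]: "?d \<in> borel_measurable \<mu>"
    using measurable_pointwise_dim[OF prob] measurable_cong_sets[OF sets refl] by blast
  \<comment> \<open>Infinite dimension must be removed, since \<open>real_of_ereal\<close> sends it
    to 0 and would create spurious mass there.\<close>
  define F where "F = {x. ?d x \<in> {0..} - {\<infinity>}}"
  have F [measurable]: "F \<in> sets \<mu>"
    using measurable_sets[OF meas, of "{0..} - {\<infinity>}"] by (simp add: F_def vimage_def sp)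
  define N where "N = distr (density \<mu> (indicator F)) borel (\<lambda>x. real_of_ereal (?d x))"
  have N: "emeasure N A = emeasure \<mu> {x\<in>F. real_of_ereal (?d x) \<in> A}" if A: "A \<in> sets borel" for A
  proof -
    have A': "(\<lambda>x. real_of_ereal (?d x)) -` A \<inter> space \<mu> \<in> sets \<mu>"
      using A by (intro measurable_sets[where A = borel]) auto
    have "emeasure N A = emeasure (density \<mu> (indicator F)) ((\<lambda>x. real_of_ereal (?d x)) -` A \<inter> space \<mu>)"
      unfolding N_def using A by (subst emeasure_distr) auto
    also have "\<dots> = emeasure \<mu> (F \<inter> ((\<lambda>x. real_of_ereal (?d x)) -` A \<inter> space \<mu>))"
      using A' by (subst emeasure_density) (auto simp flip: indicator_inter_arith)
    finally show ?thesis by (simp add: sp Int_def vimage_def)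
  qed
  have dist: "Ddist \<mu> r = measure N {..r}" for r
  proof -
    have "{x. ?d x \<in> {0..ereal r}} = {x\<in>F. real_of_ereal (?d x) \<in> {..r}}"
    proof (intro Collect_cong)
      fix x show "?d x \<in> {0..ereal r} \<longleftrightarrow> x \<in> F \<and> real_of_ereal (?d x) \<in> {..r}"
        by (cases "?d x") (auto simp: F_def)
    qed
    then show ?thesis unfolding Ddist_def measure_def N[OF atMost_borel] by simp
  qed
  have finN: "finite_measure N"
    by (rule finite_measureI) (use N[of UNIV] in \<open>simp add: N_def\<close>)
  interpret N: finite_borel_measure N
    using finN by (simp add: finite_borel_measure_def finite_borel_measure_axioms_def N_def)
  have Dcdf: "Ddist \<mu> = cdf N" by (simp add: fun_eq_iff dist cdf_def)
  have "interval_measure (Ddist \<mu>) = N"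
  proof (rule measure_eqI_generator_eq[where \<Omega> = UNIV and E = "range (\<lambda>(a, b). {a<..b::real})" and A = "\<lambda>n. {- real n<..real n}"])
    show "Int_stable (range (\<lambda>(a, b). {a<..b::real}))" by (auto simp: Int_stable_def)
    have mono: "cdf N x \<le> cdf N y" if "x \<le> y" for x y using that by (rule N.cdf_nondecreasing)
    have Ioc: "emeasure (interval_measure (Ddist \<mu>)) {a<..b} = emeasure N {a<..b}" for a b
    proof (cases "a < b")
      case True
      have "emeasure (interval_measure (Ddist \<mu>)) {a<..b} = cdf N b - cdf N a"
        unfolding Dcdf by (rule emeasure_interval_measure_Ioc[OF less_imp_le[OF True] mono N.cdf_is_right_cont])
      then show ?thesis by (simp only: N.cdf_diff_eq[OF True] N.emeasure_eq_measure)
    qed simp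
    show "emeasure (interval_measure (Ddist \<mu>)) X = emeasure N X" if "X \<in> range (\<lambda>(a, b). {a<..b::real})" for X
      using that Ioc by auto
    have "sets borel = sigma_sets UNIV (range (\<lambda>(a, b). {a<..b::real}))"
      by (subst borel_sigma_sets_Ioc) (rule sets_measure_of, simp)
    then show "sets (interval_measure (Ddist \<mu>)) = sigma_sets UNIV (range (\<lambda>(a, b). {a<..b::real}))"
      "sets N = sigma_sets UNIV (range (\<lambda>(a, b). {a<..b::real}))"
      by (simp_all only: sets_interval_measure N_def sets_distr)
    show "range (\<lambda>n. {- real n<..real n}) \<subseteq> range (\<lambda>(a, b). {a<..b::real})" by auto
    show "(\<Union>n. {- real n<..real n}) = UNIV"
    proof (intro equalityI subsetI UNIV_I)
      fix x :: real
      obtain n where "\<bar>x\<bar> < real n" using reals_Archimedean2 by blast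
      then show "x \<in> (\<Union>n. {- real n<..real n})" by (intro UN_I[of n]) auto
    qed
    show "emeasure (interval_measure (Ddist \<mu>)) {- real n<..real n} \<noteq> \<infinity>" for n
      unfolding Ioc by (simp add: N.emeasure_eq_measure)
  qed auto
  then have "emeasure (dim_prob \<mu>) E = emeasure N E"
    unfolding dim_prob_def using E by (subst emeasure_restrict_space) auto
  also have "\<dots> = emeasure \<mu> {x\<in>F. real_of_ereal (?d x) \<in> E}" by (rule N[OF E(1)])
  also have "{x\<in>F. real_of_ereal (?d x) \<in> E} = {x. ?d x \<in> ereal ` E}"
  proof (intro Collect_cong)
    fix x show "x \<in> F \<and> real_of_ereal (?d x) \<in> E \<longleftrightarrow> ?d x \<in> ereal ` E"
      using E(2) by (cases "?d x") (auto simp: F_def image_iff)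
  qed
  finally show ?thesis .
qed

theorem theorem5p15:
  fixes \<mu> :: "(nat \<Rightarrow> bool) measure"
  assumes "neutral \<mu>"
  shows "\<exists>\<nu> (c::real). neutral_unit \<nu> \<and> c > 0 \<and>
    (\<forall>E \<in> sets borel. E \<subseteq> {0..1} \<longrightarrow>
      emeasure (dim_prob \<mu>) E \<ge> ennreal c * emeasure \<nu> E)"
proof -
  have \<mu>: "\<mu> \<in> cantor_measures" using assms by (simp add: neutral_def)
  interpret prob_space \<mu> using \<mu> by (simp add: cantor_measures_def)
  have prob: "prob_space \<mu>" by unfold_locales
  have sets: "sets \<mu> = sets borel" using \<mu> by (simp add: cantor_measures_def)
  have sp: "space \<mu> = UNIV" using sets_eq_imp_space_eq[OF sets] by simp
  interpret coin: prob_space coin by (rule prob_space_coin)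
  interpret Q: prob_space "blended \<mu>" using blended_in_cantor_measures[OF \<mu>] by (simp add: cantor_measures_def)
  obtain c where c: "c > 0" "\<And>A. A \<in> sets borel \<Longrightarrow> c * measure (blended \<mu>) A \<le> measure \<mu> A"
    using neutral_dominates_blended[OF assms] by blast
  \<comment> \<open>The constant is the one by which \<mu> dominates \<open>blended \<mu>\<close>;
    between \<open>blended \<mu>\<close> and the image measure nothing is lost.\<close>
  have "ennreal c * emeasure (binval_distr \<mu>) E \<le> emeasure (dim_prob \<mu>) E"
    if E: "E \<in> sets borel" "E \<subseteq> {0..1}" for E
  proof -
    let ?A = "{x. pointwise_dim \<mu> x \<in> ereal ` E}"
    have A: "?A \<in> sets borel"
    proof -
      have "ereal ` E = (real_of_ereal -` E \<inter> space borel) - {\<infinity>, - \<infinity>}"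
      proof (intro set_eqI)
        fix e show "e \<in> ereal ` E \<longleftrightarrow> e \<in> (real_of_ereal -` E \<inter> space borel) - {\<infinity>, - \<infinity>}"
          by (cases e) auto
      qed
      also have "\<dots> \<in> sets borel"
        using E(1) by (intro sets.Diff measurable_sets[where A = borel]) auto
      finally have "ereal ` E \<in> sets borel" .
      from measurable_sets[OF measurable_pointwise_dim[OF prob] this] show ?thesis
        by (simp add: vimage_def)
    qed
    have B: "binval -` E \<in> sets \<mu>"
      using measurable_sets[OF measurable_binval E(1)] by (simp add: sets)
    have "emeasure (binval_distr \<mu>) E = emeasure \<mu> (binval -` E)"
      unfolding binval_distr_def using E sp
      by (subst emeasure_distr[OF measurable_binval_unit[OF sets]]) (auto simp: sets_restrict_space_iff)
    also have "\<dots> = (\<integral>\<^sup>+ y. indicator (binval -` E) y \<partial>\<mu>)" using B by simp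
    \<comment> \<open>For \<open>y\<close> with value in \<open>E\<close> the inner probability is
      1, as almost every blended sequence has dimension exactly \<open>binval y\<close>.\<close>
    also have "\<dots> \<le> (\<integral>\<^sup>+ y. emeasure coin {z. blend y z \<in> ?A} \<partial>\<mu>)"
    proof (rule nn_integral_mono)
      fix y
      show "indicator (binval -` E) y \<le> emeasure coin {z. blend y z \<in> ?A}"
      proof (cases "binval y \<in> E")
        case True
        have "{z. blend y z \<in> ?A} \<in> sets coin"
          using measurable_sets[OF measurable_blend A, of y] by (simp add: vimage_def)
        moreover have "AE z in coin. blend y z \<in> ?A"
          using AE_pointwise_dim_blend[OF assms, of y] by eventually_elim (use True in auto)
        ultimately have "emeasure coin {z. blend y z \<in> ?A} = 1"
          by (intro coin.emeasure_eq_1_AE) auto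
        then show ?thesis by (simp add: indicator_def)
      qed simp
    qed
    also have "\<dots> = emeasure (blended \<mu>) ?A" by (rule emeasure_blended[OF \<mu> A, symmetric])
    finally have "ennreal c * emeasure (binval_distr \<mu>) E \<le> ennreal c * emeasure (blended \<mu>) ?A"
      by (intro mult_left_mono) auto
    also have "\<dots> = ennreal (c * measure (blended \<mu>) ?A)"
      using c(1) by (simp add: Q.emeasure_eq_measure ennreal_mult)
    also have "\<dots> \<le> emeasure \<mu> ?A"
      unfolding emeasure_eq_measure using c(2)[OF A] by (rule ennreal_leI)
    also have "\<dots> = emeasure (dim_prob \<mu>) E"
      using E by (intro dim_prob_eq[OF \<mu>, symmetric]) auto
    finally show ?thesis .
  qed
  then show ?thesis using neutral_unit_binval_distr[OF assms] c(1) by blast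
qed

end
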